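(* Let $\mathbf z_1,\dots,\mathbf z_n$ be a random sample from the distribution of a random vector $\mathbf z\in\mathbb R^p$ with mutually independent components having mean $0$ and variance $1$. Notation is as in the context. (i) Suppose $\mathbf z$ has finite sixth moments and at most one of $\gamma_1,\dots,\gamma_p$ is zero. Then there exists a sequence of deflation-based solutions $\hat{\mathbf W}$ based on skewness (that is, $\alpha=1$) such that $\hat{\mathbf W}\to_P\mathbf I_p$ and $$\sqrt n\,\hat w_{kl}=-\sqrt n\,\hat w_{lk}-\sqrt n\,\hat s_{kl}+o_P(1),\quad l<k,$$ $$\sqrt n(\hat w_{kk}-1)=-\tfrac12\sqrt n(\hat s_{kk}-1)+o_P(1),$$ $$\sqrt n\,\hat w_{kl}=\frac{\sqrt n\,\hat\psi_{1kl}}{\gamma_k^2}+o_P(1),\quad l>k,$$ where $\hat\psi_{1kl}=\gamma_k\hat r_{kl}-\gamma_k^2\hat s_{kl}$. (ii) Suppose $\mathbf z$ has finite eighth moments and at most one of $\kappa_1,\dots,\kappa_p$ is zero. Then there exists a sequence of deflation-based solutions $\hat{\mathbf W}$ based on kurtosis (that is, $\alpha=0$) such that $\hat{\mathbf W}\to_P\mathbf I_p$ and $$\sqrt n\,\hat w_{kl}=-\sqrt n\,\hat w_{lk}-\sqrt n\,\hat s_{kl}+o_P(1),\quad l<k,$$ $$\sqrt n(\hat w_{kk}-1)=-\tfrac12\sqrt n(\hat s_{kk}-1)+o_P(1),$$ $$\sqrt n\,\hat w_{kl}=\frac{\sqrt n\,\hat\psi_{2kl}}{\kappa_k^2}+o_P(1),\quad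 l>k,$$ where $\hat\psi_{2kl}=\kappa_k\hat q_{kl}-\kappa_k\beta_k\hat s_{kl}$. (iii) Suppose $\mathbf z$ has finite eighth moments and $\gamma_k=\kappa_k=0$ for at most one $k$. Then there exists a sequence of deflation-based solutions $\hat{\mathbf W}$ based on both skewness and kurtosis such that $\hat{\mathbf W}\to_P\mathbf I_p$ and $$\sqrt n\,\hat w_{kl}=-\sqrt n\,\hat w_{lk}-\sqrt n\,\hat s_{kl}+o_P(1),\quad l<k,$$ $$\sqrt n(\hat w_{kk}-1)=-\tfrac12\sqrt n(\hat s_{kk}-1)+o_P(1),$$ $$\sqrt n\,\hat w_{kl}=\frac{3\alpha\sqrt n\,\hat\psi_{1kl}+4(1-\alpha)\sqrt n\,\hat\psi_{2kl}}{3\alpha\gamma_k^2+4(1-\alpha)\kappa_k^2}+o_P(1),\quad l>k,$$ where $\alpha\in[0,1]$ is the proportion of weight given to skewness, and $\hat\psi_{1kl}$ and $\hat\psi_{2kl}$ are as in (i) and (ii).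
   Context: Moments: $\gamma_k=E(z_k^3)$, $\beta_k=E(z_k^4)$, $\kappa_k=\beta_k-3$, where $z_k$ is the $k$th component of $\mathbf z$. Write $\mathbf z_i=(z_{i1},\dots,z_{ip})^T$ and $$\hat s_{kl}=\frac1n\sum_{i=1}^n z_{ik}z_{il},\quad \hat r_{kl}=\frac1n\sum_{i=1}^n(z_{ik}^2-1)z_{il},\quad \hat q_{kl}=\frac1n\sum_{i=1}^n(z_{ik}^3-\gamma_k)z_{il}.$$ Deflation-based projection pursuit functional with weight $\alpha\in[0,1]$ (the proportion of weight given to third cumulants, i.e. skewness): for a random vector $\mathbf x$ with covariance matrix $\boldsymbol\Sigma$ and standardized version $\mathbf x_{st}=\boldsymbol\Sigma^{-1/2}(\mathbf x-E\mathbf x)$ (symmetric positive definite root), the functional is $\mathbf W=\mathbf U\boldsymbol\Sigma^{-1/2}$, where the rows of the orthogonal matrix $\mathbf U=(\mathbf u_1,\dots,\mathbf u_p)^T$ are found one by one, $\mathbf u_k$ maximizing $\alpha\gamma^2(\mathbf u^T\mathbf x_{st})+(1-\alpha)\kappa^2(\mathbf u^T\mathbf x_{st})$ over unit vectors $\mathbf u$ orthogonal to $\mathbf u_1,\dots,\mathbf u_{k-1}$, with $\gamma(y)$ and $\kappa(y)$ the third moment and the fourth moment minus $3$ of the standardized version of $y$. The estimating equations obtained from this maximization problem are $(\mathbf I_p-\sum_{j=1}^k\mathbf u_j\mathbf u_j^T)\mathbf T_k=\mathbf 0$, $k=1,\dots,p$, with $$\mathbf T_k=3\alpha E[(\mathbf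 u_k^T\mathbf x_{st})^3]E[(\mathbf u_k^T\mathbf x_{st})^2\mathbf x_{st}]+4(1-\alpha)\left(E[(\mathbf u_k^T\mathbf x_{st})^4]-3\right)E[(\mathbf u_k^T\mathbf x_{st})^3\mathbf x_{st}].$$ A deflation-based solution $\hat{\mathbf W}=(\hat w_{kl})$ is the sample version of this functional, i.e. the functional applied to the empirical distribution of $\mathbf z_1,\dots,\mathbf z_n$: $\hat{\mathbf W}=\hat{\mathbf U}\hat{\boldsymbol\Sigma}^{-1/2}$ with $\bar{\mathbf z}=\frac1n\sum_i\mathbf z_i$, $\hat{\boldsymbol\Sigma}=\frac1n\sum_i(\mathbf z_i-\bar{\mathbf z})(\mathbf z_i-\bar{\mathbf z})^T$, and $\hat{\mathbf U}$ obtained with expectations over $\mathbf x_{st}$ replaced by averages over $\hat{\boldsymbol\Sigma}^{-1/2}(\mathbf z_i-\bar{\mathbf z})$, $i=1,\dots,n$. Limits are as $n\to\infty$.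
   Formalization: Formal version requires the denominator in the l>k expansion to be nonzero for every k<p (a vanishing component must be last); solutions are local maximizers solving the estimating equations, and global maximizers when the components are strictly ordered by decreasing projection index. *)

theory Defs
  imports "HOL-Probability.Probability"
begin

section \<open>The deflation-based functional\<close>

text \<open>
  All functionals below take a random variable together with the probability measure it lives on.
  They are used both for the population and, by taking the uniform distribution on the sample
  indices, for the empirical distribution of a sample.

  The index type \<open>'p\<close> of the coordinates is a finite linear order: the rows of an unmixing matrix
  are found one after another in this order.
\<close>

definition mean_vec :: "'a measure \<Rightarrow> ('a \<Rightarrow> real^'p) \<Rightarrow> real^'p" where
  "mean_vec P x = (\<chi> k. LINT i|P. x i $ k)"

definition cov_mat :: "'a measure \<Rightarrow> ('a \<Rightarrow> real^'p) \<Rightarrow> real^'p^'p" where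
  "cov_mat P x = (\<chi> k l. LINT i|P. (x i - mean_vec P x) $ k * (x i - mean_vec P x) $ l)"

definition sym_pos_def :: "real^'p^'p \<Rightarrow> bool" where
  "sym_pos_def A \<longleftrightarrow> transpose A = A \<and> (\<forall>v. v \<noteq> 0 \<longrightarrow> v \<bullet> (A *v v) > 0)"

text \<open>Meaningful only for symmetric positive definite \<open>A\<close>; for those the root exists and is unique.\<close>

definition inv_sqrt_mat :: "real^'p^'p \<Rightarrow> real^'p^'p" where
  "inv_sqrt_mat A = (THE S. sym_pos_def S \<and> S ** S = matrix_inv A)"

definition standardize_vec :: "'a measure \<Rightarrow> ('a \<Rightarrow> real^'p) \<Rightarrow> 'a \<Rightarrow> real^'p" where
  "standardize_vec P x i = inv_sqrt_mat (cov_mat P x) *v (x i - mean_vec P x)"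

definition standardize :: "'a measure \<Rightarrow> ('a \<Rightarrow> real) \<Rightarrow> 'a \<Rightarrow> real" where
  "standardize P y i = (y i - (LINT j|P. y j)) / sqrt (LINT j|P. (y j - (LINT j|P. y j))\<^sup>2)"

definition skewness :: "'a measure \<Rightarrow> ('a \<Rightarrow> real) \<Rightarrow> real" where
  "skewness P y = (LINT i|P. standardize P y i ^ 3)"

definition excess_kurtosis :: "'a measure \<Rightarrow> ('a \<Rightarrow> real) \<Rightarrow> real" where
  "excess_kurtosis P y = (LINT i|P. standardize P y i ^ 4) - 3"

definition proj_index :: "real \<Rightarrow> 'a measure \<Rightarrow> ('a \<Rightarrow> real^'p) \<Rightarrow> real^'p \<Rightarrow> real" where
  "proj_index \<alpha> P x u =
     \<alpha> * (skewness P (\<lambda>i. u \<bullet> standardize_vec P x i))\<^sup>2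
     + (1 - \<alpha>) * (excess_kurtosis P (\<lambda>i. u \<bullet> standardize_vec P x i))\<^sup>2"

definition feasible_dirs ::
    "real^('p::{finite,linorder})^('p::{finite,linorder}) \<Rightarrow> 'p \<Rightarrow> (real^('p::{finite,linorder})) set" where
  "feasible_dirs U k = {u. norm u = 1 \<and> (\<forall>j<k. u \<bullet> U $ j = 0)}"

definition estimating_vec ::
    "real \<Rightarrow> 'a measure \<Rightarrow> ('a \<Rightarrow> real^'p) \<Rightarrow> real^'p \<Rightarrow> real^'p" where
  "estimating_vec \<alpha> P x u = (let y = standardize_vec P x in
     (3 * \<alpha> * (LINT i|P. (u \<bullet> y i) ^ 3)) *\<^sub>R (\<chi> m. LINT i|P. (u \<bullet> y i)\<^sup>2 * y i $ m)
     + (4 * (1 - \<alpha>) * ((LINT i|P. (u \<bullet> y i) ^ 4) - 3)) *\<^sub>R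
         (\<chi> m. LINT i|P. (u \<bullet> y i) ^ 3 * y i $ m))"

definition estimating_eqs ::
    "real \<Rightarrow> 'a measure \<Rightarrow> ('a \<Rightarrow> real^('p::{finite,linorder})) \<Rightarrow>
     real^('p::{finite,linorder})^('p::{finite,linorder}) \<Rightarrow> bool" where
  "estimating_eqs \<alpha> P x U \<longleftrightarrow>
     (\<forall>k. (mat 1 - (\<Sum>j\<in>{..k}. (\<chi> a b. U $ j $ a * U $ j $ b))) *v
            estimating_vec \<alpha> P x (U $ k) = 0)"

text \<open>
  A solution is obtained from rows which, one after another, are local maximizers of the projection
  index under the constraints and solve the estimating equations.  Which local maximizer is
  found at each step determines the order and the signs of the recovered components.  Restricting
  to global maximizers would exclude solutions converging to the identity unless the components
  happen to be labelled by decreasing value of the projection index, without ties; the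
  globally maximizing solutions are singled out by \<open>deflation_maximizer\<close>.
\<close>

definition deflation_solution ::
    "real \<Rightarrow> 'a measure \<Rightarrow> ('a \<Rightarrow> real^('p::{finite,linorder})) \<Rightarrow>
     real^('p::{finite,linorder})^('p::{finite,linorder}) \<Rightarrow> bool" where
  "deflation_solution \<alpha> P x W \<longleftrightarrow>
     (\<exists>U. orthogonal_matrix U \<and>
          (\<forall>k. \<exists>e>0. \<forall>u \<in> feasible_dirs U k. dist u (U $ k) < e \<longrightarrow>
                  proj_index \<alpha> P x u \<le> proj_index \<alpha> P x (U $ k)) \<and>
          estimating_eqs \<alpha> P x U \<and>
          W = U ** inv_sqrt_mat (cov_mat P x))"

definition deflation_maximizer ::
    "real \<Rightarrow> 'a measure \<Rightarrow> ('a \<Rightarrow> real^('p::{finite,linorder})) \<Rightarrow>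
     real^('p::{finite,linorder})^('p::{finite,linorder}) \<Rightarrow> bool" where
  "deflation_maximizer \<alpha> P x W \<longleftrightarrow>
     (\<exists>U. orthogonal_matrix U \<and>
          (\<forall>k. \<forall>u \<in> feasible_dirs U k. proj_index \<alpha> P x u \<le> proj_index \<alpha> P x (U $ k)) \<and>
          W = U ** inv_sqrt_mat (cov_mat P x))"


section \<open>Sample versions\<close>

text \<open>
  A sample of size \<open>n\<close> is \<open>Z 0, \<dots>, Z (n - 1)\<close>.  Under \<open>emp n\<close> the map \<open>\<lambda>i. Z i \<omega>\<close> has the
  empirical distribution of the sample, and integration is averaging over the sample.
\<close>

definition emp :: "nat \<Rightarrow> nat measure" where
  "emp n = uniform_count_measure {..<n}"

text \<open>
  The root of the inverse sample covariance matrix, hence the functional at the empirical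
  distribution, is defined only where that matrix is invertible.
\<close>

definition sample_solutions ::
    "'w measure \<Rightarrow> (nat \<Rightarrow> 'w \<Rightarrow> real^('p::{finite,linorder})) \<Rightarrow> real \<Rightarrow>
     (nat \<Rightarrow> 'w \<Rightarrow> real^('p::{finite,linorder})^('p::{finite,linorder})) \<Rightarrow> bool" where
  "sample_solutions M Z \<alpha> W \<longleftrightarrow>
     (\<forall>n. W n \<in> borel_measurable M \<and>
       (\<forall>\<omega>\<in>space M. invertible (cov_mat (emp n) (\<lambda>i. Z i \<omega>)) \<longrightarrow>
          deflation_solution \<alpha> (emp n) (\<lambda>i. Z i \<omega>) (W n \<omega>)))"

definition sample_maximizers ::
    "'w measure \<Rightarrow> (nat \<Rightarrow> 'w \<Rightarrow> real^('p::{finite,linorder})) \<Rightarrow> real \<Rightarrow>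
     (nat \<Rightarrow> 'w \<Rightarrow> real^('p::{finite,linorder})^('p::{finite,linorder})) \<Rightarrow> bool" where
  "sample_maximizers M Z \<alpha> W \<longleftrightarrow>
     (\<forall>n. \<forall>\<omega>\<in>space M. invertible (cov_mat (emp n) (\<lambda>i. Z i \<omega>)) \<longrightarrow>
        deflation_maximizer \<alpha> (emp n) (\<lambda>i. Z i \<omega>) (W n \<omega>))"

definition s_hat :: "(nat \<Rightarrow> 'w \<Rightarrow> real^'p) \<Rightarrow> nat \<Rightarrow> 'p \<Rightarrow> 'p \<Rightarrow> 'w \<Rightarrow> real" where
  "s_hat Z n k l \<omega> = (\<Sum>i<n. Z i \<omega> $ k * Z i \<omega> $ l) / real n"

definition r_hat :: "(nat \<Rightarrow> 'w \<Rightarrow> real^'p) \<Rightarrow> nat \<Rightarrow> 'p \<Rightarrow> 'p \<Rightarrow> 'w \<Rightarrow> real" where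
  "r_hat Z n k l \<omega> = (\<Sum>i<n. ((Z i \<omega> $ k)\<^sup>2 - 1) * Z i \<omega> $ l) / real n"

definition q_hat :: "('p \<Rightarrow> real) \<Rightarrow> (nat \<Rightarrow> 'w \<Rightarrow> real^'p) \<Rightarrow> nat \<Rightarrow> 'p \<Rightarrow> 'p \<Rightarrow> 'w \<Rightarrow> real" where
  "q_hat \<gamma> Z n k l \<omega> = (\<Sum>i<n. ((Z i \<omega> $ k) ^ 3 - \<gamma> k) * Z i \<omega> $ l) / real n"

definition psi1_hat :: "('p \<Rightarrow> real) \<Rightarrow> (nat \<Rightarrow> 'w \<Rightarrow> real^'p) \<Rightarrow> nat \<Rightarrow> 'p \<Rightarrow> 'p \<Rightarrow> 'w \<Rightarrow> real" where
  "psi1_hat \<gamma> Z n k l \<omega> = \<gamma> k * r_hat Z n k l \<omega> - (\<gamma> k)\<^sup>2 * s_hat Z n k l \<omega>"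

definition psi2_hat ::
    "('p \<Rightarrow> real) \<Rightarrow> ('p \<Rightarrow> real) \<Rightarrow> (nat \<Rightarrow> 'w \<Rightarrow> real^'p) \<Rightarrow> nat \<Rightarrow> 'p \<Rightarrow> 'p \<Rightarrow> 'w \<Rightarrow> real" where
  "psi2_hat \<gamma> \<beta> Z n k l \<omega> =
     (\<beta> k - 3) * q_hat \<gamma> Z n k l \<omega> - (\<beta> k - 3) * \<beta> k * s_hat Z n k l \<omega>"


section \<open>Convergence in probability\<close>

definition tendsto_prob ::
    "'w measure \<Rightarrow> (nat \<Rightarrow> 'w \<Rightarrow> 'b::metric_space) \<Rightarrow> 'b \<Rightarrow> bool" where
  "tendsto_prob M X c \<longleftrightarrow>
     (\<forall>e>0. (\<lambda>n. measure M {\<omega> \<in> space M. dist (X n \<omega>) c > e}) \<longlonglongrightarrow> 0)"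

text \<open>\<open>X = Y + o_P(1)\<close>\<close>

definition eq_up_to_oP :: "'w measure \<Rightarrow> (nat \<Rightarrow> 'w \<Rightarrow> real) \<Rightarrow> (nat \<Rightarrow> 'w \<Rightarrow> real) \<Rightarrow> bool" where
  "eq_up_to_oP M X Y \<longleftrightarrow> tendsto_prob M (\<lambda>n \<omega>. X n \<omega> - Y n \<omega>) 0"

end

theory Submission
  imports Defs "HOL-Library.Landau_Symbols"
begin

text \<open>
  Write \<open>W = U ** S\<close> with \<open>S\<close> the inverse root of the sample covariance matrix \<open>C\<close>.  Solutions near the
  identity are found by maximizing the sample index, row by row, over a cap around the \<open>k\<close>-th axis (over
  the whole sphere if the components are ordered), with a measurable choice of the maximizer.  On unit
  vectors the population index is at most \<open>\<Sum>a. u $ a ^ 4 * contrast a\<close>, so the \<open>k\<close>-th axis is a strict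
  maximizer under the constraints, and uniform convergence of the sample index gives consistency.

  For the expansion, the estimating equations are multiplied by the inverse of \<open>S\<close>: with \<open>t\<^sub>k\<close> half the gradient
  of the index computed from the centered, unstandardized sample at \<open>W $ k\<close>, they read
  \<open>t\<^sub>k = (\<Sum>j\<le>k. (W $ j \<bullet> t\<^sub>k) *\<^sub>R (C *v W $ j))\<close>, while \<open>W ** C ** transpose W = mat 1\<close>.  Independence makes almost
  all linear terms vanish, so both sides can be linearized in \<open>W - mat 1\<close> up to \<open>o(Q)\<close>, where \<open>Q\<close> is the sum
  of the absolute values of the moments \<open>R\<close> entering the limits and of the error \<open>W - mat 1\<close> itself; this
  gives \<open>Q = O(R)\<close>, and \<open>R\<close> is of order \<open>1 / sqrt n\<close> in probability by Chebyshev's inequality.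
\<close>

section \<open>Square roots of positive definite matrices\<close>

text \<open>Solutions have to be measurable, yet \<open>inv_sqrt_mat\<close> is a definite
  description and maximizers need not be unique. So the root is rebuilt as a limit of polynomials in
  the entries of an inverse given by Cramer's rule, and every choice of a maximizer is made through
  measurable value functions.

  The width of a cap comes from comparing \<open>c * (1 - t)^2 + B * t^2\<close> with
  \<open>c\<close>, where \<open>c\<close> is the contrast of the row, \<open>B\<close> bounds the
  later contrasts and \<open>t\<close> is the weight on later coordinates: the former is smaller as
  long as \<open>0 < t\<close> and \<open>t * (c + B) < 2 * c\<close>. If a later contrast exceeds
  \<open>c\<close>, large \<open>t\<close> have to be cut off, and a global maximizer would find the
  wrong component.

  The equation of row \<open>k\<close> yields the entries right of the diagonal after division by
  \<open>den k\<close>; orthonormality yields the others. The last row has no such entries, so a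
  component on which the index vanishes may stand only there. This is the role of the conditions on
  \<open>k < l\<close>.

  All cases are treated at once, with \<open>deg\<close> half the order of the available moments.
  Quartic averages carry the factor \<open>1 - \<alpha>\<close>, which removes them when only sixth
  moments are assumed.\<close>

lemma matrix_diff_ldistrib: "A ** (B - C) = A ** B - A ** (C :: real^'k^'m)"
  by (simp add: matrix_matrix_mult_def vec_eq_iff algebra_simps sum_subtractf)

lemma matrix_diff_rdistrib: "(B - C) ** A = B ** A - C ** (A :: real^'k^'m)"
  by (simp add: matrix_matrix_mult_def vec_eq_iff algebra_simps sum_subtractf)

lemma matrix_inv_mult:
  fixes A :: "real^'n^'n"
  assumes "invertible A"
  shows "A ** matrix_inv A = mat 1" "matrix_inv A ** A = mat 1"
  using someI_ex[OF assms[unfolded invertible_def]] by (auto simp: matrix_inv_def)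

lemma transpose_plus: "transpose (A + B) = transpose A + transpose (B :: real^'m^'n)"
  by (simp add: transpose_def vec_eq_iff)

section \<open>Limits and measurability of matrix operations\<close>

lemma tendsto_matrix_mult:
  fixes f :: "'a \<Rightarrow> real^'m^'n" and g :: "'a \<Rightarrow> real^'k^'m"
  assumes "(f \<longlongrightarrow> A) F" "(g \<longlongrightarrow> B) F"
  shows "((\<lambda>x. f x ** g x) \<longlongrightarrow> A ** B) F"
  unfolding matrix_matrix_mult_def
  by (intro vec_tendstoI) (auto intro!: tendsto_intros assms)

lemma tendsto_matrix_vector_mult:
  fixes f :: "'a \<Rightarrow> real^'m^'n" and g :: "'a \<Rightarrow> real^'m"
  assumes "(f \<longlongrightarrow> A) F" "(g \<longlongrightarrow> v) F"
  shows "((\<lambda>x. f x *v g x) \<longlongrightarrow> A *v v) F"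
  unfolding matrix_vector_mult_def
  by (intro vec_tendstoI) (auto intro!: tendsto_intros assms)

lemma tendsto_transpose:
  fixes f :: "'a \<Rightarrow> real^'m^'n"
  assumes "(f \<longlongrightarrow> A) F"
  shows "((\<lambda>x. transpose (f x)) \<longlongrightarrow> transpose A) F"
  unfolding transpose_def by (intro vec_tendstoI) (auto intro!: tendsto_intros assms)

lemma borel_measurable_vec_nth [measurable]: "(\<lambda>x::('b::real_normed_vector)^'n. x $ i) \<in> borel_measurable borel"
  by (intro borel_measurable_continuous_onI continuous_intros)

lemma borel_measurable_vecI:
  fixes f :: "'a \<Rightarrow> ('b::euclidean_space)^'n"
  assumes "\<And>i. (\<lambda>x. f x $ i) \<in> borel_measurable M"
  shows "f \<in> borel_measurable M"
  by (rule borel_measurable_euclidean_space[THEN iffD2])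
    (auto simp: Basis_vec_def inner_axis intro!: borel_measurable_inner assms)

lemma borel_measurable_matrix_mult:
  fixes f :: "'a \<Rightarrow> real^'m^'n" and g :: "'a \<Rightarrow> real^'k^'m"
  assumes [measurable]: "f \<in> borel_measurable M" "g \<in> borel_measurable M"
  shows "(\<lambda>x. f x ** g x) \<in> borel_measurable M"
  unfolding matrix_matrix_mult_def
  by (intro borel_measurable_vecI) simp

lemma borel_measurable_matrix_vector_mult:
  fixes f :: "'a \<Rightarrow> real^'m^'n" and g :: "'a \<Rightarrow> real^'m"
  assumes [measurable]: "f \<in> borel_measurable M" "g \<in> borel_measurable M"
  shows "(\<lambda>x. f x *v g x) \<in> borel_measurable M"
  unfolding matrix_vector_mult_def
  by (intro borel_measurable_vecI) simp

section \<open>Quadratic forms and operator bounds\<close>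

lemma symmetric_matrix_inner:
  fixes A :: "real^'n^'n"
  assumes "transpose A = A"
  shows "(A *v x) \<bullet> y = x \<bullet> (A *v y)"
  by (metis assms dot_lmul_matrix transpose_matrix_vector)

text \<open>The norm of a matrix is the Euclidean norm of its entries, and an operator bound
  controls each entry as a coordinate of the image of an axis. The dimension factors are crude, but
  only the summability of a geometric series is at stake.\<close>

lemma matrix_norm_le:
  fixes A :: "real^'m^'n"
  assumes "\<And>v. norm (A *v v) \<le> K * norm v"
  shows "norm A \<le> real CARD('n) * (real CARD('m) * K)"
proof -
  have e: "\<bar>A $ i $ j\<bar> \<le> K" for i j
  proof -
    have "\<bar>A $ i $ j\<bar> = \<bar>(A *v axis j 1) $ i\<bar>"
      by (simp add: matrix_vector_mult_basis column_def)
    also have "\<dots> \<le> norm (A *v axis j 1)" by (rule component_le_norm_cart)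
    also have "\<dots> \<le> K" using assms[of "axis j 1"] by simp
    finally show ?thesis .
  qed
  have "norm A \<le> (\<Sum>i\<in>UNIV. norm (A $ i))"
    unfolding norm_vec_def by (rule L2_set_le_sum) simp
  also have "\<dots> \<le> (\<Sum>i\<in>(UNIV::'n set). real CARD('m) * K)"
  proof (rule sum_mono)
    fix i
    have "norm (A $ i) \<le> (\<Sum>j\<in>UNIV. \<bar>A $ i $ j\<bar>)" by (rule norm_le_l1_cart)
    also have "\<dots> \<le> (\<Sum>j\<in>(UNIV::'m set). K)" by (intro sum_mono e)
    finally show "norm (A $ i) \<le> real CARD('m) * K" by simp
  qed
  finally show ?thesis by simp
qed

text \<open>A bound that is explicit in the entries, so that the scale chosen in
  \<open>root_mat\<close> is a measurable function of the matrix.\<close>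

lemma quadratic_form_le:
  fixes A :: "real^'n^'n"
  shows "\<bar>v \<bullet> (A *v v)\<bar> \<le> (\<Sum>i\<in>UNIV. \<Sum>j\<in>UNIV. \<bar>A $ i $ j\<bar>) * (norm v)\<^sup>2"
proof -
  have "\<bar>v \<bullet> (A *v v)\<bar> = \<bar>\<Sum>i\<in>UNIV. \<Sum>j\<in>UNIV. v $ i * (A $ i $ j * v $ j)\<bar>"
    by (simp add: inner_vec_def matrix_vector_mult_def sum_distrib_left)
  also have "\<dots> \<le> (\<Sum>i\<in>UNIV. \<Sum>j\<in>UNIV. \<bar>v $ i * (A $ i $ j * v $ j)\<bar>)"
    by (intro order_trans[OF sum_abs] sum_mono order_trans[OF sum_abs]) simp
  also have "\<dots> \<le> (\<Sum>i\<in>UNIV. \<Sum>j\<in>UNIV. \<bar>A $ i $ j\<bar> * (norm v)\<^sup>2)"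
  proof (intro sum_mono)
    fix i j
    have "\<bar>v $ i\<bar> * \<bar>v $ j\<bar> \<le> norm v * norm v"
      by (intro mult_mono component_le_norm_cart) auto
    then have "\<bar>A $ i $ j\<bar> * (\<bar>v $ i\<bar> * \<bar>v $ j\<bar>) \<le> \<bar>A $ i $ j\<bar> * (norm v)\<^sup>2"
      by (intro mult_left_mono) (auto simp: power2_eq_square)
    then show "\<bar>v $ i * (A $ i $ j * v $ j)\<bar> \<le> \<bar>A $ i $ j\<bar> * (norm v)\<^sup>2"
      by (simp add: abs_mult mult_ac)
  qed
  finally show ?thesis by (simp add: sum_distrib_right)
qed

text \<open>Polarization takes the place of eigenvalues: for unit vectors,
  \<open>4 * (y \<bullet> (B *v x))\<close> is the difference of the forms at \<open>x + y\<close>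
  and \<open>x - y\<close>, and the parallelogram law bounds it by \<open>4 * \<beta>\<close>.
  Taking \<open>y\<close> in the direction of the image of \<open>x\<close> turns this into a bound
  on the norm of that image.\<close>

lemma symmetric_norm_le:
  fixes B :: "real^'n^'n"
  assumes sym: "transpose B = B" and b: "\<And>v. \<bar>v \<bullet> (B *v v)\<bar> \<le> \<beta> * (norm v)\<^sup>2" and "0 \<le> \<beta>"
  shows "norm (B *v v) \<le> \<beta> * norm v"
proof (cases "v = 0 \<or> B *v v = 0")
  case True
  then show ?thesis using \<open>0 \<le> \<beta>\<close> by auto
next
  case False
  define x where "x = v /\<^sub>R norm v"
  define y where "y = (B *v v) /\<^sub>R norm (B *v v)"
  have n: "norm x = 1" "norm y = 1" using False by (auto simp: x_def y_def)
  have "(x + y) \<bullet> (B *v (x + y)) - (x - y) \<bullet> (B *v (x - y)) = 2 * (y \<bullet> (B *v x)) + 2 * (x \<bullet> (B *v y))"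
    by (simp add: matrix_vector_right_distrib matrix_vector_mult_diff_distrib inner_add_left
        inner_add_right inner_diff_left inner_diff_right)
  also have "x \<bullet> (B *v y) = y \<bullet> (B *v x)"
    using symmetric_matrix_inner[OF sym, of x y] by (simp add: inner_commute)
  finally have "4 * (y \<bullet> (B *v x)) = (x + y) \<bullet> (B *v (x + y)) - (x - y) \<bullet> (B *v (x - y))" by simp
  also have "\<dots> \<le> \<beta> * (norm (x + y))\<^sup>2 + \<beta> * (norm (x - y))\<^sup>2"
    using b[of "x + y"] b[of "x - y"] by linarith
  also have "\<dots> = \<beta> * 4"
    using n by (simp add: power2_norm_eq_inner inner_add_left inner_add_right inner_diff_left
        inner_diff_right inner_commute algebra_simps norm_eq_1)
  finally have le: "y \<bullet> (B *v x) \<le> \<beta>" by simp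
  have "y \<bullet> (B *v x) = norm (B *v v) / norm v"
    using False
    by (simp add: x_def y_def matrix_vector_mult_scaleR inner_commute dot_square_norm power2_eq_square field_simps)
  with le show ?thesis using False by (simp add: field_simps)
qed

lemma positive_definite_lower_bound:
  fixes A :: "real^'n^'n"
  assumes "sym_pos_def A"
  obtains m where "m > 0" "\<And>v. m * (norm v)\<^sup>2 \<le> v \<bullet> (A *v v)"
proof -
  have cont: "continuous_on (sphere 0 1) (\<lambda>v. v \<bullet> (A *v v))"
    by (intro continuous_intros linear_continuous_on matrix_vector_mul_bounded_linear)
  have "sphere (0::real^'n) 1 \<noteq> {}" by simp
  from continuous_attains_inf[OF compact_sphere this cont]
  obtain x where x: "x \<in> sphere 0 1" and min: "\<And>y. y \<in> sphere 0 1 \<Longrightarrow> x \<bullet> (A *v x) \<le> y \<bullet> (A *v y)" by auto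
  have pos: "x \<bullet> (A *v x) > 0"
    using assms x unfolding sym_pos_def_def by (metis dist_0_norm mem_sphere norm_zero zero_neq_one)
  have "(x \<bullet> (A *v x)) * (norm v)\<^sup>2 \<le> v \<bullet> (A *v v)" for v
  proof (cases "v = 0")
    case False
    have "x \<bullet> (A *v x) \<le> (v /\<^sub>R norm v) \<bullet> (A *v (v /\<^sub>R norm v))"
      by (rule min) (use False in auto)
    also have "\<dots> = (v \<bullet> (A *v v)) / (norm v)\<^sup>2"
      by (simp add: matrix_vector_mult_scaleR power2_eq_square divide_simps)
    finally show ?thesis using False by (simp add: field_simps)
  qed simp
  with pos show thesis by (rule that)
qed

text \<open>With \<open>D = S - T\<close> the hypothesis reads \<open>S ** D + D ** T = 0\<close>.
  Multiplied by \<open>D\<close>, its trace is the sum of the nonnegative traces of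
  \<open>D ** S ** D\<close> and \<open>D ** T ** D\<close>, so both vanish; definiteness of
  \<open>S\<close> then kills every column of \<open>D\<close>. No diagonalization is
  involved.\<close>

lemma sym_pos_def_unique_root:
  fixes S T :: "real^'n^'n"
  assumes S: "sym_pos_def S" and T: "sym_pos_def T" and eq: "S ** S = T ** T"
  shows "S = T"
proof -
  define D where "D = S - T"
  have sym: "transpose S = S" "transpose T = T" using S T by (auto simp: sym_pos_def_def)
  have symD: "transpose D = D" using sym by (simp add: D_def transpose_def vec_eq_iff)
  have "S ** D + D ** T = 0"
    using eq by (simp add: D_def matrix_diff_ldistrib matrix_diff_rdistrib)
  then have "D ** (S ** D) + D ** (D ** T) = 0"
    by (metis matrix_add_ldistrib matrix_mul_lid mult_not_zero matrix_vector_mult_0 times0_right)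
  then have "trace (D ** (S ** D)) + trace (D ** (D ** T)) = 0"
    by (metis trace_add trace_0 mat_0)
  moreover have "trace (D ** (D ** T)) = trace (D ** (T ** D))"
    using trace_mul_sym[of D "D ** T"] by (simp add: matrix_mul_assoc)
  moreover have tr: "trace (D ** (R ** D)) = (\<Sum>j\<in>UNIV. (D *v axis j 1) \<bullet> (R *v (D *v axis j 1)))" for R
  proof -
    have "(D ** (R ** D)) $ j $ j = (D *v axis j 1) \<bullet> (R *v (D *v axis j 1))" for j
    proof -
      have "(D ** (R ** D)) $ j $ j = ((D ** (R ** D)) *v axis j 1) $ j"
        by (simp add: matrix_vector_mult_basis column_def)
      also have "\<dots> = axis j 1 \<bullet> (D *v (R *v (D *v axis j 1)))"
        by (simp add: matrix_vector_mul_assoc inner_axis')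
      also have "\<dots> = (D *v axis j 1) \<bullet> (R *v (D *v axis j 1))"
        by (rule symmetric_matrix_inner[OF symD, symmetric])
      finally show ?thesis .
    qed
    then show ?thesis by (simp add: trace_def)
  qed
  have nn: "0 \<le> v \<bullet> (S *v v)" "0 \<le> v \<bullet> (T *v v)" for v
    using S T unfolding sym_pos_def_def by (cases "v = 0"; force simp: less_imp_le)+
  have "0 \<le> trace (D ** (S ** D))" "0 \<le> trace (D ** (T ** D))"
    unfolding tr by (intro sum_nonneg nn)+
  ultimately have "trace (D ** (S ** D)) = 0" by linarith
  then have "(D *v axis j 1) \<bullet> (S *v (D *v axis j 1)) = 0" for j
    unfolding tr by (subst (asm) sum_nonneg_eq_0_iff) (auto intro: nn)
  then have "D *v axis j 1 = 0" for j
    using S unfolding sym_pos_def_def by (metis less_irrefl)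
  then have "D = 0" by (simp add: matrix_vector_mult_basis column_def vec_eq_iff)
  then show ?thesis by (simp add: D_def)
qed

text \<open>If the iteration converges to \<open>X\<close> then \<open>(mat 1 - X)\<^sup>2 = mat 1 - B\<close>.\<close>

fun sqrt_iter :: "real^'n^'n \<Rightarrow> nat \<Rightarrow> real^'n^'n" where
  "sqrt_iter B 0 = 0"
| "sqrt_iter B (Suc n) = (1/2) *\<^sub>R (B + sqrt_iter B n ** sqrt_iter B n)"

text \<open>The scale \<open>c\<close> dominates the form of \<open>A\<close> on unit vectors, so
  that \<open>mat 1 - (1/c) *\<^sub>R A\<close> is a strict contraction when \<open>A\<close> is
  positive definite. The iterates are polynomials in the entries, and their \<open>lim\<close> is
  measurable also where the iteration diverges.\<close>

definition root_mat :: "real^'n^'n \<Rightarrow> real^'n^'n" where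
  "root_mat A = (let c = 1 + (\<Sum>i\<in>UNIV. \<Sum>j\<in>UNIV. \<bar>A $ i $ j\<bar>) in
     sqrt c *\<^sub>R (mat 1 - lim (sqrt_iter (mat 1 - (1/c) *\<^sub>R A))))"

lemma borel_measurable_root_mat:
  fixes f :: "'a \<Rightarrow> real^'n^'n"
  assumes [measurable]: "f \<in> borel_measurable M"
  shows "(\<lambda>x. root_mat (f x)) \<in> borel_measurable M"
proof -
  have it: "(\<lambda>x. sqrt_iter (g x) k) \<in> borel_measurable M"
    if [measurable]: "g \<in> borel_measurable M" for k and g :: "'a \<Rightarrow> real^'n^'n"
  proof (induction k)
    case (Suc k)
    note borel_measurable_matrix_mult[OF Suc Suc, measurable]
    show ?case by simp
  qed simp
  show ?thesis unfolding root_mat_def Let_def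
    by (intro borel_measurable_scaleR borel_measurable_diff borel_measurable_lim_metric it) simp_all
qed

text \<open>The bound survives a step because
  \<open>(\<beta> + \<beta> * \<beta>) / 2 \<le> \<beta>\<close>.\<close>

lemma sqrt_iter_norm:
  assumes "\<And>v. norm (B *v v) \<le> \<beta> * norm v" "0 \<le> \<beta>" "\<beta> < 1"
  shows "norm (sqrt_iter B n *v v) \<le> \<beta> * norm v"
proof (induction n arbitrary: v)
  case (Suc n)
  have "norm (sqrt_iter B (Suc n) *v v) = (1/2) * norm (B *v v + sqrt_iter B n *v (sqrt_iter B n *v v))"
    by (simp add: matrix_vector_mult_add_rdistrib matrix_vector_mul_assoc flip: scaleR_matrix_vector_assoc)
  also have "\<dots> \<le> (1/2) * (norm (B *v v) + norm (sqrt_iter B n *v (sqrt_iter B n *v v)))"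
    by (simp add: norm_triangle_ineq)
  also have "\<dots> \<le> (1/2) * (\<beta> * norm v + \<beta> * (\<beta> * norm v))"
    using assms(1)[of v] Suc[of v] Suc[of "sqrt_iter B n *v v"] mult_left_mono[OF Suc[of v] assms(2)]
    by (intro mult_left_mono add_mono) auto
  also have "\<dots> \<le> (1/2) * (\<beta> * norm v + 1 * (\<beta> * norm v))"
    using assms by (intro mult_left_mono add_left_mono mult_right_mono) auto
  finally show ?case by simp
qed (use assms in simp)

text \<open>Writing \<open>X ** X - Y ** Y\<close> as \<open>X ** (X - Y) + (X - Y) ** Y\<close>
  needs no commutation. Each outer factor has norm at most \<beta>, and the factor one half averages
  the two terms, so successive differences shrink by \<beta>.\<close>

lemma sqrt_iter_diff_norm:
  assumes "\<And>v. norm (B *v v) \<le> \<beta> * norm v" "0 \<le> \<beta>" "\<beta> < 1"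
  shows "norm ((sqrt_iter B (Suc n) - sqrt_iter B n) *v v) \<le> \<beta> ^ Suc n * norm v"
proof (induction n arbitrary: v)
  case 0
  have "norm ((1/2) *\<^sub>R (B *v v)) \<le> norm (B *v v)" by simp
  then have "norm ((1/2) *\<^sub>R (B *v v)) \<le> \<beta> * norm v" using assms(1)[of v] by linarith
  moreover have "(sqrt_iter B (Suc 0) - sqrt_iter B 0) *v v = (1/2) *\<^sub>R (B *v v)"
    by (simp add: matrix_matrix_mult_def scaleR_matrix_vector_assoc flip: zero_vec_def)
  ultimately show ?case by simp
next
  case (Suc n)
  let ?X = "sqrt_iter B (Suc n)" and ?Y = "sqrt_iter B n"
  have "sqrt_iter B (Suc (Suc n)) - ?X = (1/2) *\<^sub>R (?X ** (?X - ?Y) + (?X - ?Y) ** ?Y)"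
    unfolding sqrt_iter.simps(2)[of B "Suc n"]
    by (subst (3) sqrt_iter.simps(2))
       (simp only: matrix_diff_ldistrib matrix_diff_rdistrib scaleR_diff_right[symmetric], simp)
  then have "norm ((sqrt_iter B (Suc (Suc n)) - ?X) *v v) =
      (1/2) * norm (?X *v ((?X - ?Y) *v v) + (?X - ?Y) *v (?Y *v v))"
    by (simp add: matrix_vector_mult_add_rdistrib matrix_vector_mul_assoc scaleR_matrix_vector_assoc[symmetric] del: sqrt_iter.simps)
  also have "\<dots> \<le> (1/2) * (norm (?X *v ((?X - ?Y) *v v)) + norm ((?X - ?Y) *v (?Y *v v)))"
    by (simp add: norm_triangle_ineq)
  also have "\<dots> \<le> (1/2) * (\<beta> * (\<beta> ^ Suc n * norm v) + \<beta> ^ Suc n * (\<beta> * norm v))"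
  proof -
    have "norm (?X *v ((?X - ?Y) *v v)) \<le> \<beta> * (\<beta> ^ Suc n * norm v)"
      using sqrt_iter_norm[OF assms, of "Suc n" "(?X - ?Y) *v v"] mult_left_mono[OF Suc[of v] assms(2)] by linarith
    moreover have "norm ((?X - ?Y) *v (?Y *v v)) \<le> \<beta> ^ Suc n * (\<beta> * norm v)"
      using Suc[of "?Y *v v"] mult_left_mono[OF sqrt_iter_norm[OF assms, of n v], of "\<beta> ^ Suc n"] assms(2)
      by (meson order_trans zero_le_power)
    ultimately show ?thesis by (intro mult_left_mono add_mono) auto
  qed
  finally show ?case by (simp add: mult_ac del: sqrt_iter.simps)
qed

lemma sqrt_iter_convergent:
  fixes B :: "real^'n^'n"
  assumes "\<And>v. norm (B *v v) \<le> \<beta> * norm v" "0 \<le> \<beta>" "\<beta> < 1"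
  shows "convergent (sqrt_iter B)"
proof -
  have "summable (\<lambda>n. sqrt_iter B (Suc n) - sqrt_iter B n)"
  proof (rule summable_comparison_test')
    show "summable (\<lambda>n. real CARD('n) * (real CARD('n) * \<beta> ^ Suc n))"
      using assms by (intro summable_mult) (simp add: summable_geometric)
    show "norm (sqrt_iter B (Suc n) - sqrt_iter B n) \<le> real CARD('n) * (real CARD('n) * \<beta> ^ Suc n)" for n
      by (intro matrix_norm_le sqrt_iter_diff_norm assms)
  qed
  then have "convergent (\<lambda>n. \<Sum>i<n. sqrt_iter B (Suc i) - sqrt_iter B i)"
    by (simp add: summable_iff_convergent)
  then show ?thesis by (simp only: sum_lessThan_telescope) simp
qed

lemma transpose_sqrt_iter:
  assumes "transpose B = B"
  shows "transpose (sqrt_iter B n) = sqrt_iter B n"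
proof (induction n)
  case (Suc n)
  then show ?case using assms
    by (simp add: transpose_scalar transpose_plus matrix_transpose_mul)
qed (simp add: transpose_def vec_eq_iff)


lemma root_mat_root:
  fixes A :: "real^'n^'n"
  assumes A: "sym_pos_def A"
  shows "sym_pos_def (root_mat A)" "root_mat A ** root_mat A = A"
proof -
  define c where "c = 1 + (\<Sum>i\<in>UNIV. \<Sum>j\<in>UNIV. \<bar>A $ i $ j\<bar>)"
  define B where "B = mat 1 - (1/c) *\<^sub>R A"
  define X where "X = lim (sqrt_iter B)"
  have root: "root_mat A = sqrt c *\<^sub>R (mat 1 - X)"
    by (simp add: root_mat_def c_def B_def X_def Let_def)
  have c1: "c \<ge> 1" by (simp add: c_def sum_nonneg)
  obtain m where m: "m > 0" "\<And>v. m * (norm v)\<^sup>2 \<le> v \<bullet> (A *v v)"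
    using positive_definite_lower_bound[OF A] by blast
  \<comment> \<open>The form of \<open>A\<close> lies between \<open>m\<close> and \<open>c\<close>
    on unit vectors, hence that of \<open>B\<close> between 0 and \<open>1 - m / c\<close>. The
    maximum saves a proof of \<open>m \<le> c\<close>.\<close>
  define \<beta> where "\<beta> = max 0 (1 - m / c)"
  have \<beta>: "0 \<le> \<beta>" "\<beta> < 1" using m c1 by (auto simp: \<beta>_def)
  have symA: "transpose A = A" using A by (simp add: sym_pos_def_def)
  have symB: "transpose B = B"
    using symA by (simp add: B_def transpose_def vec_eq_iff mat_def)
  have Bv: "v \<bullet> (B *v v) = (norm v)\<^sup>2 - (v \<bullet> (A *v v)) / c" for v
    by (simp add: B_def matrix_vector_mult_diff_rdistrib inner_diff_right power2_norm_eq_inner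
        flip: scaleR_matrix_vector_assoc)
  have "\<bar>v \<bullet> (B *v v)\<bar> \<le> \<beta> * (norm v)\<^sup>2" for v
  proof -
    have "v \<bullet> (A *v v) \<le> c * (norm v)\<^sup>2"
      using quadratic_form_le[of v A] zero_le_power2[of "norm v"] unfolding c_def ring_distribs by linarith
    then have "(v \<bullet> (A *v v)) / c \<le> (norm v)\<^sup>2" using c1 by (simp add: field_simps)
    moreover have "(m / c) * (norm v)\<^sup>2 \<le> (v \<bullet> (A *v v)) / c"
      using m(2)[of v] c1 by (simp add: field_simps)
    moreover have "(1 - m / c) * (norm v)\<^sup>2 \<le> \<beta> * (norm v)\<^sup>2"
      by (intro mult_right_mono) (auto simp: \<beta>_def)
    ultimately show ?thesis unfolding Bv by (auto simp: abs_if algebra_simps)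
  qed
  from symmetric_norm_le[OF symB this \<beta>(1)] have B: "norm (B *v v) \<le> \<beta> * norm v" for v .
  have lim: "sqrt_iter B \<longlonglongrightarrow> X"
    unfolding X_def using sqrt_iter_convergent[OF B \<beta>] by (simp add: convergent_LIMSEQ_iff)
  have "(\<lambda>n. sqrt_iter B (Suc n)) \<longlonglongrightarrow> (1/2) *\<^sub>R (B + X ** X)"
    unfolding sqrt_iter.simps by (intro tendsto_intros tendsto_matrix_mult lim)
  with LIMSEQ_Suc[OF lim] have fp: "X = (1/2) *\<^sub>R (B + X ** X)" by (rule LIMSEQ_unique)
  have "(\<lambda>n. transpose (sqrt_iter B n)) \<longlonglongrightarrow> transpose X" by (rule tendsto_transpose[OF lim])
  then have symX: "transpose X = X"
    using lim LIMSEQ_unique by (simp add: transpose_sqrt_iter[OF symB])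
  have "(\<lambda>n. norm (sqrt_iter B n *v v)) \<longlonglongrightarrow> norm (X *v v)" for v
    by (intro tendsto_norm tendsto_matrix_vector_mult lim tendsto_const)
  then have Xv: "norm (X *v v) \<le> \<beta> * norm v" for v
    by (rule LIMSEQ_le_const2) (use sqrt_iter_norm[OF B \<beta>] in auto)
  have "X + X = B + X ** X" using arg_cong[OF fp, of "\<lambda>Y. 2 *\<^sub>R Y"] by (simp add: scaleR_2)
  then have "(mat 1 - X) ** (mat 1 - X) = mat 1 - B"
    by (simp add: matrix_diff_ldistrib matrix_diff_rdistrib algebra_simps)
  then have "root_mat A ** root_mat A = c *\<^sub>R (mat 1 - B)"
    unfolding root using c1
    by (simp add: scalar_matrix_assoc[symmetric] matrix_scalar_ac)
  then show "root_mat A ** root_mat A = A" using c1 by (simp add: B_def)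
  have "v \<bullet> (root_mat A *v v) > 0" if "v \<noteq> 0" for v
  proof -
    have "v \<bullet> (X *v v) \<le> norm v * (\<beta> * norm v)"
      using norm_cauchy_schwarz[of v "X *v v"] mult_left_mono[OF Xv[of v], of "norm v"] by simp
    also have "\<dots> < norm v * norm v"
      using \<beta> that by simp
    finally have "v \<bullet> (X *v v) < v \<bullet> v" by (simp add: power2_norm_eq_inner flip: power2_eq_square)
    then show ?thesis unfolding root using c1
      by (simp add: matrix_vector_mult_diff_rdistrib inner_diff_right flip: scaleR_matrix_vector_assoc)
  qed
  moreover have "transpose (root_mat A) = root_mat A"
    unfolding root using symX by (simp add: transpose_def vec_eq_iff mat_def)
  ultimately show "sym_pos_def (root_mat A)" by (simp add: sym_pos_def_def)
qed

text \<open>Cramer's rule, solved for each axis. Unlike the choice in \<open>matrix_inv\<close>, it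
  shows the entries of the inverse to be rational functions of the matrix, hence measurable, and
  continuous where the determinant does not vanish.\<close>

definition cramer_inv :: "real^'n^'n \<Rightarrow> real^'n^'n" where
  "cramer_inv A = (\<chi> i j. det (\<chi> a b. if b = i then axis j 1 $ a else A $ a $ b) / det A)"

lemma matrix_inv_cramer:
  fixes A :: "real^'n^'n"
  assumes "invertible A"
  shows "matrix_inv A = cramer_inv A"
proof -
  have "matrix_inv A $ i $ j = cramer_inv A $ i $ j" for i j
  proof -
    have d: "det A \<noteq> 0" using assms by (simp add: invertible_det_nz)
    have "A *v (matrix_inv A *v axis j 1) = axis j 1"
      using assms by (simp add: matrix_vector_mul_assoc matrix_inv_mult(1))
    then have "matrix_inv A *v axis j 1 = (\<chi> k. det (\<chi> a b. if b = k then axis j 1 $ a else A $ a $ b) / det A)"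
      using cramer[OF d] by blast
    then show ?thesis
      by (simp add: matrix_vector_mult_basis column_def vec_eq_iff cramer_inv_def)
  qed
  then show ?thesis by (simp add: vec_eq_iff)
qed

lemma borel_measurable_det:
  fixes f :: "'a \<Rightarrow> real^'n^'n"
  assumes [measurable]: "f \<in> borel_measurable M"
  shows "(\<lambda>x. det (f x)) \<in> borel_measurable M"
  unfolding det_def by (intro borel_measurable_sum borel_measurable_times borel_measurable_prod) simp_all

lemma tendsto_det:
  fixes f :: "'a \<Rightarrow> real^'n^'n"
  assumes "(f \<longlongrightarrow> A) F"
  shows "((\<lambda>x. det (f x)) \<longlongrightarrow> det A) F"
  unfolding det_def by (intro tendsto_intros assms)

lemma borel_measurable_cramer_inv:
  fixes f :: "'a \<Rightarrow> real^'n^'n"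
  assumes [measurable]: "f \<in> borel_measurable M"
  shows "(\<lambda>x. cramer_inv (f x)) \<in> borel_measurable M"
proof -
  have "(\<lambda>x. \<chi> a b. if b = i then axis j 1 $ a else f x $ a $ b) \<in> borel_measurable M" for i j :: 'n
    by (intro borel_measurable_vecI) (auto split: if_split)
  then show ?thesis unfolding cramer_inv_def
    by (intro borel_measurable_vecI)
       (auto intro!: borel_measurable_divide borel_measurable_det)
qed

lemma tendsto_cramer_inv:
  fixes f :: "'a \<Rightarrow> real^'n^'n"
  assumes f: "(f \<longlongrightarrow> A) F" and d: "det A \<noteq> 0"
  shows "((\<lambda>x. cramer_inv (f x)) \<longlongrightarrow> cramer_inv A) F"
proof -
  have "((\<lambda>x. \<chi> a b. if b = i then axis j 1 $ a else f x $ a $ b) \<longlongrightarrow>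
      (\<chi> a b. if b = i then axis j 1 $ a else A $ a $ b)) F" for i j :: 'n
    by (intro vec_tendstoI) (auto intro!: tendsto_intros f split: if_split)
  then show ?thesis unfolding cramer_inv_def
    by (intro vec_tendstoI) (auto intro!: tendsto_intros tendsto_det f d)
qed

section \<open>The inverse square root of a positive definite matrix\<close>

lemma sym_pos_def_invertible: "sym_pos_def A \<Longrightarrow> invertible A"
  unfolding sym_pos_def_def invertible_left_inverse matrix_left_invertible_ker
  by (metis inner_zero_right less_irrefl)

lemma sym_pos_def_matrix_inv:
  assumes A: "sym_pos_def A"
  shows "sym_pos_def (matrix_inv A)"
proof -
  have inv: "invertible A" by (rule sym_pos_def_invertible[OF A])
  have symA: "transpose A = A" using A by (simp add: sym_pos_def_def)
  have AI: "A ** matrix_inv A = mat 1" "matrix_inv A ** A = mat 1" using inv matrix_inv_mult by auto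
  have "transpose (matrix_inv A) ** A = mat 1"
    by (metis AI(1) matrix_transpose_mul symA transpose_mat)
  then have "transpose (matrix_inv A) = matrix_inv A"
    by (metis AI(1) matrix_mul_assoc matrix_mul_lid matrix_mul_rid)
  moreover have "v \<bullet> (matrix_inv A *v v) > 0" if "v \<noteq> 0" for v
  proof -
    define w where "w = matrix_inv A *v v"
    have v: "v = A *v w" by (simp add: w_def matrix_vector_mul_assoc AI)
    then have "w \<noteq> 0" using that by auto
    then have "w \<bullet> (A *v w) > 0" using A by (simp add: sym_pos_def_def)
    then show ?thesis by (simp add: inner_commute flip: w_def v)
  qed
  ultimately show ?thesis by (simp add: sym_pos_def_def)
qed

text \<open>Trades the definite description for a function whose measurability is known: the
  iteration supplies a root, the trace argument its uniqueness.\<close>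

lemma inv_sqrt_mat_eq_root:
  assumes A: "sym_pos_def A"
  shows "inv_sqrt_mat A = root_mat (cramer_inv A)"
  unfolding inv_sqrt_mat_def
proof (rule the_equality)
  note r = root_mat_root[OF sym_pos_def_matrix_inv[OF A]]
  have eq: "cramer_inv A = matrix_inv A" by (simp add: matrix_inv_cramer sym_pos_def_invertible[OF A])
  show "sym_pos_def (root_mat (cramer_inv A)) \<and> root_mat (cramer_inv A) ** root_mat (cramer_inv A) = matrix_inv A"
    using r eq by simp
  then show "S = root_mat (cramer_inv A)" if "sym_pos_def S \<and> S ** S = matrix_inv A" for S
    using that sym_pos_def_unique_root by metis
qed

lemma inv_sqrt_mat:
  assumes A: "sym_pos_def A"
  shows "sym_pos_def (inv_sqrt_mat A)"
    and "inv_sqrt_mat A ** inv_sqrt_mat A = matrix_inv A"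
    and "A ** (inv_sqrt_mat A ** inv_sqrt_mat A) = mat 1"
    and "inv_sqrt_mat A ** (A ** inv_sqrt_mat A) = mat 1"
proof -
  note r = root_mat_root[OF sym_pos_def_matrix_inv[OF A]]
  have i: "invertible A" by (rule sym_pos_def_invertible[OF A])
  have eq: "inv_sqrt_mat A = root_mat (matrix_inv A)"
    by (simp add: inv_sqrt_mat_eq_root[OF A] matrix_inv_cramer i)
  show "sym_pos_def (inv_sqrt_mat A)" and sq: "inv_sqrt_mat A ** inv_sqrt_mat A = matrix_inv A"
    using r eq by auto
  then show "A ** (inv_sqrt_mat A ** inv_sqrt_mat A) = mat 1" using matrix_inv_mult[OF i] by simp
  then show "inv_sqrt_mat A ** (A ** inv_sqrt_mat A) = mat 1"
    by (metis matrix_left_right_inverse matrix_mul_assoc)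
qed

lemma invertible_mat1: "invertible (mat 1 :: real^'n^'n)"
  by (auto simp: invertible_def)

text \<open>Continuity is needed only at the identity. There a positive definite \<open>S\<close>
  satisfies \<open>norm ((S - mat 1) *v v) \<le> norm ((S ** S - mat 1) *v v)\<close>: with
  \<open>w\<close> the vector on the left, the one on the right is \<open>S *v w + w\<close>, whose
  inner product with \<open>w\<close> is at least \<open>w \<bullet> w\<close>. So the root is no
  further from the identity than the inverse itself.\<close>

lemma tendsto_inv_sqrt_mat:
  fixes A :: "'a \<Rightarrow> real^'n^'n"
  assumes lim: "(A \<longlongrightarrow> mat 1) F" and pd: "eventually (\<lambda>x. sym_pos_def (A x)) F"
  shows "((\<lambda>x. inv_sqrt_mat (A x)) \<longlongrightarrow> mat 1) F"
proof -
  have "cramer_inv (mat 1 :: real^'n^'n) = mat 1"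
    by (metis invertible_mat1 matrix_inv_cramer matrix_inv_mult(1) matrix_mul_lid)
  then have "((\<lambda>x. cramer_inv (A x)) \<longlongrightarrow> mat 1) F"
    using tendsto_cramer_inv[OF lim] by simp
  then have "((\<lambda>x. norm ((cramer_inv (A x) - mat 1) *v axis j 1)) \<longlongrightarrow> norm ((mat 1 - mat 1 :: real^'n^'n) *v axis j 1)) F" for j
    by (intro tendsto_norm tendsto_matrix_vector_mult tendsto_diff tendsto_const)
  then have lim0: "((\<lambda>x. norm ((cramer_inv (A x) - mat 1) *v axis j 1)) \<longlongrightarrow> 0) F" for j by simp
  have le: "norm ((inv_sqrt_mat B - mat 1) *v v) \<le> norm ((cramer_inv B - mat 1) *v v)"
    if B: "sym_pos_def B" for B :: "real^'n^'n" and v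
  proof -
    define S where "S = inv_sqrt_mat B"
    define w where "w = (S - mat 1) *v v"
    have S: "sym_pos_def S" "S ** S = cramer_inv B"
      using inv_sqrt_mat[OF B] matrix_inv_cramer[OF sym_pos_def_invertible[OF B]] by (auto simp: S_def)
    have "(cramer_inv B - mat 1) *v v = S *v w + w"
      unfolding w_def S(2)[symmetric]
      by (simp add: matrix_vector_mult_diff_rdistrib matrix_vector_mult_diff_distrib matrix_vector_mul_assoc)
    moreover have "w \<bullet> w \<le> w \<bullet> (S *v w + w)"
      using S(1) unfolding sym_pos_def_def by (cases "w = 0") (auto simp: inner_add_right less_imp_le)
    ultimately have "norm w * norm w \<le> norm w * norm ((cramer_inv B - mat 1) *v v)"
      using norm_cauchy_schwarz[of w "S *v w + w"]
      by (metis dual_order.trans power2_eq_square power2_norm_eq_inner)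
    then show ?thesis by (cases "w = 0") (auto simp: w_def S_def)
  qed
  have "((\<lambda>x. inv_sqrt_mat (A x) $ i $ j) \<longlongrightarrow> mat 1 $ i $ j) F" for i j
  proof -
    have "((\<lambda>x. inv_sqrt_mat (A x) $ i $ j - mat 1 $ i $ j) \<longlongrightarrow> 0) F"
    proof (rule Lim_null_comparison[OF _ lim0[of j]])
      have "norm (inv_sqrt_mat (A x) $ i $ j - mat 1 $ i $ j)
          \<le> norm ((cramer_inv (A x) - mat 1) *v axis j 1)" if "sym_pos_def (A x)" for x
      proof -
        have "norm (inv_sqrt_mat (A x) $ i $ j - mat 1 $ i $ j) = norm (((inv_sqrt_mat (A x) - mat 1) *v axis j 1) $ i)"
          by (simp add: matrix_vector_mult_basis column_def)
        also have "\<dots> \<le> norm ((inv_sqrt_mat (A x) - mat 1) *v axis j 1)"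
          by (simp add: component_le_norm_cart)
        also note le[OF that]
        finally show ?thesis .
      qed
      then show "\<forall>\<^sub>F x in F. norm (inv_sqrt_mat (A x) $ i $ j - mat 1 $ i $ j)
          \<le> norm ((cramer_inv (A x) - mat 1) *v axis j 1)"
        using pd by (auto elim: eventually_mono)
    qed
    then show ?thesis by (rule LIM_zero_cancel)
  qed
  then show ?thesis by (intro vec_tendstoI)
qed

section \<open>Measurable selection of constrained maximizers\<close>

definition caratheodory :: "'w measure \<Rightarrow> 'b::euclidean_space set \<Rightarrow> ('w \<Rightarrow> 'b \<Rightarrow> real) \<Rightarrow> bool" where
  "caratheodory M K g \<longleftrightarrow>
     (\<forall>u\<in>K. (\<lambda>\<omega>. g \<omega> u) \<in> borel_measurable M) \<and> (\<forall>\<omega>\<in>space M. continuous_on K (g \<omega>))"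

text \<open>Closed-valued random sets of the form \<open>{u \<in> K. g \<omega> u \<ge> 0}\<close>, given by their membership predicate.\<close>

definition random_closed :: "'w measure \<Rightarrow> 'b::euclidean_space set \<Rightarrow> ('w \<Rightarrow> 'b \<Rightarrow> bool) \<Rightarrow> bool" where
  "random_closed M K P \<longleftrightarrow>
     (\<exists>g. caratheodory M K g \<and> (\<forall>\<omega>\<in>space M. \<forall>u\<in>K. P \<omega> u \<longleftrightarrow> 0 \<le> g \<omega> u))"

lemma random_closed_cong:
  assumes "\<And>\<omega> u. \<omega> \<in> space M \<Longrightarrow> P \<omega> u \<longleftrightarrow> Q \<omega> u"
  shows "random_closed M K P \<longleftrightarrow> random_closed M K Q"
  using assms by (simp add: random_closed_def cong: ball_cong)

lemma random_closed_ge: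
  assumes "caratheodory M K f" "caratheodory M K g"
  shows "random_closed M K (\<lambda>\<omega> u. f \<omega> u \<le> g \<omega> u)"
  unfolding random_closed_def
  by (rule exI[of _ "\<lambda>\<omega> u. g \<omega> u - f \<omega> u"])
     (use assms in \<open>auto simp: caratheodory_def intro!: continuous_intros borel_measurable_diff\<close>)

lemma random_closed_conj:
  assumes "random_closed M K P" "random_closed M K Q"
  shows "random_closed M K (\<lambda>\<omega> u. P \<omega> u \<and> Q \<omega> u)"
proof -
  obtain f g where "caratheodory M K f" "\<And>\<omega> u. \<omega> \<in> space M \<Longrightarrow> u \<in> K \<Longrightarrow> P \<omega> u \<longleftrightarrow> 0 \<le> f \<omega> u"
    and "caratheodory M K g" "\<And>\<omega> u. \<omega> \<in> space M \<Longrightarrow> u \<in> K \<Longrightarrow> Q \<omega> u \<longleftrightarrow> 0 \<le> g \<omega> u"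
    using assms unfolding random_closed_def by blast
  then show ?thesis unfolding random_closed_def
    by (intro exI[of _ "\<lambda>\<omega> u. min (f \<omega> u) (g \<omega> u)"])
       (auto simp: caratheodory_def intro!: continuous_intros borel_measurable_min)
qed

lemma random_closed_disj:
  assumes "random_closed M K P" "random_closed M K Q"
  shows "random_closed M K (\<lambda>\<omega> u. P \<omega> u \<or> Q \<omega> u)"
proof -
  obtain f g where "caratheodory M K f" "\<And>\<omega> u. \<omega> \<in> space M \<Longrightarrow> u \<in> K \<Longrightarrow> P \<omega> u \<longleftrightarrow> 0 \<le> f \<omega> u"
    and "caratheodory M K g" "\<And>\<omega> u. \<omega> \<in> space M \<Longrightarrow> u \<in> K \<Longrightarrow> Q \<omega> u \<longleftrightarrow> 0 \<le> g \<omega> u"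
    using assms unfolding random_closed_def by blast
  then show ?thesis unfolding random_closed_def
    by (intro exI[of _ "\<lambda>\<omega> u. max (f \<omega> u) (g \<omega> u)"])
       (auto simp: caratheodory_def intro!: continuous_intros borel_measurable_max)
qed

lemma random_closed_event:
  assumes "D \<in> sets M"
  shows "random_closed M K (\<lambda>\<omega> u. \<omega> \<in> D)"
  unfolding random_closed_def
  by (rule exI[of _ "\<lambda>\<omega> u. indicator D \<omega> - 1"])
     (use assms in \<open>auto simp: caratheodory_def indicator_def\<close>)

lemma random_closed_all:
  assumes "finite J" "\<And>j. j \<in> J \<Longrightarrow> random_closed M K (P j)"
  shows "random_closed M K (\<lambda>\<omega> u. \<forall>j\<in>J. P j \<omega> u)"
  using assms
proof (induction J)
  case empty
  show ?case unfolding random_closed_def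
    by (rule exI[of _ "\<lambda>\<omega> u. 0"]) (auto simp: caratheodory_def)
next
  case (insert j J)
  then show ?case using random_closed_conj[of M K "P j"] by simp
qed

text \<open>By compactness and continuity, \<open>g\<close> is nonnegative somewhere on
  \<open>K\<close> iff for every \<open>m\<close> it exceeds \<open>- inverse (real (Suc m))\<close>
  somewhere on a countable dense subset. The existential over \<open>K\<close> thus becomes a
  countable combination of events, and no projection theorem is required.\<close>

lemma random_closed_hit_sets:
  assumes P: "random_closed M K P" and K: "compact K"
  shows "{\<omega>\<in>space M. \<exists>u\<in>K. P \<omega> u} \<in> sets M"
proof -
  obtain g where g: "caratheodory M K g" "\<And>\<omega> u. \<omega> \<in> space M \<Longrightarrow> u \<in> K \<Longrightarrow> P \<omega> u \<longleftrightarrow> 0 \<le> g \<omega> u"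
    using P unfolding random_closed_def by blast
  obtain D where D: "countable D" "D \<subseteq> K" "K \<subseteq> closure D" using separable by blast
  have "(\<exists>u\<in>K. P \<omega> u) \<longleftrightarrow> (\<forall>m. \<exists>u\<in>D. - inverse (real (Suc m)) \<le> g \<omega> u)" if w: "\<omega> \<in> space M" for \<omega>
  proof
    have cont: "continuous_on K (g \<omega>)" using g(1) w by (simp add: caratheodory_def)
    show "\<forall>m. \<exists>u\<in>D. - inverse (real (Suc m)) \<le> g \<omega> u" if ex: "\<exists>u\<in>K. P \<omega> u"
    proof (rule ccontr)
      assume "\<not> (\<forall>m. \<exists>u\<in>D. - inverse (real (Suc m)) \<le> g \<omega> u)"
      then obtain m where "\<not> (\<exists>u\<in>D. - inverse (real (Suc m)) \<le> g \<omega> u)" by blast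
      then have m: "\<And>u. u \<in> D \<Longrightarrow> g \<omega> u \<le> - inverse (real (Suc m))" by (meson linear)
      have "closed {u\<in>K. g \<omega> u \<le> - inverse (real (Suc m))}"
        by (intro continuous_on_closed_Collect_le cont continuous_on_const compact_imp_closed K)
      then have "closure D \<subseteq> {u\<in>K. g \<omega> u \<le> - inverse (real (Suc m))}"
        using D m by (intro closure_minimal) auto
      moreover obtain u where "u \<in> K" "0 \<le> g \<omega> u" using ex g(2) w by blast
      ultimately have "0 \<le> - inverse (real (Suc m))" using D(3) by (blast intro: order_trans)
      then show False by simp
    qed
    assume h: "\<forall>m. \<exists>u\<in>D. - inverse (real (Suc m)) \<le> g \<omega> u"
    then have "K \<noteq> {}" using D by blast
    then obtain u where u: "u \<in> K" "\<And>u'. u' \<in> K \<Longrightarrow> g \<omega> u' \<le> g \<omega> u"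
      using continuous_attains_sup[OF K _ cont] by blast
    have ge: "- inverse (real (Suc m)) \<le> g \<omega> u" for m
    proof -
      obtain d where "d \<in> D" "- inverse (real (Suc m)) \<le> g \<omega> d" using h by blast
      with u(2)[of d] D show ?thesis by auto
    qed
    have "0 \<le> g \<omega> u"
    proof (rule ccontr)
      assume "\<not> 0 \<le> g \<omega> u"
      then obtain m where "inverse (real (Suc m)) < - g \<omega> u"
        using reals_Archimedean[of "- g \<omega> u"] by auto
      with ge[of m] show False by linarith
    qed
    with u w show "\<exists>u\<in>K. P \<omega> u" using g(2) by blast
  qed
  then have "{\<omega>\<in>space M. \<exists>u\<in>K. P \<omega> u} = {\<omega>\<in>space M. \<forall>m. \<exists>u\<in>D. - inverse (real (Suc m)) \<le> g \<omega> u}"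
    by blast
  also have "\<dots> \<in> sets M"
  proof -
    have "{\<omega>\<in>space M. - inverse (real (Suc m)) \<le> g \<omega> u} \<in> sets M" if "u \<in> D" for u m
    proof -
      have [measurable]: "(\<lambda>\<omega>. g \<omega> u) \<in> borel_measurable M"
        using g(1) D that by (auto simp: caratheodory_def)
      show ?thesis by measurable
    qed
    then have "{\<omega>\<in>space M. \<exists>u\<in>D. - inverse (real (Suc m)) \<le> g \<omega> u} \<in> sets M" for m
      using D(1) by (intro sets.sets_Collect_countable_Ex') auto
    then show ?thesis by (intro sets.sets_Collect_countable_All) auto
  qed
  finally show ?thesis .
qed

text \<open>The superlevel sets of the maximal value are hitting events, so the value is a
  measurable function \<open>v\<close> of the outcome. Being a maximizer is then the closed
  condition \<open>v \<omega> \<le> h \<omega> u\<close>, and vacuous where nothing satisfies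
  \<open>P\<close>. Hence maximizers can be refined again by a further criterion.\<close>

lemma random_closed_argmax:
  assumes P: "random_closed M K P" and K: "compact K" and h: "caratheodory M K h"
  shows "random_closed M K (\<lambda>\<omega> u. \<forall>u'\<in>K. P \<omega> u' \<longrightarrow> h \<omega> u' \<le> h \<omega> u)"
    and "\<exists>v\<in>borel_measurable M. \<forall>\<omega>\<in>space M. \<forall>u\<in>K. P \<omega> u \<longrightarrow> (\<forall>u'\<in>K. P \<omega> u' \<longrightarrow> h \<omega> u' \<le> h \<omega> u) \<longrightarrow> h \<omega> u = v \<omega>"
    and "\<forall>\<omega>\<in>space M. (\<exists>u\<in>K. P \<omega> u) \<longrightarrow> (\<exists>u\<in>K. P \<omega> u \<and> (\<forall>u'\<in>K. P \<omega> u' \<longrightarrow> h \<omega> u' \<le> h \<omega> u))"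
proof -
  obtain g where g: "caratheodory M K g" "\<And>\<omega> u. \<omega> \<in> space M \<Longrightarrow> u \<in> K \<Longrightarrow> P \<omega> u \<longleftrightarrow> 0 \<le> g \<omega> u"
    using P unfolding random_closed_def by blast
  define D where "D = {\<omega>\<in>space M. \<exists>u\<in>K. P \<omega> u}"
  have DM: "D \<in> sets M" unfolding D_def by (rule random_closed_hit_sets[OF P K])
  have ex: "\<exists>u\<in>K. P \<omega> u \<and> (\<forall>u'\<in>K. P \<omega> u' \<longrightarrow> h \<omega> u' \<le> h \<omega> u)" if "\<omega> \<in> D" for \<omega>
  proof -
    have w: "\<omega> \<in> space M" using that by (simp add: D_def)
    define L where "L = {u\<in>K. 0 \<le> g \<omega> u}"
    have "closed L" unfolding L_def
      using g(1) w K by (intro continuous_on_closed_Collect_le continuous_on_const compact_imp_closed)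
        (auto simp: caratheodory_def)
    moreover have LK: "L \<subseteq> K" by (auto simp: L_def)
    ultimately have "compact L" using K compact_Int_closed[of K L] by (simp add: inf.absorb2)
    moreover have "L \<noteq> {}" using that g(2) by (auto simp: L_def D_def)
    moreover have "continuous_on L (h \<omega>)"
      using h w LK by (auto simp: caratheodory_def intro: continuous_on_subset)
    ultimately have "\<exists>u\<in>L. \<forall>u'\<in>L. h \<omega> u' \<le> h \<omega> u"
      by (rule continuous_attains_sup)
    then obtain u where "u \<in> L" "\<forall>u'\<in>L. h \<omega> u' \<le> h \<omega> u" by (rule bexE)
    then show ?thesis using g(2) w by (intro bexI[of _ u]) (auto simp: L_def)
  qed
  then show "\<forall>\<omega>\<in>space M. (\<exists>u\<in>K. P \<omega> u) \<longrightarrow> (\<exists>u\<in>K. P \<omega> u \<and> (\<forall>u'\<in>K. P \<omega> u' \<longrightarrow> h \<omega> u' \<le> h \<omega> u))"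
    unfolding D_def by blast
  have "\<forall>\<omega>\<in>D. \<exists>u. u \<in> K \<and> P \<omega> u \<and> (\<forall>u'\<in>K. P \<omega> u' \<longrightarrow> h \<omega> u' \<le> h \<omega> u)" using ex by blast
  then obtain m where mm: "\<forall>\<omega>\<in>D. m \<omega> \<in> K \<and> P \<omega> (m \<omega>) \<and> (\<forall>u'\<in>K. P \<omega> u' \<longrightarrow> h \<omega> u' \<le> h \<omega> (m \<omega>))"
    using bchoice[of D "\<lambda>\<omega> u. u \<in> K \<and> P \<omega> u \<and> (\<forall>u'\<in>K. P \<omega> u' \<longrightarrow> h \<omega> u' \<le> h \<omega> u)"] by blast
  have m: "m \<omega> \<in> K" "P \<omega> (m \<omega>)" "u' \<in> K \<Longrightarrow> P \<omega> u' \<Longrightarrow> h \<omega> u' \<le> h \<omega> (m \<omega>)"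
    if "\<omega> \<in> D" for \<omega> u'
    using bspec[OF mm that] by blast+
  define v where "v \<omega> = (if \<omega> \<in> D then h \<omega> (m \<omega>) else 0)" for \<omega>
  have cc: "caratheodory M K (\<lambda>\<omega> u. a)" for a :: real unfolding caratheodory_def by (intro conjI ballI borel_measurable_const continuous_on_const)
  have ge: "{\<omega>\<in>space M. a \<le> v \<omega>} \<in> sets M" for a
  proof -
    \<comment> \<open>The default value 0 of \<open>v\<close> outside \<open>D\<close> places the
      complement of \<open>D\<close> in the superlevel sets with \<open>a \<le> 0\<close>.\<close>
    have "{\<omega>\<in>space M. a \<le> v \<omega>} =
      {\<omega>\<in>space M. \<exists>u\<in>K. P \<omega> u \<and> a \<le> h \<omega> u} \<union> (if a \<le> 0 then space M - D else {})"
    proof (intro set_eqI iffI)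
      fix \<omega> assume *: "\<omega> \<in> {\<omega>\<in>space M. a \<le> v \<omega>}"
      show "\<omega> \<in> {\<omega>\<in>space M. \<exists>u\<in>K. P \<omega> u \<and> a \<le> h \<omega> u} \<union> (if a \<le> 0 then space M - D else {})"
      proof (cases "\<omega> \<in> D")
        case True
        then show ?thesis using * m(1,2) by (auto simp: v_def)
      next
        case False
        then show ?thesis using * by (auto simp: v_def)
      qed
    next
      fix \<omega> assume *: "\<omega> \<in> {\<omega>\<in>space M. \<exists>u\<in>K. P \<omega> u \<and> a \<le> h \<omega> u} \<union> (if a \<le> 0 then space M - D else {})"
      show "\<omega> \<in> {\<omega>\<in>space M. a \<le> v \<omega>}"
      proof (cases "\<omega> \<in> D")
        case True
        then obtain u where u: "u \<in> K" "P \<omega> u" "a \<le> h \<omega> u"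
          using * by (auto split: if_splits)
        then have "a \<le> h \<omega> (m \<omega>)" using m(3)[OF True, of u] by linarith
        then show ?thesis using True by (auto simp: v_def D_def)
      next
        case False
        then show ?thesis using * by (auto simp: v_def D_def split: if_splits)
      qed
    qed
    also have "\<dots> \<in> sets M"
      using DM random_closed_hit_sets[OF random_closed_conj[OF P random_closed_ge[OF cc[of a] h]] K] by auto
    finally show ?thesis .
  qed
  have v: "v \<in> borel_measurable M" unfolding borel_measurable_iff_ge using ge by blast
  have vmax: "(\<forall>u'\<in>K. P \<omega> u' \<longrightarrow> h \<omega> u' \<le> h \<omega> u) \<longleftrightarrow> \<omega> \<in> space M - D \<or> v \<omega> \<le> h \<omega> u"
    if w: "\<omega> \<in> space M" for \<omega> u
  proof (cases "\<omega> \<in> D")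
    case True
    have "(\<forall>u'\<in>K. P \<omega> u' \<longrightarrow> h \<omega> u' \<le> h \<omega> u) \<longleftrightarrow> h \<omega> (m \<omega>) \<le> h \<omega> u"
    proof
      assume "\<forall>u'\<in>K. P \<omega> u' \<longrightarrow> h \<omega> u' \<le> h \<omega> u"
      then show "h \<omega> (m \<omega>) \<le> h \<omega> u" using m(1,2)[OF True] by blast
    next
      assume "h \<omega> (m \<omega>) \<le> h \<omega> u"
      then show "\<forall>u'\<in>K. P \<omega> u' \<longrightarrow> h \<omega> u' \<le> h \<omega> u" using m(3)[OF True] order_trans by blast
    qed
    with True show ?thesis by (simp add: v_def)
  next
    case False
    with w show ?thesis by (auto simp: D_def)
  qed
  have "caratheodory M K (\<lambda>\<omega> u. v \<omega>)" using v by (auto simp: caratheodory_def)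
  then have "random_closed M K (\<lambda>\<omega> u. \<omega> \<in> space M - D \<or> v \<omega> \<le> h \<omega> u)"
    using DM by (intro random_closed_disj random_closed_event random_closed_ge h) auto
  then show "random_closed M K (\<lambda>\<omega> u. \<forall>u'\<in>K. P \<omega> u' \<longrightarrow> h \<omega> u' \<le> h \<omega> u)"
    by (rule random_closed_cong[THEN iffD1, rotated]) (simp add: vmax)
  have "h \<omega> u = v \<omega>" if "\<omega> \<in> space M" "u \<in> K" "P \<omega> u" "\<forall>u'\<in>K. P \<omega> u' \<longrightarrow> h \<omega> u' \<le> h \<omega> u" for \<omega> u
  proof -
    have "\<omega> \<in> D" using that by (auto simp: D_def)
    then have "h \<omega> (m \<omega>) \<le> h \<omega> u" "h \<omega> u \<le> h \<omega> (m \<omega>)" using that(2,3,4) m(1,2,3)[of \<omega>] by auto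
    with \<open>\<omega> \<in> D\<close> show ?thesis by (simp add: v_def)
  qed
  with v show "\<exists>v\<in>borel_measurable M. \<forall>\<omega>\<in>space M. \<forall>u\<in>K. P \<omega> u \<longrightarrow> (\<forall>u'\<in>K. P \<omega> u' \<longrightarrow> h \<omega> u' \<le> h \<omega> u) \<longrightarrow> h \<omega> u = v \<omega>"
    by blast
qed

text \<open>Maximizing the coordinates one after another leaves a single point, whose coordinates are
  measurable value functions.\<close>

lemma random_closed_selection:
  assumes P: "random_closed M K P" and K: "compact K"
    and ne: "\<And>\<omega>. \<omega> \<in> space M \<Longrightarrow> \<exists>u\<in>K. P \<omega> u"
  shows "\<exists>s\<in>borel_measurable M. \<forall>\<omega>\<in>space M. s \<omega> \<in> K \<and> P \<omega> (s \<omega>)"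
proof -
  have "finite B \<Longrightarrow> \<exists>Q v. random_closed M K Q \<and> (\<forall>\<omega>\<in>space M. \<exists>u\<in>K. Q \<omega> u) \<and>
      (\<forall>\<omega>\<in>space M. \<forall>u\<in>K. Q \<omega> u \<longrightarrow> P \<omega> u \<and> (\<forall>b\<in>B. u \<bullet> b = v b \<omega>)) \<and> (\<forall>b\<in>B. v b \<in> borel_measurable M)" for B
  proof (induction B rule: finite_induct)
    case empty
    then show ?case using P ne by auto
  next
    case (insert b B)
    then obtain Q v where Q: "random_closed M K Q" "\<And>\<omega>. \<omega> \<in> space M \<Longrightarrow> \<exists>u\<in>K. Q \<omega> u"
      "\<And>\<omega> u. \<omega> \<in> space M \<Longrightarrow> u \<in> K \<Longrightarrow> Q \<omega> u \<Longrightarrow> P \<omega> u \<and> (\<forall>b\<in>B. u \<bullet> b = v b \<omega>)"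
      "\<And>b. b \<in> B \<Longrightarrow> v b \<in> borel_measurable M" by blast
    have h: "caratheodory M K (\<lambda>\<omega> u. u \<bullet> b)" by (auto simp: caratheodory_def intro!: continuous_intros)
    note am = random_closed_argmax[OF Q(1) K h]
    obtain vb where vb: "vb \<in> borel_measurable M"
      "\<And>\<omega> u. \<omega>\<in>space M \<Longrightarrow> u\<in>K \<Longrightarrow> Q \<omega> u \<Longrightarrow> (\<forall>u'\<in>K. Q \<omega> u' \<longrightarrow> u' \<bullet> b \<le> u \<bullet> b) \<Longrightarrow> u \<bullet> b = vb \<omega>"
      using am(2) by blast
    show ?case
    proof (intro exI conjI)
      show "random_closed M K (\<lambda>\<omega> u. Q \<omega> u \<and> (\<forall>u'\<in>K. Q \<omega> u' \<longrightarrow> u' \<bullet> b \<le> u \<bullet> b))"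
        by (intro random_closed_conj Q(1) am(1))
      show "\<forall>\<omega>\<in>space M. \<exists>u\<in>K. Q \<omega> u \<and> (\<forall>u'\<in>K. Q \<omega> u' \<longrightarrow> u' \<bullet> b \<le> u \<bullet> b)"
        using am(3) Q(2) by blast
      show "\<forall>\<omega>\<in>space M. \<forall>u\<in>K. Q \<omega> u \<and> (\<forall>u'\<in>K. Q \<omega> u' \<longrightarrow> u' \<bullet> b \<le> u \<bullet> b) \<longrightarrow>
          P \<omega> u \<and> (\<forall>c\<in>insert b B. u \<bullet> c = (v(b := vb)) c \<omega>)"
        using Q(3) vb(2) insert.hyps by auto
      show "\<forall>c\<in>insert b B. (v(b := vb)) c \<in> borel_measurable M" using Q(4) vb(1) by auto
    qed
  qed
  from this[OF finite_Basis] obtain Q v where QQ: "\<forall>\<omega>\<in>space M. \<exists>u\<in>K. Q \<omega> u"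
      "\<forall>\<omega>\<in>space M. \<forall>u\<in>K. Q \<omega> u \<longrightarrow> P \<omega> u \<and> (\<forall>b\<in>Basis. u \<bullet> b = v b \<omega>)"
      "\<forall>b\<in>Basis. v b \<in> borel_measurable M" by (elim exE conjE) (rule that)
  have "(\<Sum>b\<in>Basis. v b \<omega> *\<^sub>R b) \<in> K \<and> P \<omega> (\<Sum>b\<in>Basis. v b \<omega> *\<^sub>R b)" if w: "\<omega> \<in> space M" for \<omega>
  proof -
    obtain u where u: "u \<in> K" "P \<omega> u" "\<forall>b\<in>Basis. u \<bullet> b = v b \<omega>" 
    proof -
      obtain u where u: "u \<in> K" "Q \<omega> u" using bspec[OF QQ(1) w] by (rule bexE)
      with bspec[OF bspec[OF QQ(2) w] u(1)] show thesis by (intro that[of u]) auto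
    qed
    have "(\<Sum>b\<in>Basis. v b \<omega> *\<^sub>R b) = (\<Sum>b\<in>Basis. (u \<bullet> b) *\<^sub>R b)" using u(3) by simp
    also have "\<dots> = u" by (rule euclidean_representation)
    finally show ?thesis using u by simp
  qed
  moreover have "(\<lambda>\<omega>. \<Sum>b\<in>Basis. v b \<omega> *\<^sub>R b) \<in> borel_measurable M"
    using QQ(3) by (intro borel_measurable_sum borel_measurable_scaleR) auto
  ultimately show ?thesis by (intro bexI[of _ "\<lambda>\<omega>. \<Sum>b\<in>Basis. v b \<omega> *\<^sub>R b"]) auto
qed

text \<open>Row \<open>k\<close> should be close to the \<open>k\<close>-th unit vector.  It is chosen with \<open>k\<close>-th entry at least
  \<open>(1 + \<rho>) / 2\<close> among the maximizers over the feasible directions whose \<open>k\<close>-th entry is at least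
  \<open>\<rho>\<close> in absolute value, whenever there is such a choice.  The gap between \<open>\<rho>\<close> and \<open>(1 + \<rho>) / 2\<close>
  makes it a local maximizer; for \<open>\<rho> = 0\<close> it is a global one.\<close>

definition good_row :: "('p \<Rightarrow> real) \<Rightarrow> (real^'p \<Rightarrow> real) \<Rightarrow> 'p \<Rightarrow> (real^'p) set \<Rightarrow> real^'p \<Rightarrow> bool" where
  "good_row \<rho> f k S u \<longleftrightarrow>
     u \<in> S \<and> (1 + \<rho> k) / 2 \<le> u $ k \<and> (\<forall>u'\<in>S. \<rho> k \<le> \<bar>u' $ k\<bar> \<longrightarrow> f u' \<le> f u)"

definition row_choice :: "('p \<Rightarrow> real) \<Rightarrow> (real^'p \<Rightarrow> real) \<Rightarrow> 'p \<Rightarrow> (real^'p) set \<Rightarrow> real^'p \<Rightarrow> bool" where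
  "row_choice \<rho> f k S u \<longleftrightarrow>
     u \<in> S \<and> (if \<exists>u'. good_row \<rho> f k S u' then good_row \<rho> f k S u else \<forall>u'\<in>S. f u' \<le> f u)"

lemma row_choice_local_max:
  assumes c: "row_choice \<rho> f k S u" and r: "\<rho> k < 1"
  shows "\<exists>e>0. \<forall>v\<in>S. dist v u < e \<longrightarrow> f v \<le> f u"
proof (cases "good_row \<rho> f k S u")
  case True
  have "f v \<le> f u" if v: "v \<in> S" "dist v u < (1 - \<rho> k) / 2" for v
  proof -
    have "\<bar>v $ k - u $ k\<bar> \<le> dist v u"
      using component_le_norm_cart[of "v - u" k] by (simp add: dist_norm)
    moreover have "1 + \<rho> k \<le> 2 * (u $ k)" using True by (simp add: good_row_def)
    ultimately have "\<rho> k \<le> v $ k" using v by (simp add: abs_if split: if_splits)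
    then show ?thesis using True v by (auto simp: good_row_def)
  qed
  then show ?thesis using r by (intro exI[of _ "(1 - \<rho> k) / 2"]) auto
next
  case False
  then show ?thesis using c by (auto simp: row_choice_def intro!: exI[of _ 1] split: if_splits)
qed

lemma row_choice_global_max:
  assumes "row_choice \<rho> f k S u" "\<rho> k = 0" "v \<in> S"
  shows "f v \<le> f u"
  using assms by (auto simp: row_choice_def good_row_def split: if_splits)

section \<open>Measurable choice of orthonormal rows\<close>

lemma exists_unit_orthogonal:
  fixes V :: "'j \<Rightarrow> real^'p"
  assumes "finite J" "card J < CARD('p)"
  obtains u where "norm u = 1" "\<And>j. j \<in> J \<Longrightarrow> u \<bullet> V j = 0"
proof -
  have "dim (V ` J) \<le> card (V ` J)" using assms by (intro dim_le_card') auto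
  also have "\<dots> \<le> card J" using assms by (intro card_image_le) auto
  finally have "dim (V ` J) < DIM(real^'p)" using assms by simp
  then obtain x where x: "x \<noteq> 0" "\<And>y. y \<in> span (V ` J) \<Longrightarrow> orthogonal x y"
    using orthogonal_to_subspace_exists by blast
  show thesis
  proof (rule that[of "x /\<^sub>R norm x"])
    show "norm (x /\<^sub>R norm x) = 1" using x by simp
    show "(x /\<^sub>R norm x) \<bullet> V j = 0" if "j \<in> J" for j
      using x(2)[of "V j"] that by (simp add: orthogonal_def span_base)
  qed
qed

text \<open>Good rows form a random closed set, so the existence of one is an event
  \<open>D\<close>. The case distinction in \<open>row_choice\<close> therefore keeps the admissible
  set random closed: good rows on \<open>D\<close>, unrestricted maximizers off it. A dimension
  count makes the feasible set nonempty.\<close>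

lemma measurable_row:
  fixes f :: "'w \<Rightarrow> real^'p \<Rightarrow> real" and V :: "'j \<Rightarrow> 'w \<Rightarrow> real^'p"
  assumes f: "caratheodory M (sphere 0 1) f"
    and J: "finite J" "card J < CARD('p)" and V: "\<And>j. j \<in> J \<Longrightarrow> V j \<in> borel_measurable M"
  shows "\<exists>s\<in>borel_measurable M. \<forall>\<omega>\<in>space M.
    row_choice \<rho> (f \<omega>) k {u. norm u = 1 \<and> (\<forall>j\<in>J. u \<bullet> V j \<omega> = 0)} (s \<omega>)"
proof -
  let ?K = "sphere (0::real^'p) 1"
  let ?S = "\<lambda>\<omega>. {u. norm u = 1 \<and> (\<forall>j\<in>J. u \<bullet> V j \<omega> = 0)}"
  \<comment> \<open>The orthogonality constraints are put as inequalities between Caratheodory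
    functions, the form covered by \<open>random_closed_ge\<close>.\<close>
  define Fp where "Fp \<omega> u \<longleftrightarrow> (\<forall>j\<in>J. \<bar>u \<bullet> V j \<omega>\<bar> \<le> 0)" for \<omega> u
  define P1 where "P1 \<omega> u \<longleftrightarrow> Fp \<omega> u \<and> \<rho> k \<le> \<bar>u $ k\<bar>" for \<omega> u
  define G where "G \<omega> u \<longleftrightarrow> Fp \<omega> u \<and> (1 + \<rho> k) / 2 \<le> u $ k \<and> (\<forall>u'\<in>?K. P1 \<omega> u' \<longrightarrow> f \<omega> u' \<le> f \<omega> u)" for \<omega> u
  define D where "D = {\<omega>\<in>space M. \<exists>u\<in>?K. G \<omega> u}"
  define A where "A \<omega> u \<longleftrightarrow> (\<forall>u'\<in>?K. Fp \<omega> u' \<longrightarrow> f \<omega> u' \<le> f \<omega> u)" for \<omega> u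
  define P where "P \<omega> u \<longleftrightarrow> Fp \<omega> u \<and> (\<omega> \<in> D \<and> G \<omega> u \<or> \<omega> \<in> space M - D \<and> A \<omega> u)" for \<omega> u
  have cK: "compact ?K" by (rule compact_sphere)
  have rc1: "random_closed M ?K Fp"
    unfolding Fp_def
  proof (intro random_closed_all J random_closed_ge)
    fix j assume "j \<in> J"
    with V have [measurable]: "V j \<in> borel_measurable M" by blast
    show "caratheodory M ?K (\<lambda>\<omega> u. \<bar>u \<bullet> V j \<omega>\<bar>)"
      unfolding caratheodory_def by (intro conjI ballI continuous_intros) measurable
    show "caratheodory M ?K (\<lambda>\<omega> u. 0)"
      unfolding caratheodory_def by (intro conjI ballI continuous_intros) measurable
  qed
  have rck: "random_closed M ?K (\<lambda>\<omega> u. \<rho> k \<le> \<bar>u $ k\<bar>)" "random_closed M ?K (\<lambda>\<omega> u. (1 + \<rho> k) / 2 \<le> u $ k)"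
    by (intro random_closed_ge; unfold caratheodory_def; intro conjI ballI continuous_intros borel_measurable_const)+
  have rc2: "random_closed M ?K P1" unfolding P1_def by (intro random_closed_conj rc1 rck)
  have rc3: "random_closed M ?K G" unfolding G_def
    by (intro random_closed_conj rc1 rck random_closed_argmax(1)[OF rc2 cK f])
  have D: "D \<in> sets M" unfolding D_def by (rule random_closed_hit_sets[OF rc3 cK])
  have rc4: "random_closed M ?K A" unfolding A_def by (rule random_closed_argmax(1)[OF rc1 cK f])
  have rc5: "random_closed M ?K P" unfolding P_def
    using D by (intro random_closed_conj random_closed_disj random_closed_event rc1 rc3 rc4) auto
  have "\<exists>u\<in>?K. P \<omega> u" if w: "\<omega> \<in> space M" for \<omega>
  proof (cases "\<omega> \<in> D")
    case True
    then obtain u where "u \<in> ?K" "G \<omega> u" unfolding D_def by blast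
    with True show ?thesis by (intro bexI[of _ u]) (auto simp: P_def G_def)
  next
    case False
    obtain u where "norm u = 1" "\<And>j. j \<in> J \<Longrightarrow> u \<bullet> V j \<omega> = 0"
      using exists_unit_orthogonal[OF J, of "\<lambda>j. V j \<omega>"] by metis
    then have "\<exists>u\<in>?K. Fp \<omega> u" by (intro bexI[of _ u]) (auto simp: Fp_def)
    then obtain u where "u \<in> ?K" "Fp \<omega> u" "A \<omega> u"
      using random_closed_argmax(3)[OF rc1 cK f] w unfolding A_def by blast
    with False w show ?thesis by (intro bexI[of _ u]) (auto simp: P_def)
  qed
  from random_closed_selection[OF rc5 cK this]
  obtain s where s: "s \<in> borel_measurable M" "\<And>\<omega>. \<omega> \<in> space M \<Longrightarrow> s \<omega> \<in> ?K \<and> P \<omega> (s \<omega>)" by blast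
  have "row_choice \<rho> (f \<omega>) k (?S \<omega>) (s \<omega>)" if w: "\<omega> \<in> space M" for \<omega>
  proof -
    have S: "?S \<omega> = {u\<in>?K. Fp \<omega> u}" by (auto simp: Fp_def)
    have G: "good_row \<rho> (f \<omega>) k (?S \<omega>) u \<longleftrightarrow> u \<in> ?K \<and> G \<omega> u" for u
      unfolding good_row_def S G_def P1_def by auto
    have D: "(\<exists>u'. good_row \<rho> (f \<omega>) k (?S \<omega>) u') \<longleftrightarrow> \<omega> \<in> D" unfolding G using w by (auto simp: D_def)
    have "s \<omega> \<in> ?K \<and> P \<omega> (s \<omega>)" by (rule s(2)[OF w])
    then show ?thesis
      unfolding row_choice_def D unfolding G unfolding S P_def A_def by auto
  qed
  with s(1) show ?thesis by blast
qed

text \<open>Each induction step adds an index above all present ones. Its row is constrained by all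
  rows chosen so far, and their own constraints do not change.\<close>

lemma measurable_row_choices:
  fixes f :: "'w \<Rightarrow> real^('p::{finite,linorder}) \<Rightarrow> real"
  assumes f: "caratheodory M (sphere 0 1) f"
  shows "\<exists>U. U \<in> borel_measurable M \<and> (\<forall>\<omega>\<in>space M. orthogonal_matrix (U \<omega>) \<and>
    (\<forall>k. row_choice \<rho> (f \<omega>) k (feasible_dirs (U \<omega>) k) (U \<omega> $ k)))"
proof -
  have "\<exists>V :: 'p \<Rightarrow> 'w \<Rightarrow> real^('p::{finite,linorder}). \<forall>k\<in>A. V k \<in> borel_measurable M \<and>
      (\<forall>\<omega>\<in>space M. row_choice \<rho> (f \<omega>) k {u. norm u = 1 \<and> (\<forall>j\<in>{j\<in>A. j < k}. u \<bullet> V j \<omega> = 0)} (V k \<omega>))"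
    if "finite A" for A :: "'p set"
    using that
  proof (induction A rule: finite_linorder_max_induct)
    case empty
    show ?case by simp
  next
    case (insert b A)
    then obtain V :: "'p \<Rightarrow> 'w \<Rightarrow> real^('p::{finite,linorder})" where V: "\<And>k. k \<in> A \<Longrightarrow> V k \<in> borel_measurable M"
      "\<And>k \<omega>. k \<in> A \<Longrightarrow> \<omega> \<in> space M \<Longrightarrow>
         row_choice \<rho> (f \<omega>) k {u. norm u = 1 \<and> (\<forall>j\<in>{j\<in>A. j < k}. u \<bullet> V j \<omega> = 0)} (V k \<omega>)"
      by blast
    have "b \<notin> A" using insert by auto
    then have "card A < CARD('p)" by (intro psubset_card_mono) auto
    from measurable_row[OF f \<open>finite A\<close> this V(1)]
    obtain s where s: "s \<in> borel_measurable M"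
      "\<forall>\<omega>\<in>space M. row_choice \<rho> (f \<omega>) b {u. norm u = 1 \<and> (\<forall>j\<in>A. u \<bullet> V j \<omega> = 0)} (s \<omega>)"
      by (rule bexE)
    define V' where "V' = V(b := s)"
    have V'A: "V' j = V j" if "j \<in> A" for j using that \<open>b \<notin> A\<close> by (auto simp: V'_def)
    have "V' k \<in> borel_measurable M \<and> (\<forall>\<omega>\<in>space M. row_choice \<rho> (f \<omega>) k
        {u. norm u = 1 \<and> (\<forall>j\<in>{j\<in>insert b A. j < k}. u \<bullet> V' j \<omega> = 0)} (V' k \<omega>))" if "k \<in> insert b A" for k
    proof (cases "k = b")
      case True
      have "{j\<in>insert b A. j < k} = A" using True insert.hyps by auto
      then show ?thesis using True s by (simp add: V'A V'_def[THEN fun_cong, of b])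
    next
      case False
      then have k: "k \<in> A" using that by simp
      have eq: "{j\<in>insert b A. j < k} = {j\<in>A. j < k}" using k insert.hyps by auto
      show ?thesis unfolding eq using k V by (simp add: V'A)
    qed
    then show ?case by blast
  qed
  from this[OF finite, of UNIV] obtain V :: "'p \<Rightarrow> 'w \<Rightarrow> real^('p::{finite,linorder})" where
    V: "\<And>k. V k \<in> borel_measurable M" and
    ch: "\<And>k \<omega>. \<omega> \<in> space M \<Longrightarrow> row_choice \<rho> (f \<omega>) k {u. norm u = 1 \<and> (\<forall>j<k. u \<bullet> V j \<omega> = 0)} (V k \<omega>)"
    by auto
  define U where "U \<omega> = (\<chi> k. V k \<omega>)" for \<omega>
  have Uk: "U \<omega> $ k = V k \<omega>" for \<omega> k by (simp add: U_def)
  have "U \<in> borel_measurable M" by (rule borel_measurable_vecI) (simp add: Uk V)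
  moreover have "orthogonal_matrix (U \<omega>)" if w: "\<omega> \<in> space M" for \<omega>
  proof -
    have r: "row k (U \<omega>) = V k \<omega>" for k by (simp add: row_def Uk vec_eq_iff)
    have n: "norm (V k \<omega>) = 1" and o: "j < k \<Longrightarrow> V k \<omega> \<bullet> V j \<omega> = 0" for k j
      using ch[OF w, of k] by (auto simp: row_choice_def)
    have "orthogonal (V i \<omega>) (V j \<omega>)" if "i \<noteq> j" for i j
      using that o[of i j] o[of j i] by (cases i j rule: linorder_cases) (auto simp: orthogonal_def inner_commute)
    then show ?thesis unfolding orthogonal_matrix_orthonormal_rows r using n by blast
  qed
  moreover have "row_choice \<rho> (f \<omega>) k (feasible_dirs (U \<omega>) k) (U \<omega> $ k)" if "\<omega> \<in> space M" for \<omega> k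
    unfolding feasible_dirs_def Uk by (rule ch[OF that])
  ultimately show ?thesis by blast
qed

section \<open>Convergence in probability as a filter\<close>

text \<open>A property of pairs of sample size and outcome holds eventually if its (inner) probability
  tends to \<open>1\<close>.  Convergence along this filter is convergence in probability, without any
  measurability requirement, and the library calculus of limits and Landau symbols applies.\<close>

definition whp :: "'w measure \<Rightarrow> (nat \<times> 'w) filter" where
  "whp M = Abs_filter (\<lambda>P. \<forall>d>0. \<forall>\<^sub>F n in sequentially. \<exists>A\<in>sets M. 1 - d \<le> measure M A \<and> (\<forall>\<omega>\<in>A. P (n, \<omega>)))"

text \<open>This is \<open>O_P(1)\<close>. The constant may depend on \<open>d\<close>; boundedness
  along \<open>whp M\<close> would ask for one constant valid for every \<open>d\<close>, which
  already fails for a sequence with a fixed normal distribution.\<close>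

definition stoch_bounded :: "'w measure \<Rightarrow> (nat \<Rightarrow> 'w \<Rightarrow> real) \<Rightarrow> bool" where
  "stoch_bounded M X \<longleftrightarrow> (\<forall>d>0. \<exists>K. \<forall>\<^sub>F n in sequentially. \<exists>A\<in>sets M. 1 - d \<le> measure M A \<and> (\<forall>\<omega>\<in>A. \<bar>X n \<omega>\<bar> \<le> K))"

context prob_space
begin

abbreviation likely :: "real \<Rightarrow> ('a \<Rightarrow> bool) \<Rightarrow> bool" where
  "likely d P \<equiv> \<exists>A\<in>events. 1 - d \<le> prob A \<and> (\<forall>\<omega>\<in>A. P \<omega>)"

lemma prob_Int_ge:
  assumes "A \<in> events" "B \<in> events" "1 - d \<le> prob A" "1 - e \<le> prob B"
  shows "1 - (d + e) \<le> prob (A \<inter> B)"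
proof -
  have "prob (A \<union> B) = prob A + prob B - prob (A \<inter> B)"
    using assms by (intro measure_Un3) (auto simp: fmeasurable_eq_sets)
  moreover have "prob (A \<union> B) \<le> 1" by (rule prob_le_1)
  ultimately show ?thesis using assms by linarith
qed

lemma eventually_whp:
  "eventually P (whp M) \<longleftrightarrow>
     (\<forall>d>0. \<forall>\<^sub>F n in sequentially. likely d (\<lambda>\<omega>. P (n, \<omega>)))"
  unfolding whp_def
proof (rule eventually_Abs_filter, rule is_filter.intro)
  show "\<forall>d>0. \<forall>\<^sub>F n in sequentially. likely d (\<lambda>\<omega>. True)"
    by (auto intro!: always_eventually bexI[of _ "space M"] simp: prob_space)
next
  fix P Q :: "nat \<times> 'a \<Rightarrow> bool"
  assume P: "\<forall>d>0. \<forall>\<^sub>F n in sequentially. likely d (\<lambda>\<omega>. P (n, \<omega>))"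
    and Q: "\<forall>d>0. \<forall>\<^sub>F n in sequentially. likely d (\<lambda>\<omega>. Q (n, \<omega>))"
  show "\<forall>d>0. \<forall>\<^sub>F n in sequentially. likely d (\<lambda>\<omega>. P (n, \<omega>) \<and> Q (n, \<omega>))"
  proof (intro allI impI)
    fix d :: real assume "d > 0"
    then have "d / 2 > 0" by simp
    from P[rule_format, OF this] Q[rule_format, OF this]
    show "\<forall>\<^sub>F n in sequentially. likely d (\<lambda>\<omega>. P (n, \<omega>) \<and> Q (n, \<omega>))"
    proof eventually_elim
      case (elim n)
      then obtain A B where "A \<in> events" "1 - d/2 \<le> prob A" "\<forall>\<omega>\<in>A. P (n, \<omega>)"
        "B \<in> events" "1 - d/2 \<le> prob B" "\<forall>\<omega>\<in>B. Q (n, \<omega>)" by blast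
      then show ?case using prob_Int_ge[of A B "d/2" "d/2"] by (intro bexI[of _ "A \<inter> B"]) auto
    qed
  qed
next
  fix P Q :: "nat \<times> 'a \<Rightarrow> bool"
  assume PQ: "\<forall>x. P x \<longrightarrow> Q x"
    and P: "\<forall>d>0. \<forall>\<^sub>F n in sequentially. likely d (\<lambda>\<omega>. P (n, \<omega>))"
  show "\<forall>d>0. \<forall>\<^sub>F n in sequentially. likely d (\<lambda>\<omega>. Q (n, \<omega>))"
  proof (intro allI impI)
    fix d :: real assume "d > 0"
    from P[rule_format, OF this]
    show "\<forall>\<^sub>F n in sequentially. likely d (\<lambda>\<omega>. Q (n, \<omega>))"
      by eventually_elim (use PQ in blast)
  qed
qed

lemma eventually_whp_space: "\<forall>\<^sub>F x in whp M. snd x \<in> space M"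
  unfolding eventually_whp
  by (auto intro!: always_eventually bexI[of _ "space M"] simp: prob_space)

lemma eventually_whp_sequentially:
  assumes "\<forall>\<^sub>F n in sequentially. P n"
  shows "\<forall>\<^sub>F x in whp M. P (fst x)"
  unfolding eventually_whp
  using assms by (auto elim!: eventually_mono intro!: bexI[of _ "space M"] simp: prob_space)

lemma tendsto_prob_whp:
  assumes "((\<lambda>x. X (fst x) (snd x)) \<longlongrightarrow> c) (whp M)"
  shows "tendsto_prob M X c"
  unfolding tendsto_prob_def
proof (intro allI impI)
  fix e :: real assume "e > 0"
  with assms have ev: "\<forall>\<^sub>F x in whp M. dist (X (fst x) (snd x)) c < e" by (rule tendstoD)
  show "(\<lambda>n. prob {\<omega> \<in> space M. e < dist (X n \<omega>) c}) \<longlonglongrightarrow> 0"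
  proof (rule tendstoI)
    fix d :: real assume d: "d > 0"
    then have "d / 2 > 0" by simp
    with ev have "\<forall>\<^sub>F n in sequentially. likely (d/2) (\<lambda>\<omega>. dist (X n \<omega>) c < e)"
      unfolding eventually_whp by auto
    then show "\<forall>\<^sub>F n in sequentially. dist (prob {\<omega> \<in> space M. e < dist (X n \<omega>) c}) 0 < d"
    proof eventually_elim
      case (elim n)
      then obtain A where A: "A \<in> events" "1 - d/2 \<le> prob A" "\<forall>\<omega>\<in>A. dist (X n \<omega>) c < e" by blast
      \<comment> \<open>Monotonicity asks only the larger set to be an event, so \<open>X n\<close>
        need not be measurable.\<close>
      have "prob {\<omega> \<in> space M. e < dist (X n \<omega>) c} \<le> prob (space M - A)"
        using A by (intro finite_measure_mono) fastforce+
      also have "\<dots> = 1 - prob A" using A by (simp add: prob_compl)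
      finally show ?case using A d by simp
    qed
  qed
qed

section \<open>Calculus of stochastic boundedness\<close>

lemma stoch_bounded_const: "stoch_bounded M (\<lambda>n \<omega>. c)"
  unfolding stoch_bounded_def
  by (intro allI impI exI[of _ "\<bar>c\<bar>"] always_eventually bexI[of _ "space M"]) (auto simp: prob_space)

lemma stoch_bounded_add:
  assumes X: "stoch_bounded M X" and Y: "stoch_bounded M Y"
  shows "stoch_bounded M (\<lambda>n \<omega>. X n \<omega> + Y n \<omega>)"
  unfolding stoch_bounded_def
proof (intro allI impI)
  fix d :: real assume "d > 0"
  then have d: "d / 2 > 0" by simp
  obtain K L where K: "\<forall>\<^sub>F n in sequentially. likely (d/2) (\<lambda>\<omega>. \<bar>X n \<omega>\<bar> \<le> K)"
    and L: "\<forall>\<^sub>F n in sequentially. likely (d/2) (\<lambda>\<omega>. \<bar>Y n \<omega>\<bar> \<le> L)"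
    using X[unfolded stoch_bounded_def, rule_format, OF d] Y[unfolded stoch_bounded_def, rule_format, OF d] by blast
  have "\<forall>\<^sub>F n in sequentially. likely d (\<lambda>\<omega>. \<bar>X n \<omega> + Y n \<omega>\<bar> \<le> K + L)"
    using K L
  proof eventually_elim
    case (elim n)
    then obtain A B where AB: "A \<in> events" "1 - d/2 \<le> prob A" "\<forall>\<omega>\<in>A. \<bar>X n \<omega>\<bar> \<le> K"
      "B \<in> events" "1 - d/2 \<le> prob B" "\<forall>\<omega>\<in>B. \<bar>Y n \<omega>\<bar> \<le> L" by blast
    have "\<bar>X n \<omega> + Y n \<omega>\<bar> \<le> K + L" if "\<omega> \<in> A \<inter> B" for \<omega>
      using that AB(3,6) abs_triangle_ineq[of "X n \<omega>" "Y n \<omega>"] by fastforce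
    then show ?case using AB prob_Int_ge[of A B "d/2" "d/2"] by (intro bexI[of _ "A \<inter> B"]) auto
  qed
  then show "\<exists>K. \<forall>\<^sub>F n in sequentially. likely d (\<lambda>\<omega>. \<bar>X n \<omega> + Y n \<omega>\<bar> \<le> K)" by blast
qed

lemma stoch_bounded_sum:
  assumes "\<And>i. i \<in> I \<Longrightarrow> stoch_bounded M (X i)"
  shows "stoch_bounded M (\<lambda>n \<omega>. \<Sum>i\<in>I. X i n \<omega>)"
  using assms by (induction I rule: infinite_finite_induct) (auto intro: stoch_bounded_const stoch_bounded_add)

lemma stoch_bounded_cmult:
  assumes "stoch_bounded M X"
  shows "stoch_bounded M (\<lambda>n \<omega>. c * X n \<omega>)"
  unfolding stoch_bounded_def
proof (intro allI impI)
  fix d :: real assume "d > 0"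
  then obtain K where K: "\<forall>\<^sub>F n in sequentially. likely d (\<lambda>\<omega>. \<bar>X n \<omega>\<bar> \<le> K)"
    using assms unfolding stoch_bounded_def by blast
  have "\<forall>\<^sub>F n in sequentially. likely d (\<lambda>\<omega>. \<bar>c * X n \<omega>\<bar> \<le> \<bar>c\<bar> * K)"
    using K by eventually_elim (fastforce simp: abs_mult intro: mult_left_mono)
  then show "\<exists>K. \<forall>\<^sub>F n in sequentially. likely d (\<lambda>\<omega>. \<bar>c * X n \<omega>\<bar> \<le> K)" by blast
qed

lemma stoch_bounded_abs: "stoch_bounded M X \<Longrightarrow> stoch_bounded M (\<lambda>n \<omega>. \<bar>X n \<omega>\<bar>)"
  unfolding stoch_bounded_def by simp

lemma stoch_bounded_second_moment:
  assumes [measurable]: "\<And>n. X n \<in> borel_measurable M" and int: "\<And>n. integrable M (\<lambda>\<omega>. (X n \<omega>)\<^sup>2)"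
    and C: "\<And>n. expectation (\<lambda>\<omega>. (X n \<omega>)\<^sup>2) \<le> C"
  shows "stoch_bounded M X"
  unfolding stoch_bounded_def
proof (intro allI impI)
  fix d :: real assume d: "d > 0"
  have "C \<ge> 0" using C[of 0] by (rule order_trans[rotated]) simp
  \<comment> \<open>Markov's inequality at level \<open>L\<close> gives the bound
    \<open>C / L\<close>, which is at most \<open>d\<close>; the added 1 keeps \<open>L\<close>
    positive when \<open>C = 0\<close>.\<close>
  define L where "L = (C + 1) / d"
  have L: "L > 0" using d \<open>C \<ge> 0\<close> by (simp add: L_def)
  have "likely d (\<lambda>\<omega>. \<bar>X n \<omega>\<bar> \<le> sqrt L)" for n
  proof (rule bexI)
    let ?B = "{\<omega>\<in>space M. L \<le> (X n \<omega>)\<^sup>2}"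
    have B: "?B \<in> events" by measurable
    then show "space M - ?B \<in> events" by blast
    have "prob ?B \<le> expectation (\<lambda>\<omega>. (X n \<omega>)\<^sup>2) / L"
      by (rule integral_Markov_inequality_measure[OF int B]) (use L in auto)
    also have "\<dots> \<le> (C + 1) / L" using C[of n] L by (intro divide_right_mono) auto
    also have "\<dots> = d" using \<open>C \<ge> 0\<close> d by (simp add: L_def)
    finally have "1 - d \<le> prob (space M - ?B)" by (simp add: prob_compl[OF B])
    then show "1 - d \<le> prob (space M - ?B) \<and> (\<forall>\<omega>\<in>space M - ?B. \<bar>X n \<omega>\<bar> \<le> sqrt L)"
      by (auto intro!: real_le_rsqrt)
  qed
  then show "\<exists>K. \<forall>\<^sub>F n in sequentially. likely d (\<lambda>\<omega>. \<bar>X n \<omega>\<bar> \<le> K)"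
    by (intro exI[of _ "sqrt L"] always_eventually) blast
qed

text \<open>Here the filter meets \<open>O_P\<close>: once \<open>d\<close> has fixed the bound
  \<open>K\<close> for the scaled \<open>R\<close>, the Landau constant can still be chosen as small
  as \<open>K\<close> requires, since the estimate \<open>o(R)\<close> holds with high probability
  for every constant.\<close>

lemma smallo_scaled_tendsto:
  assumes f: "f \<in> o[whp M](R)" and b: "stoch_bounded M (\<lambda>n \<omega>. a n * R (n, \<omega>))"
  shows "((\<lambda>x. a (fst x) * f x) \<longlongrightarrow> 0) (whp M)"
proof (rule tendstoI)
  fix e :: real assume e: "e > 0"
  show "\<forall>\<^sub>F x in whp M. dist (a (fst x) * f x) 0 < e"
    unfolding eventually_whp
  proof (intro allI impI)
    fix d :: real assume "d > 0"
    then have d: "d / 2 > 0" by simp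
    obtain K where K: "\<forall>\<^sub>F n in sequentially. likely (d/2) (\<lambda>\<omega>. \<bar>a n * R (n, \<omega>)\<bar> \<le> K)"
      using b[unfolded stoch_bounded_def, rule_format, OF d] by blast
    \<comment> \<open>\<open>K\<close> may be zero or negative; the absolute value and the added 1
      keep the quotient positive.\<close>
    define c where "c = e / (\<bar>K\<bar> + 1)"
    have c: "c > 0" using e by (simp add: c_def)
    from landau_o.smallD[OF f c]
    have "\<forall>\<^sub>F n in sequentially. likely (d/2) (\<lambda>\<omega>. norm (f (n, \<omega>)) \<le> c * norm (R (n, \<omega>)))"
      unfolding eventually_whp using d by blast
    with K show "\<forall>\<^sub>F n in sequentially. likely d (\<lambda>\<omega>. dist (a (fst (n, \<omega>)) * f (n, \<omega>)) 0 < e)"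
    proof eventually_elim
      case (elim n)
      then obtain A B where AB: "A \<in> events" "1 - d/2 \<le> prob A" "\<forall>\<omega>\<in>A. \<bar>a n * R (n, \<omega>)\<bar> \<le> K"
        "B \<in> events" "1 - d/2 \<le> prob B" "\<forall>\<omega>\<in>B. norm (f (n, \<omega>)) \<le> c * norm (R (n, \<omega>))" by blast
      have "\<bar>a n * f (n, \<omega>)\<bar> < e" if w: "\<omega> \<in> A \<inter> B" for \<omega>
      proof -
        have "\<bar>a n * f (n, \<omega>)\<bar> \<le> \<bar>a n\<bar> * (c * \<bar>R (n, \<omega>)\<bar>)"
          using AB(6) w by (auto simp: abs_mult intro!: mult_left_mono)
        also have "\<dots> = c * \<bar>a n * R (n, \<omega>)\<bar>" by (simp add: abs_mult)
        also have "\<dots> \<le> c * \<bar>K\<bar>" using AB(3) w c by (intro mult_left_mono) force+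
        also have "\<dots> < e" using e by (simp add: c_def field_simps)
        finally show ?thesis .
      qed
      then show ?case using AB prob_Int_ge[of A B "d/2" "d/2"] by (intro bexI[of _ "A \<inter> B"]) auto
    qed
  qed
qed

end

section \<open>Moments and laws of large numbers\<close>

text \<open>Lists with repetition let mixed moments be written by their indices, as in
  \<open>[k, k, l]\<close>, with products as concatenations and exponents recovered by
  \<open>count_list\<close>.\<close>

definition monom_vec :: "'p list \<Rightarrow> real^'p \<Rightarrow> real" where
  "monom_vec xs v = (\<Prod>a\<leftarrow>xs. v $ a)"

lemma monom_vec_simps [simp]:
  "monom_vec [] v = 1" "monom_vec (a # xs) v = v $ a * monom_vec xs v"
  by (simp_all add: monom_vec_def)

lemma monom_vec_append: "monom_vec (xs @ ys) v = monom_vec xs v * monom_vec ys v"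
  by (simp add: monom_vec_def)

lemma monom_vec_prod: "monom_vec xs v = (\<Prod>k\<in>UNIV. v $ k ^ count_list xs k)"
proof (induction xs)
  case (Cons a xs)
  have "(\<Prod>k\<in>UNIV. v $ k ^ count_list (a # xs) k) = (\<Prod>k\<in>UNIV. (if k = a then v $ k else 1) * v $ k ^ count_list xs k)"
    by (intro prod.cong) auto
  then show ?case using Cons by (simp add: prod.distrib)
qed simp

lemma borel_measurable_monom_vec [measurable]: "monom_vec xs \<in> borel_measurable borel"
  unfolding monom_vec_prod[abs_def] by measurable

locale iid_sample = N: prob_space N + M: prob_space M
  for N :: "'v measure" and M :: "'w measure" +
  fixes z :: "'v \<Rightarrow> real^'p" and Z :: "nat \<Rightarrow> 'w \<Rightarrow> real^'p"
  assumes z_measurable [measurable]: "z \<in> borel_measurable N"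
    and components_indep: "N.indep_vars (\<lambda>_. borel) (\<lambda>k v. z v $ k) UNIV"
    and sample_indep: "M.indep_vars (\<lambda>_. borel) Z UNIV"
    and sample_distr: "distr M borel (Z i) = distr N borel z"
begin

lemma Z_measurable [measurable]: "Z i \<in> borel_measurable M"
  using sample_indep unfolding M.indep_vars_def by blast

lemma integrable_sample:
  assumes [measurable]: "f \<in> borel_measurable borel" and "integrable N (\<lambda>v. f (z v))"
  shows "integrable M (\<lambda>\<omega>. f (Z i \<omega>) :: real)"
  using assms(2) integrable_distr_eq[of z N borel f] integrable_distr_eq[of "Z i" M borel f]
  by (simp add: sample_distr)

lemma integral_sample:
  assumes [measurable]: "f \<in> borel_measurable borel"
  shows "(LINT \<omega>|M. f (Z i \<omega>)) = (LINT v|N. f (z v) :: real)"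
  using integral_distr[of z N borel f] integral_distr[of "Z i" M borel f] by (simp add: sample_distr)

definition avg :: "nat \<Rightarrow> (real^'p \<Rightarrow> real) \<Rightarrow> 'w \<Rightarrow> real" where
  "avg n f \<omega> = (\<Sum>i<n. f (Z i \<omega>)) / real n"

lemma borel_measurable_avg:
  assumes [measurable]: "f \<in> borel_measurable borel"
  shows "avg n f \<in> borel_measurable M"
  unfolding avg_def[abs_def] by measurable

text \<open>Expanding the square leaves only the diagonal: independence factors the mixed terms into
  products of means, which are zero.\<close>

lemma centered_sum_second_moment:
  assumes [measurable]: "f \<in> borel_measurable borel" and int: "integrable N (\<lambda>v. (f (z v))\<^sup>2)"
    and mean: "(LINT v|N. f (z v)) = 0"
  shows "integrable M (\<lambda>\<omega>. (\<Sum>i<n. f (Z i \<omega>))\<^sup>2)"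
    and "(LINT \<omega>|M. (\<Sum>i<n. f (Z i \<omega>))\<^sup>2) = real n * (LINT v|N. (f (z v))\<^sup>2)"
proof -
  have int1: "integrable N (\<lambda>v. f (z v))"
    by (rule N.square_integrable_imp_integrable[OF _ int]) measurable
  have cross: "integrable M (\<lambda>\<omega>. f (Z i \<omega>) * f (Z j \<omega>)) \<and>
      (LINT \<omega>|M. f (Z i \<omega>) * f (Z j \<omega>)) = (if i = j then LINT v|N. (f (z v))\<^sup>2 else 0)" for i j
  proof (cases "i = j")
    case True
    have "integrable M (\<lambda>\<omega>. (f (Z i \<omega>))\<^sup>2)" "(LINT \<omega>|M. (f (Z i \<omega>))\<^sup>2) = (LINT v|N. (f (z v))\<^sup>2)"
      using integrable_sample[of "\<lambda>u. (f u)\<^sup>2"] integral_sample[of "\<lambda>u. (f u)\<^sup>2"] int by simp_all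
    then show ?thesis using True by (simp add: power2_eq_square)
  next
    case False
    have ind: "M.indep_vars (\<lambda>_. borel) (\<lambda>i \<omega>. f (Z i \<omega>)) {i, j}"
      by (intro M.indep_vars_compose2[OF M.indep_vars_subset[OF sample_indep]]) auto
    have ints: "integrable M (\<lambda>\<omega>. f (Z k \<omega>))" for k by (rule integrable_sample) (auto intro: int1)
    have "integrable M (\<lambda>\<omega>. \<Prod>k\<in>{i,j}. f (Z k \<omega>))"
      by (intro M.indep_vars_integrable ind ints) auto
    moreover have "(LINT \<omega>|M. (\<Prod>k\<in>{i,j}. f (Z k \<omega>))) = (\<Prod>k\<in>{i,j}. LINT \<omega>|M. f (Z k \<omega>))"
      by (intro M.indep_vars_lebesgue_integral ind ints) auto
    ultimately show ?thesis using False mean by (simp add: integral_sample)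
  qed
  have sq: "(\<Sum>i<n. f (Z i \<omega>))\<^sup>2 = (\<Sum>i<n. \<Sum>j<n. f (Z i \<omega>) * f (Z j \<omega>))" for \<omega>
    by (simp add: power2_eq_square sum_product)
  show "integrable M (\<lambda>\<omega>. (\<Sum>i<n. f (Z i \<omega>))\<^sup>2)" unfolding sq
    using cross by (intro Bochner_Integration.integrable_sum) blast
  have "(LINT \<omega>|M. (\<Sum>i<n. f (Z i \<omega>))\<^sup>2) = (\<Sum>i<n. \<Sum>j<n. LINT \<omega>|M. f (Z i \<omega>) * f (Z j \<omega>))"
    unfolding sq using cross by (simp add: Bochner_Integration.integral_sum Bochner_Integration.integrable_sum)
  also have "\<dots> = (\<Sum>i<n. \<Sum>j<n. if i = j then LINT v|N. (f (z v))\<^sup>2 else 0)"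
    using cross by (intro sum.cong refl) blast
  also have "\<dots> = (\<Sum>i<n. LINT v|N. (f (z v))\<^sup>2)" by (intro sum.cong refl) (simp add: sum.delta)
  finally show "(LINT \<omega>|M. (\<Sum>i<n. f (Z i \<omega>))\<^sup>2) = real n * (LINT v|N. (f (z v))\<^sup>2)" by simp
qed

lemma avg_stoch_bounded:
  assumes [measurable]: "f \<in> borel_measurable borel" and int: "integrable N (\<lambda>v. (f (z v))\<^sup>2)"
    and mean: "(LINT v|N. f (z v)) = 0"
  shows "stoch_bounded M (\<lambda>n \<omega>. sqrt (real n) * avg n f \<omega>)"
proof (rule M.stoch_bounded_second_moment)
  note [measurable] = borel_measurable_avg
  show "(\<lambda>\<omega>. sqrt (real n) * avg n f \<omega>) \<in> borel_measurable M" for n by measurable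
  have eq: "(sqrt (real n) * avg n f \<omega>)\<^sup>2 = (\<Sum>i<n. f (Z i \<omega>))\<^sup>2 / real n" for n \<omega>
    by (simp add: avg_def power_mult_distrib power_divide) (simp add: power2_eq_square)
  show "integrable M (\<lambda>\<omega>. (sqrt (real n) * avg n f \<omega>)\<^sup>2)" for n
    unfolding eq using centered_sum_second_moment(1)[OF assms] by simp
  show "(LINT \<omega>|M. (sqrt (real n) * avg n f \<omega>)\<^sup>2) \<le> (LINT v|N. (f (z v))\<^sup>2)" for n
    unfolding eq using centered_sum_second_moment(2)[OF assms, of n] by simp
qed

lemma whp_pos: "\<forall>\<^sub>F x in whp M. fst x > 0"
  by (rule M.eventually_whp_sequentially[OF eventually_gt_at_top])

text \<open>The root-n bound is reused: the centered average is
  \<open>inverse (sqrt (real n))\<close>, which tends to 0, times a stochastically bounded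
  quantity.\<close>

lemma avg_LLN:
  assumes [measurable]: "f \<in> borel_measurable borel" and int: "integrable N (\<lambda>v. (f (z v))\<^sup>2)"
  shows "((\<lambda>x. avg (fst x) f (snd x)) \<longlongrightarrow> (LINT v|N. f (z v))) (whp M)"
proof -
  define c where "c = (LINT v|N. f (z v))"
  define g where "g u = f u - c" for u
  have [measurable]: "g \<in> borel_measurable borel" unfolding g_def by measurable
  have int1: "integrable N (\<lambda>v. f (z v))"
    by (rule N.square_integrable_imp_integrable[OF _ int]) measurable
  have g2: "integrable N (\<lambda>v. (g (z v))\<^sup>2)"
    using int int1 by (simp add: g_def power2_diff)
  have g0: "(LINT v|N. g (z v)) = 0" using int1 by (simp add: g_def c_def N.prob_space)
  have "stoch_bounded M (\<lambda>n \<omega>. sqrt (real n) * avg n g \<omega>)" by (rule avg_stoch_bounded[OF _ g2 g0]) measurable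
  then have sb: "stoch_bounded M (\<lambda>n \<omega>. 1 * (\<lambda>x. sqrt (real (fst x)) * avg (fst x) g (snd x)) (n, \<omega>))" by simp
  have "((\<lambda>n. inverse (sqrt (real n))) \<longlongrightarrow> 0) sequentially"
    by (rule tendsto_inverse_0_at_top[OF filterlim_compose[OF sqrt_at_top filterlim_real_sequentially]])
  then have "((\<lambda>x. inverse (sqrt (real (fst x)))) \<longlongrightarrow> 0) (whp M)"
    unfolding tendsto_def by (auto intro: M.eventually_whp_sequentially)
  then have "(\<lambda>x. inverse (sqrt (real (fst x)))) \<in> o[whp M](\<lambda>x. 1)"
    by (intro smalloI_tendsto) auto
  then have "(\<lambda>x. inverse (sqrt (real (fst x))) * (sqrt (real (fst x)) * avg (fst x) g (snd x)))
      \<in> o[whp M](\<lambda>x. 1 * (sqrt (real (fst x)) * avg (fst x) g (snd x)))"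
    by (intro landau_o.small_big_mult) auto
  then have "((\<lambda>x. 1 * (inverse (sqrt (real (fst x))) * (sqrt (real (fst x)) * avg (fst x) g (snd x)))) \<longlongrightarrow> 0) (whp M)"
    by (intro M.smallo_scaled_tendsto[OF _ sb]) simp
  then have "((\<lambda>x. avg (fst x) f (snd x) - c) \<longlongrightarrow> 0) (whp M)"
  proof (rule Lim_transform_eventually)
    show "\<forall>\<^sub>F x in whp M. 1 * (inverse (sqrt (real (fst x))) * (sqrt (real (fst x)) * avg (fst x) g (snd x))) = avg (fst x) f (snd x) - c"
      using whp_pos by eventually_elim (simp add: avg_def g_def sum_subtractf diff_divide_distrib)
  qed
  then show ?thesis unfolding c_def by (rule LIM_zero_cancel)
qed

section \<open>Moments of monomials in independent components\<close>

lemma integrable_power_le: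
  assumes "integrable N (\<lambda>v. (z v $ k) ^ (2 * d))" "m \<le> 2 * d"
  shows "integrable N (\<lambda>v. (z v $ k) ^ m)"
proof (rule Bochner_Integration.integrable_bound)
  show "integrable N (\<lambda>v. 1 + (z v $ k) ^ (2 * d))" using assms by simp
  have "\<bar>t\<bar> ^ m \<le> 1 + \<bar>t\<bar> ^ (2 * d)" for t :: real
  proof (cases "\<bar>t\<bar> \<le> 1")
    case True
    then show ?thesis using power_le_one[of "\<bar>t\<bar>" m] by (simp add: add_increasing2)
  next
    case False
    then have "\<bar>t\<bar> ^ m \<le> \<bar>t\<bar> ^ (2 * d)" using assms(2) by (intro power_increasing) auto
    then show ?thesis by simp
  qed
  then show "AE v in N. norm ((z v $ k) ^ m) \<le> norm (1 + (z v $ k) ^ (2 * d))"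
    by (intro AE_I2) (simp add: power_abs power_mult)
qed measurable

text \<open>Independence makes a product of integrable powers integrable and factors its mean. A
  moment of order \<open>2 * d\<close> of each single component is enough, because no exponent
  exceeds the length of the list.\<close>

lemma monomial_moment:
  assumes int: "\<And>k. integrable N (\<lambda>v. (z v $ k) ^ (2 * d))" and len: "length xs \<le> 2 * d"
  shows "integrable N (\<lambda>v. monom_vec xs (z v))"
    and "(LINT v|N. monom_vec xs (z v)) = (\<Prod>k\<in>UNIV. LINT v|N. (z v $ k) ^ count_list xs k)"
proof -
  have ind: "N.indep_vars (\<lambda>_. borel) (\<lambda>k v. (z v $ k) ^ count_list xs k) UNIV"
    by (intro N.indep_vars_compose2[OF components_indep]) measurable
  have "count_list xs k \<le> 2 * d" for k using count_le_length[of xs k] len by simp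
  then have ints: "integrable N (\<lambda>v. (z v $ k) ^ count_list xs k)" for k
    by (intro integrable_power_le[OF int])
  show "integrable N (\<lambda>v. monom_vec xs (z v))" unfolding monom_vec_prod
    by (intro N.indep_vars_integrable ind ints) auto
  show "(LINT v|N. monom_vec xs (z v)) = (\<Prod>k\<in>UNIV. LINT v|N. (z v $ k) ^ count_list xs k)"
    unfolding monom_vec_prod by (intro N.indep_vars_lebesgue_integral ind ints) auto
qed

text \<open>Squaring doubles the list. This is why cubic averages call for sixth moments and quartic
  ones for eighth moments.\<close>

lemma monomial_square_integrable:
  assumes int: "\<And>k. integrable N (\<lambda>v. (z v $ k) ^ (2 * d))" and len: "length xs \<le> d"
  shows "integrable N (\<lambda>v. (monom_vec xs (z v))\<^sup>2)"
  using monomial_moment(1)[OF int, of "xs @ xs"] len by (simp add: monom_vec_append power2_eq_square)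

end

section \<open>The functional at the empirical distribution\<close>

lemma emp_integral: "(LINT i|emp n. f i) = (\<Sum>i<n. f i) / real n" for f :: "nat \<Rightarrow> real"
  by (simp add: emp_def integral_uniform_count_measure)

text \<open>The projection index without the inner standardization. On unit directions of
  standardized data that step does nothing, and what remains is a polynomial in
  \<open>u\<close>.\<close>

definition index_poly :: "real \<Rightarrow> nat \<Rightarrow> (nat \<Rightarrow> real^'p) \<Rightarrow> real^'p \<Rightarrow> real" where
  "index_poly \<alpha> n y u =
     \<alpha> * ((\<Sum>i<n. (u \<bullet> y i) ^ 3) / real n)\<^sup>2 + (1 - \<alpha>) * ((\<Sum>i<n. (u \<bullet> y i) ^ 4) / real n - 3)\<^sup>2"

text \<open>Half the gradient of \<open>index_poly\<close>.\<close>

definition index_grad :: "real \<Rightarrow> nat \<Rightarrow> (nat \<Rightarrow> real^'p) \<Rightarrow> real^'p \<Rightarrow> real^'p" where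
  "index_grad \<alpha> n y u =
     (3 * \<alpha> * ((\<Sum>i<n. (u \<bullet> y i) ^ 3) / real n)) *\<^sub>R (\<chi> m. (\<Sum>i<n. (u \<bullet> y i)\<^sup>2 * y i $ m) / real n)
     + (4 * (1 - \<alpha>) * ((\<Sum>i<n. (u \<bullet> y i) ^ 4) / real n - 3)) *\<^sub>R
         (\<chi> m. (\<Sum>i<n. (u \<bullet> y i) ^ 3 * y i $ m) / real n)"

lemma index_poly_uminus: "index_poly \<alpha> n y (- u) = index_poly \<alpha> n y u"
proof -
  have "(\<Sum>i<n. (- u \<bullet> y i) ^ 3) = - (\<Sum>i<n. (u \<bullet> y i) ^ 3)"
    by (simp add: sum_negf)
  then show ?thesis by (simp add: index_poly_def)
qed

section \<open>Stationarity of constrained maximizers\<close>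

lemma index_grad_inner:
  "index_grad \<alpha> n y u \<bullet> d =
     3 * \<alpha> * ((\<Sum>i<n. (u \<bullet> y i) ^ 3) / real n) * ((\<Sum>i<n. (u \<bullet> y i)\<^sup>2 * (d \<bullet> y i)) / real n)
     + 4 * (1 - \<alpha>) * ((\<Sum>i<n. (u \<bullet> y i) ^ 4) / real n - 3) * ((\<Sum>i<n. (u \<bullet> y i) ^ 3 * (d \<bullet> y i)) / real n)"
proof -
  have "(\<chi> m. (\<Sum>i<n. c i * y i $ m) / real n) \<bullet> d = (\<Sum>i<n. c i * (d \<bullet> y i)) / real n" for c
  proof -
    have "(\<chi> m. (\<Sum>i<n. c i * y i $ m) / real n) \<bullet> d = (\<Sum>m\<in>UNIV. \<Sum>i<n. c i * y i $ m * d $ m) / real n"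
      by (simp add: inner_vec_def sum_distrib_right sum_divide_distrib)
    also have "\<dots> = (\<Sum>i<n. \<Sum>m\<in>UNIV. c i * y i $ m * d $ m) / real n" by (subst sum.swap) simp
    also have "\<dots> = (\<Sum>i<n. c i * (d \<bullet> y i)) / real n"
      by (simp add: inner_vec_def sum_distrib_left mult_ac)
    finally show ?thesis .
  qed
  then show ?thesis by (simp add: index_grad_def inner_add_left)
qed

text \<open>A great circle stays on the sphere when \<open>d\<close> is a unit vector orthogonal to
  \<open>u\<close>, so first-order conditions come from calculus in one variable, without Lagrange
  multipliers. The factor 2 is there because \<open>index_grad\<close> is half the gradient.\<close>

lemma index_poly_circle_deriv:
  "((\<lambda>t. index_poly \<alpha> n y (cos t *\<^sub>R u + sin t *\<^sub>R d)) has_real_derivative 2 * (index_grad \<alpha> n y u \<bullet> d)) (at 0)"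
proof -
  have pow: "((\<lambda>t. (\<Sum>i<n. ((cos t *\<^sub>R u + sin t *\<^sub>R d) \<bullet> y i) ^ m) / real n) has_real_derivative
      real m * ((\<Sum>i<n. (u \<bullet> y i) ^ (m - 1) * (d \<bullet> y i)) / real n)) (at 0)" for m
    unfolding inner_add_left inner_scaleR_left times_divide_eq_right sum_distrib_left
    by (intro DERIV_cdivide DERIV_sum) (auto intro!: derivative_eq_intros)
  have v: "(cos 0 *\<^sub>R u + sin 0 *\<^sub>R d) = u" by simp
  show ?thesis
    unfolding index_poly_def index_grad_inner
    by (rule DERIV_cong[OF DERIV_add[OF DERIV_cmult[OF DERIV_power[OF pow]]
          DERIV_cmult[OF DERIV_power[OF DERIV_diff[OF pow DERIV_const]]]]])
       (simp add: v algebra_simps add_divide_distrib diff_divide_distrib)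
qed

text \<open>Let \<open>w\<close> be the part of the gradient orthogonal to rows up to
  \<open>k\<close>. The great circle from row \<open>k\<close> towards \<open>w\<close> remains
  feasible, so maximality makes the gradient orthogonal to \<open>w\<close>. Since the gradient
  differs from \<open>w\<close> by a combination of those rows,
  \<open>w \<bullet> w = 0\<close>.\<close>

lemma index_poly_stationary:
  fixes U :: "real^('p::{finite,linorder})^('p::{finite,linorder})"
  assumes U: "orthogonal_matrix U"
    and e: "e > 0" and max: "\<And>u. u \<in> feasible_dirs U k \<Longrightarrow> dist u (U $ k) < e \<Longrightarrow>
      index_poly \<alpha> n y u \<le> index_poly \<alpha> n y (U $ k)"
  shows "index_grad \<alpha> n y (U $ k) = (\<Sum>j\<in>{..k}. (U $ j \<bullet> index_grad \<alpha> n y (U $ k)) *\<^sub>R U $ j)"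
proof -
  let ?T = "index_grad \<alpha> n y (U $ k)"
  have rows: "U $ i \<bullet> U $ j = (if i = j then 1 else 0)" for i j
    using U unfolding orthogonal_matrix_orthonormal_rows
    by (auto simp: row_def orthogonal_def vec_nth_inverse norm_eq_1)
  define w where "w = ?T - (\<Sum>j\<in>{..k}. (U $ j \<bullet> ?T) *\<^sub>R U $ j)"
  have wU: "w \<bullet> U $ j = 0" if "j \<le> k" for j
  proof -
    have "(\<Sum>i\<in>{..k}. (U $ i \<bullet> ?T) *\<^sub>R U $ i) \<bullet> U $ j = (\<Sum>i\<in>{..k}. if i = j then U $ i \<bullet> ?T else 0)"
      by (simp add: inner_sum_left rows if_distrib cong: if_cong)
    also have "\<dots> = U $ j \<bullet> ?T" using that by simp
    finally show ?thesis by (simp add: w_def inner_diff_left inner_commute[of "U $ j" ?T])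
  qed
  have "w = 0"
  proof (rule ccontr)
    assume "w \<noteq> 0"
    define d where "d = w /\<^sub>R norm w"
    have d: "norm d = 1" "\<And>j. j \<le> k \<Longrightarrow> d \<bullet> U $ j = 0"
      using \<open>w \<noteq> 0\<close> wU by (auto simp: d_def)
    define c where "c t = cos t *\<^sub>R U $ k + sin t *\<^sub>R d" for t
    have "(c t) \<bullet> (c t) = 1" for t
      using d(1) d(2)[of k] rows[of k k] sin_cos_squared_add2[of t]
      by (simp add: c_def inner_add_left inner_add_right inner_commute norm_eq_1 power2_eq_square)
    then have feas: "c t \<in> feasible_dirs U k" for t
      unfolding feasible_dirs_def
      using d(2) rows by (auto simp: norm_eq_1 c_def inner_add_left)
    have "((\<lambda>t. c t) \<longlongrightarrow> U $ k) (at 0)"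
      unfolding c_def by (rule tendsto_eq_intros refl | simp)+
    with e have "\<forall>\<^sub>F t in at 0. dist (c t) (U $ k) < e" by (rule tendstoD[rotated])
    then obtain r where r: "r > 0" "\<And>t. t \<noteq> 0 \<Longrightarrow> dist t 0 < r \<Longrightarrow> dist (c t) (U $ k) < e"
      unfolding eventually_at by blast
    have c0: "c 0 = U $ k" by (simp add: c_def)
    have "2 * (?T \<bullet> d) = 0"
    proof (rule DERIV_local_max)
      show "((\<lambda>t. index_poly \<alpha> n y (c t)) has_real_derivative 2 * (?T \<bullet> d)) (at 0)"
        unfolding c_def by (rule index_poly_circle_deriv)
      show "r > 0" by (rule r)
      show "\<forall>t. \<bar>0 - t\<bar> < r \<longrightarrow> index_poly \<alpha> n y (c t) \<le> index_poly \<alpha> n y (c 0)"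
      proof (intro allI impI)
        fix t :: real assume t: "\<bar>0 - t\<bar> < r"
        show "index_poly \<alpha> n y (c t) \<le> index_poly \<alpha> n y (c 0)"
        proof (cases "t = 0")
          case False
          with t r(2)[of t] max[OF feas[of t]] show ?thesis by (simp add: c0 dist_real_def)
        qed simp
      qed
    qed
    then have "?T \<bullet> w = 0" using \<open>w \<noteq> 0\<close> by (simp add: d_def)
    moreover have "w \<bullet> (\<Sum>j\<in>{..k}. (U $ j \<bullet> ?T) *\<^sub>R U $ j) = 0"
      using wU by (simp add: inner_sum_right)
    ultimately have "w \<bullet> w = 0"
      by (subst (asm) inner_commute) (subst (2) w_def, simp add: inner_diff_right)
    with \<open>w \<noteq> 0\<close> show False by simp
  qed
  then show ?thesis by (simp add: w_def)
qed

section \<open>Standardization of a fixed sample\<close>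

definition centered :: "nat \<Rightarrow> (nat \<Rightarrow> real^'p) \<Rightarrow> nat \<Rightarrow> real^'p" where
  "centered n \<zeta> i = \<zeta> i - mean_vec (emp n) \<zeta>"

lemma mean_vec_emp: "mean_vec (emp n) \<zeta> $ k = (\<Sum>i<n. \<zeta> i $ k) / real n"
  by (simp add: mean_vec_def emp_integral)

lemma cov_mat_emp: "cov_mat (emp n) \<zeta> $ k $ l = (\<Sum>i<n. centered n \<zeta> i $ k * centered n \<zeta> i $ l) / real n"
  by (simp add: cov_mat_def centered_def emp_integral)

lemma cov_mat_emp_mult:
  "(cov_mat (emp n) \<zeta> *v v) $ k = (\<Sum>i<n. centered n \<zeta> i $ k * (v \<bullet> centered n \<zeta> i)) / real n"
proof -
  have "(cov_mat (emp n) \<zeta> *v v) $ k = (\<Sum>l\<in>UNIV. \<Sum>i<n. centered n \<zeta> i $ k * centered n \<zeta> i $ l * v $ l) / real n"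
    by (simp add: matrix_vector_mult_def cov_mat_emp sum_distrib_right sum_divide_distrib)
  also have "\<dots> = (\<Sum>i<n. \<Sum>l\<in>UNIV. centered n \<zeta> i $ k * centered n \<zeta> i $ l * v $ l) / real n"
    by (subst sum.swap) simp
  finally show ?thesis by (simp add: inner_vec_def sum_distrib_left mult_ac)
qed

lemma cov_mat_emp_form:
  "u \<bullet> (cov_mat (emp n) \<zeta> *v v) = (\<Sum>i<n. (u \<bullet> centered n \<zeta> i) * (v \<bullet> centered n \<zeta> i)) / real n"
proof -
  have "u \<bullet> (cov_mat (emp n) \<zeta> *v v) = (\<Sum>k\<in>UNIV. \<Sum>i<n. u $ k * (centered n \<zeta> i $ k * (v \<bullet> centered n \<zeta> i))) / real n"
    by (simp add: inner_vec_def[of u] cov_mat_emp_mult sum_distrib_left sum_divide_distrib)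
  also have "\<dots> = (\<Sum>i<n. \<Sum>k\<in>UNIV. u $ k * (centered n \<zeta> i $ k * (v \<bullet> centered n \<zeta> i))) / real n"
    by (subst sum.swap) simp
  also have "\<dots> = (\<Sum>i<n. (u \<bullet> centered n \<zeta> i) * (v \<bullet> centered n \<zeta> i)) / real n"
    by (simp add: inner_vec_def[of u] sum_distrib_right mult.assoc)
  finally show ?thesis .
qed

locale standardizable =
  fixes n :: nat and \<zeta> :: "nat \<Rightarrow> real^('p::{finite,linorder})"
  assumes cov_invertible: "invertible (cov_mat (emp n) \<zeta>)"
begin

definition "C = cov_mat (emp n) \<zeta>"
definition "S = inv_sqrt_mat C"
definition "x = centered n \<zeta>"
definition "y i = S *v x i"

text \<open>For \<open>n = 0\<close> every average is a division by zero, so the covariance matrix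
  is zero and not invertible.\<close>

lemma n_pos: "n > 0"
proof (rule ccontr)
  assume "\<not> n > 0"
  then have "C *v axis k 1 = 0" for k unfolding C_def vec_eq_iff cov_mat_emp_mult by simp
  then have "axis k 1 = (0 :: real^('p::{finite,linorder}))" for k
    using cov_invertible unfolding C_def[symmetric] invertible_left_inverse matrix_left_invertible_ker by blast
  then show False by simp
qed

lemma cov_sym_pos_def: "sym_pos_def C"
  unfolding sym_pos_def_def
proof (intro conjI allI impI)
  show "transpose C = C" by (simp add: C_def transpose_def vec_eq_iff cov_mat_emp mult.commute)
  fix v :: "real^('p::{finite,linorder})" assume "v \<noteq> 0"
  have "v \<bullet> (C *v v) = (\<Sum>i<n. (v \<bullet> x i)\<^sup>2) / real n"
    by (simp add: C_def cov_mat_emp_form x_def power2_eq_square)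
  moreover have "(\<Sum>i<n. (v \<bullet> x i)\<^sup>2) \<noteq> 0"
  proof
    assume "(\<Sum>i<n. (v \<bullet> x i)\<^sup>2) = 0"
    then have "\<forall>i\<in>{..<n}. v \<bullet> x i = 0" by (subst (asm) sum_nonneg_eq_0_iff) auto
    then have "C *v v = 0" by (simp add: C_def cov_mat_emp_mult vec_eq_iff x_def[symmetric])
    then have "v = 0"
      using cov_invertible unfolding C_def[symmetric] invertible_left_inverse matrix_left_invertible_ker by blast
    with \<open>v \<noteq> 0\<close> show False by simp
  qed
  ultimately show "v \<bullet> (C *v v) > 0"
    using n_pos by (simp add: order.not_eq_order_implies_strict sum_nonneg)
qed

lemmas S = inv_sqrt_mat[OF cov_sym_pos_def, folded S_def]

lemma S_inner: "(S *v u) \<bullet> v = u \<bullet> (S *v v)"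
  using S(1) by (intro symmetric_matrix_inner) (simp add: sym_pos_def_def)

lemma inner_y: "u \<bullet> y i = (S *v u) \<bullet> x i"
  by (simp add: y_def S_inner)

lemma standardize_vec_emp: "standardize_vec (emp n) \<zeta> i = y i"
  by (simp add: standardize_vec_def y_def S_def C_def x_def centered_def)

lemma sum_x: "(\<Sum>i<n. v \<bullet> x i) = 0"
proof -
  have "(\<Sum>i<n. x i) = 0"
    unfolding vec_eq_iff sum_component x_def centered_def vector_minus_component sum_subtractf mean_vec_emp
    using n_pos by simp
  then show ?thesis by (simp flip: inner_sum_right)
qed

lemma second_moment_y: "(\<Sum>i<n. (u \<bullet> y i)\<^sup>2) / real n = (norm u)\<^sup>2"
proof -
  have "(\<Sum>i<n. (u \<bullet> y i)\<^sup>2) / real n = (S *v u) \<bullet> (C *v (S *v u))"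
    by (simp add: C_def cov_mat_emp_form x_def[symmetric] inner_y power2_eq_square)
  also have "\<dots> = u \<bullet> ((S ** (C ** S)) *v u)"
    by (simp add: S_inner matrix_vector_mul_assoc[symmetric])
  finally show ?thesis by (simp add: S(4) power2_norm_eq_inner)
qed

lemma standardize_y:
  assumes "norm u = 1"
  shows "standardize (emp n) (\<lambda>i. u \<bullet> standardize_vec (emp n) \<zeta> i) = (\<lambda>i. u \<bullet> y i)"
  using second_moment_y[of u] assms sum_x[of "S *v u"]
  by (simp add: fun_eq_iff standardize_def emp_integral standardize_vec_emp inner_y)

lemma proj_index_emp: "norm u = 1 \<Longrightarrow> proj_index \<alpha> (emp n) \<zeta> u = index_poly \<alpha> n y u"
  by (simp add: proj_index_def skewness_def excess_kurtosis_def standardize_y emp_integral index_poly_def)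

lemma estimating_vec_emp: "estimating_vec \<alpha> (emp n) \<zeta> u = index_grad \<alpha> n y u"
  by (simp add: estimating_vec_def Let_def standardize_vec_emp emp_integral index_grad_def)

text \<open>The chain rule for \<open>u \<bullet> y i = (S *v u) \<bullet> x i\<close>. It expresses
  the gradient for standardized data by the centered data and the row \<open>S *v u\<close> of the
  unmixing matrix.\<close>

lemma index_grad_transform: "index_grad \<alpha> n y u = S *v index_grad \<alpha> n x (S *v u)"
proof -
  have "index_grad \<alpha> n y u \<bullet> d = (S *v index_grad \<alpha> n x (S *v u)) \<bullet> d" for d
    by (simp add: S_inner index_grad_inner inner_y)
  then show ?thesis by (rule vector_eq_rdot[THEN iffD1, OF allI])
qed

end

lemma row_matrix_mult_symmetric:
  fixes S :: "real^'p^'p"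
  assumes "transpose S = S"
  shows "(U ** S) $ j = S *v (U $ j)"
proof -
  have s: "S $ b $ a = S $ a $ b" for a b
    using arg_cong[OF assms, of "\<lambda>A. A $ a $ b"] by (simp add: transpose_def)
  show ?thesis
    by (simp add: vec_eq_iff matrix_matrix_mult_def matrix_vector_mult_def s mult.commute)
qed

context standardizable
begin

lemma row_mult_S: "(U ** S) $ j = S *v (U $ j)"
  using S(1) by (intro row_matrix_mult_symmetric) (simp add: sym_pos_def_def)

text \<open>The estimating equations are not imposed on the choice of rows; they are the
  stationarity condition of a local maximizer, with the projector acting on the gradient.\<close>

lemma deflation_solution_emp:
  assumes U: "orthogonal_matrix U"
    and rows: "\<And>k. row_choice \<rho> (index_poly \<alpha> n y) k (feasible_dirs U k) (U $ k)"
    and rho: "\<And>k. \<rho> k < 1"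
  shows "deflation_solution \<alpha> (emp n) \<zeta> (U ** S)"
  unfolding deflation_solution_def
proof (intro exI[of _ U] conjI allI U)
  fix k
  have Uk: "U $ k \<in> feasible_dirs U k" using rows[of k] by (simp add: row_choice_def)
  show "\<exists>e>0. \<forall>u\<in>feasible_dirs U k. dist u (U $ k) < e \<longrightarrow>
      proj_index \<alpha> (emp n) \<zeta> u \<le> proj_index \<alpha> (emp n) \<zeta> (U $ k)"
    using row_choice_local_max[of \<rho>, OF rows rho] Uk by (simp add: feasible_dirs_def proj_index_emp)
next
  show "estimating_eqs \<alpha> (emp n) \<zeta> U"
    unfolding estimating_eqs_def estimating_vec_emp
  proof
    fix k
    obtain e where "e > 0" "\<forall>v\<in>feasible_dirs U k. dist v (U $ k) < e \<longrightarrow> index_poly \<alpha> n y v \<le> index_poly \<alpha> n y (U $ k)"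
      using row_choice_local_max[of \<rho>, OF rows rho] by blast
    then have eq: "index_grad \<alpha> n y (U $ k) = (\<Sum>j\<in>{..k}. (U $ j \<bullet> index_grad \<alpha> n y (U $ k)) *\<^sub>R U $ j)"
      by (intro index_poly_stationary[OF U]) auto
    have proj: "(\<Sum>j\<in>J. (\<chi> a b. U $ j $ a * U $ j $ b)) *v v = (\<Sum>j\<in>J. (U $ j \<bullet> v) *\<^sub>R U $ j)"
      if "finite J" for J v
      using that
    proof (induction J)
      case (insert j J)
      have "(\<chi> a b. U $ j $ a * U $ j $ b) *v v = (U $ j \<bullet> v) *\<^sub>R U $ j"
        by (simp add: vec_eq_iff matrix_vector_mult_def inner_vec_def sum_distrib_left mult_ac)
      with insert show ?case by (simp add: matrix_vector_mult_add_rdistrib)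
    qed simp
    show "(mat 1 - (\<Sum>j\<in>{..k}. (\<chi> a b. U $ j $ a * U $ j $ b))) *v index_grad \<alpha> n y (U $ k) = 0"
      using eq by (simp add: matrix_vector_mult_diff_rdistrib proj)
  qed
next
  show "U ** S = U ** inv_sqrt_mat (cov_mat (emp n) \<zeta>)" by (simp add: S_def C_def)
qed

lemma deflation_maximizer_emp:
  assumes U: "orthogonal_matrix U"
    and rows: "\<And>k. row_choice \<rho> (index_poly \<alpha> n y) k (feasible_dirs U k) (U $ k)"
    and rho: "\<And>k. \<rho> k = 0"
  shows "deflation_maximizer \<alpha> (emp n) \<zeta> (U ** S)"
  unfolding deflation_maximizer_def
proof (intro exI[of _ U] conjI allI ballI U)
  fix k u assume u: "u \<in> feasible_dirs U k"
  have Uk: "U $ k \<in> feasible_dirs U k" using rows[of k] by (simp add: row_choice_def)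
  show "proj_index \<alpha> (emp n) \<zeta> u \<le> proj_index \<alpha> (emp n) \<zeta> (U $ k)"
    using row_choice_global_max[of \<rho>, OF rows rho u] Uk u by (simp add: feasible_dirs_def proj_index_emp)
qed (simp add: S_def C_def)

text \<open>The estimating equations multiplied by the root of the sample covariance matrix, which
  eliminates the standardization.\<close>

lemma unmixing_equations:
  assumes U: "orthogonal_matrix U"
    and rows: "\<And>k. row_choice \<rho> (index_poly \<alpha> n y) k (feasible_dirs U k) (U $ k)"
    and rho: "\<And>k. \<rho> k < 1"
  shows "index_grad \<alpha> n x ((U ** S) $ k) =
     (\<Sum>j\<in>{..k}. ((U ** S) $ j \<bullet> index_grad \<alpha> n x ((U ** S) $ k)) *\<^sub>R (C *v (U ** S) $ j))"
proof -
  let ?t = "index_grad \<alpha> n x ((U ** S) $ k)"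
  obtain e where "e > 0" "\<forall>v\<in>feasible_dirs U k. dist v (U $ k) < e \<longrightarrow> index_poly \<alpha> n y v \<le> index_poly \<alpha> n y (U $ k)"
    using row_choice_local_max[of \<rho>, OF rows rho] by blast
  then have "index_grad \<alpha> n y (U $ k) = (\<Sum>j\<in>{..k}. (U $ j \<bullet> index_grad \<alpha> n y (U $ k)) *\<^sub>R U $ j)"
    by (intro index_poly_stationary[OF U]) auto
  then have eq: "S *v ?t = (\<Sum>j\<in>{..k}. ((U ** S) $ j \<bullet> ?t) *\<^sub>R U $ j)"
    by (simp add: index_grad_transform row_mult_S S_inner)
  have "?t = (C ** S) *v (S *v ?t)"
    using S(3) by (simp add: matrix_vector_mul_assoc matrix_mul_assoc)
  also have "\<dots> = (C ** S) *v (\<Sum>j\<in>{..k}. ((U ** S) $ j \<bullet> ?t) *\<^sub>R U $ j)" by (simp only: eq)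
  also have "\<dots> = (\<Sum>j\<in>{..k}. ((U ** S) $ j \<bullet> ?t) *\<^sub>R ((C ** S) *v U $ j))"
    by (simp add: linear_sum[OF matrix_vector_mul_linear] matrix_vector_mult_scaleR)
  finally show ?thesis by (simp add: row_mult_S matrix_vector_mul_assoc)
qed

lemma unmixing_orthonormal:
  assumes U: "orthogonal_matrix U"
  shows "(U ** S) $ k \<bullet> (C *v (U ** S) $ l) = (if k = l then 1 else 0)"
proof -
  have "(U ** S) $ k \<bullet> (C *v (U ** S) $ l) = U $ k \<bullet> ((S ** (C ** S)) *v U $ l)"
    by (simp add: row_mult_S S_inner matrix_vector_mul_assoc[symmetric])
  also have "\<dots> = U $ k \<bullet> U $ l" by (simp add: S(4))
  also have "\<dots> = (if k = l then 1 else 0)"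
    using U unfolding orthogonal_matrix_orthonormal_rows
    by (auto simp: row_def orthogonal_def norm_eq_1)
  finally show ?thesis .
qed

end

text \<open>Total and measurable in the data: the identity is an arbitrary value where the
  covariance matrix is singular, and elsewhere this is \<open>inv_sqrt_mat\<close> of that
  matrix.\<close>

definition sample_root :: "nat \<Rightarrow> (nat \<Rightarrow> real^'p) \<Rightarrow> real^'p^'p" where
  "sample_root n \<zeta> = (if det (cov_mat (emp n) \<zeta>) = 0 then mat 1 else root_mat (cramer_inv (cov_mat (emp n) \<zeta>)))"

definition sample_std :: "nat \<Rightarrow> (nat \<Rightarrow> real^'p) \<Rightarrow> nat \<Rightarrow> real^'p" where
  "sample_std n \<zeta> i = sample_root n \<zeta> *v centered n \<zeta> i"

lemma (in standardizable) sample_root_eq: "sample_root n \<zeta> = S"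
  using cov_invertible
  by (simp add: sample_root_def S_def inv_sqrt_mat_eq_root[OF cov_sym_pos_def] C_def[symmetric] invertible_det_nz)

lemma (in standardizable) sample_std_eq: "sample_std n \<zeta> = y"
  by (simp add: fun_eq_iff sample_std_def y_def x_def sample_root_eq)

section \<open>Measurability of the sample quantities\<close>

lemma borel_measurable_centered:
  assumes [measurable]: "\<And>i. Z i \<in> borel_measurable M"
  shows "(\<lambda>\<omega>. centered n (\<lambda>i. Z i \<omega>) i) \<in> borel_measurable M"
  by (rule borel_measurable_vecI) (simp add: centered_def mean_vec_emp)

lemma borel_measurable_cov_mat:
  assumes [measurable]: "\<And>i. Z i \<in> borel_measurable M"
  shows "(\<lambda>\<omega>. cov_mat (emp n) (\<lambda>i. Z i \<omega>)) \<in> borel_measurable M"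
proof (intro borel_measurable_vecI)
  fix k l
  note [measurable] = borel_measurable_centered
  show "(\<lambda>\<omega>. cov_mat (emp n) (\<lambda>i. Z i \<omega>) $ k $ l) \<in> borel_measurable M"
    unfolding cov_mat_emp by measurable
qed

lemma borel_measurable_sample_root:
  assumes "\<And>i. Z i \<in> borel_measurable M"
  shows "(\<lambda>\<omega>. sample_root n (\<lambda>i. Z i \<omega>)) \<in> borel_measurable M"
proof -
  note [measurable] = borel_measurable_cov_mat[OF assms] borel_measurable_det[OF borel_measurable_cov_mat[OF assms]]
    borel_measurable_root_mat[OF borel_measurable_cramer_inv[OF borel_measurable_cov_mat[OF assms]]]
  show ?thesis unfolding sample_root_def by measurable
qed

lemma caratheodory_index_poly:
  assumes "\<And>i. Z i \<in> borel_measurable M"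
  shows "caratheodory M K (\<lambda>\<omega>. index_poly \<alpha> n (sample_std n (\<lambda>i. Z i \<omega>)))"
proof -
  have [measurable]: "(\<lambda>\<omega>. sample_std n (\<lambda>i. Z i \<omega>) i) \<in> borel_measurable M" for i
    unfolding sample_std_def
    by (intro borel_measurable_matrix_vector_mult borel_measurable_sample_root borel_measurable_centered assms)
  show ?thesis unfolding caratheodory_def
  proof (intro conjI ballI)
    show "(\<lambda>\<omega>. index_poly \<alpha> n (sample_std n (\<lambda>i. Z i \<omega>)) u) \<in> borel_measurable M" for u
      unfolding index_poly_def by measurable
    show "continuous_on K (index_poly \<alpha> n (sample_std n (\<lambda>i. Z i \<omega>)))" for \<omega>
      \<comment> \<open>For \<open>n = 0\<close> the quotients are constantly zero; the continuity
        rule for division covers only the other case.\<close>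
      unfolding index_poly_def by (cases "n = 0") (auto intro!: continuous_intros)
  qed
qed

section \<open>Limits of the sample moments\<close>

lemma sum_centered2:
  fixes f g :: "nat \<Rightarrow> real"
  assumes n: "n > 0" and "a = (\<Sum>i<n. f i) / real n" "b = (\<Sum>i<n. g i) / real n"
  shows "(\<Sum>i<n. (f i - a) * (g i - b)) / real n = (\<Sum>i<n. f i * g i) / real n - a * b"
proof -
  have s: "(\<Sum>i<n. f i) = n * a" "(\<Sum>i<n. g i) = n * b" using assms by auto
  have "(\<Sum>i<n. (f i - a) * (g i - b)) = (\<Sum>i<n. f i * g i - a * g i - b * f i + a * b)"
    by (intro sum.cong refl) (simp add: algebra_simps)
  also have "\<dots> = (\<Sum>i<n. f i * g i) - n * a * b"
    by (simp add: sum.distrib sum_subtractf sum_distrib_left[symmetric] s)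
  finally show ?thesis using n by (simp add: field_simps)
qed

lemma sum_centered3:
  fixes f g h :: "nat \<Rightarrow> real"
  assumes n: "n > 0" and "a = (\<Sum>i<n. f i) / real n" "b = (\<Sum>i<n. g i) / real n" "c = (\<Sum>i<n. h i) / real n"
  shows "(\<Sum>i<n. (f i - a) * ((g i - b) * (h i - c))) / real n =
    (\<Sum>i<n. f i * (g i * h i)) / real n - a * ((\<Sum>i<n. g i * h i) / real n) - b * ((\<Sum>i<n. f i * h i) / real n)
    - c * ((\<Sum>i<n. f i * g i) / real n) + 2 * a * b * c"
proof -
  have s: "(\<Sum>i<n. f i) = n * a" "(\<Sum>i<n. g i) = n * b" "(\<Sum>i<n. h i) = n * c" using assms by auto
  have "(\<Sum>i<n. (f i - a) * ((g i - b) * (h i - c))) =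
      (\<Sum>i<n. f i * (g i * h i) - a * (g i * h i) - b * (f i * h i) - c * (f i * g i)
        + a * b * h i + a * c * g i + b * c * f i - a * b * c)"
    by (intro sum.cong refl) (simp add: algebra_simps)
  also have "\<dots> = (\<Sum>i<n. f i * (g i * h i)) - a * (\<Sum>i<n. g i * h i) - b * (\<Sum>i<n. f i * h i)
      - c * (\<Sum>i<n. f i * g i) + 2 * n * a * b * c"
    by (simp add: sum.distrib sum_subtractf sum_distrib_left[symmetric] s)
  finally show ?thesis using n by (simp add: diff_divide_distrib add_divide_distrib)
qed

text \<open>In the last coefficient, the four terms with three means contribute -4 and the product
  of all four means contributes 1. For three factors the same count gives 3 - 1 = 2.\<close>

lemma sum_centered4:
  fixes f g h k :: "nat \<Rightarrow> real"
  assumes n: "n > 0" and "a = (\<Sum>i<n. f i) / real n" "b = (\<Sum>i<n. g i) / real n" "c = (\<Sum>i<n. h i) / real n"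
    "d = (\<Sum>i<n. k i) / real n"
  shows "(\<Sum>i<n. (f i - a) * ((g i - b) * ((h i - c) * (k i - d)))) / real n =
    (\<Sum>i<n. f i * (g i * (h i * k i))) / real n
    - a * ((\<Sum>i<n. g i * (h i * k i)) / real n) - b * ((\<Sum>i<n. f i * (h i * k i)) / real n)
    - c * ((\<Sum>i<n. f i * (g i * k i)) / real n) - d * ((\<Sum>i<n. f i * (g i * h i)) / real n)
    + a * b * ((\<Sum>i<n. h i * k i) / real n) + a * c * ((\<Sum>i<n. g i * k i) / real n)
    + a * d * ((\<Sum>i<n. g i * h i) / real n) + b * c * ((\<Sum>i<n. f i * k i) / real n)
    + b * d * ((\<Sum>i<n. f i * h i) / real n) + c * d * ((\<Sum>i<n. f i * g i) / real n)
    - 3 * a * b * c * d"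
proof -
  have s: "(\<Sum>i<n. f i) = n * a" "(\<Sum>i<n. g i) = n * b" "(\<Sum>i<n. h i) = n * c" "(\<Sum>i<n. k i) = n * d"
    using assms by auto
  have "(\<Sum>i<n. (f i - a) * ((g i - b) * ((h i - c) * (k i - d)))) =
      (\<Sum>i<n. f i * (g i * (h i * k i)) - a * (g i * (h i * k i)) - b * (f i * (h i * k i))
        - c * (f i * (g i * k i)) - d * (f i * (g i * h i))
        + a * b * (h i * k i) + a * c * (g i * k i) + a * d * (g i * h i)
        + b * c * (f i * k i) + b * d * (f i * h i) + c * d * (f i * g i)
        - b * c * d * f i - a * c * d * g i - a * b * d * h i - a * b * c * k i + a * b * c * d)"
    by (intro sum.cong refl) (simp add: algebra_simps)
  also have "\<dots> = (\<Sum>i<n. f i * (g i * (h i * k i)))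
    - a * (\<Sum>i<n. g i * (h i * k i)) - b * (\<Sum>i<n. f i * (h i * k i))
    - c * (\<Sum>i<n. f i * (g i * k i)) - d * (\<Sum>i<n. f i * (g i * h i))
    + a * b * (\<Sum>i<n. h i * k i) + a * c * (\<Sum>i<n. g i * k i) + a * d * (\<Sum>i<n. g i * h i)
    + b * c * (\<Sum>i<n. f i * k i) + b * d * (\<Sum>i<n. f i * h i) + c * d * (\<Sum>i<n. f i * g i)
    - 3 * n * a * b * c * d"
    by (simp add: sum.distrib sum_subtractf sum_distrib_left[symmetric] s)
  finally show ?thesis using n by (simp add: diff_divide_distrib add_divide_distrib)
qed

text \<open>The parameter \<open>deg\<close> is the largest degree of averages that are controlled:
  three when only skewness has weight, at least four otherwise. One development thus serves every
  weight and each moment assumption.\<close>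

locale ica_sample = iid_sample N M z Z
  for N :: "'v measure" and M :: "'w measure" and z :: "'v \<Rightarrow> real^('p::{finite,linorder})" and Z +
  fixes \<alpha> :: real and deg :: nat
  assumes mean0: "(LINT v|N. z v $ k) = 0" and var1: "(LINT v|N. (z v $ k)\<^sup>2) = 1"
    and deg3: "3 \<le> deg" and deg_moments: "integrable N (\<lambda>v. (z v $ k) ^ (2 * deg))"
    and deg4: "\<alpha> \<noteq> 1 \<Longrightarrow> 4 \<le> deg"
    and alpha: "0 \<le> \<alpha>" "\<alpha> \<le> 1"
begin

definition mom :: "'p \<Rightarrow> nat \<Rightarrow> real" where "mom k m = (LINT v|N. (z v $ k) ^ m)"

lemma mom_simps: "mom k 0 = 1" "mom k (Suc 0) = 0" "mom k 2 = 1" "mom k (Suc (Suc 0)) = 1"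
  using mean0 var1 by (simp_all add: mom_def N.prob_space numeral_2_eq_2)

abbreviation "\<gamma> k \<equiv> mom k 3"
abbreviation "\<beta> k \<equiv> mom k 4"
abbreviation "\<kappa> k \<equiv> mom k 4 - 3"
abbreviation "F \<equiv> whp M"

text \<open>The mixed fourth moment of independent standardized components: the three Gaussian
  pairings, corrected on the diagonal by the fourth cumulant.\<close>

abbreviation m4 :: "'p \<Rightarrow> 'p \<Rightarrow> 'p \<Rightarrow> 'p \<Rightarrow> real" where
  "m4 a b c d \<equiv> (if a = b \<and> b = c \<and> c = d then \<kappa> a else 0)
    + (if a = b \<and> c = d then 1 else 0) + (if a = c \<and> b = d then 1 else 0) + (if a = d \<and> b = c then 1 else 0)"

definition am :: "'p list \<Rightarrow> nat \<times> 'w \<Rightarrow> real" where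
  "am xs x = avg (fst x) (monom_vec xs) (snd x)"

definition X :: "nat \<times> 'w \<Rightarrow> nat \<Rightarrow> real^('p::{finite,linorder})" where
  "X x = centered (fst x) (\<lambda>i. Z i (snd x))"

text \<open>Central averages are what the estimator sees, raw averages \<open>am\<close> are sums of
  independent terms. The two differ by products containing some \<open>am [a]\<close>, which tends
  to 0, so their limits agree.\<close>

definition cm :: "'p list \<Rightarrow> nat \<times> 'w \<Rightarrow> real" where
  "cm xs x = (\<Sum>i<fst x. monom_vec xs (X x i)) / real (fst x)"

section \<open>Limits of raw and central sample moments\<close>

lemma monomial_expectation:
  assumes "length xs \<le> 2 * deg"
  shows "(LINT v|N. monom_vec xs (z v)) = (\<Prod>k\<in>set xs. mom k (count_list xs k))"
proof -
  have "(LINT v|N. monom_vec xs (z v)) = (\<Prod>k\<in>UNIV. mom k (count_list xs k))"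
    unfolding mom_def by (rule monomial_moment(2)[OF deg_moments assms])
  also have "\<dots> = (\<Prod>k\<in>set xs. mom k (count_list xs k))"
    by (rule prod.mono_neutral_right) (auto simp: count_list_0_iff mom_simps)
  finally show ?thesis .
qed

lemma am_tendsto:
  assumes "length xs \<le> deg"
  shows "(am xs \<longlongrightarrow> (\<Prod>k\<in>set xs. mom k (count_list xs k))) F"
  unfolding am_def[abs_def] monomial_expectation[symmetric, OF order_trans[OF assms le_add2[of deg deg, folded mult_2]]]
  by (intro avg_LLN monomial_square_integrable[OF deg_moments] assms) measurable

lemma am1: "(am [a] \<longlongrightarrow> 0) F"
  using am_tendsto[of "[a]"] deg3 by (simp add: mom_simps)

lemma am2: "(am [a, b] \<longlongrightarrow> (if a = b then 1 else 0)) F"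
  using am_tendsto[of "[a, b]"] deg3 by (cases "a = b") (simp_all add: mom_simps)

lemma am3: "(am [a, b, c] \<longlongrightarrow> (if a = b \<and> b = c then \<gamma> a else 0)) F"
  using am_tendsto[of "[a, b, c]"] deg3
  by (cases "a = b"; cases "b = c"; cases "a = c") (simp_all add: mom_simps eval_nat_numeral prod.insert_if)

lemma am4:
  assumes "\<alpha> \<noteq> 1"
  shows "(am [a, b, c, d] \<longlongrightarrow> m4 a b c d) F"
  using am_tendsto[of "[a, b, c, d]"] deg4[OF assms]
  by (cases "a = b"; cases "b = c"; cases "a = c"; cases "a = d"; cases "b = d"; cases "c = d")
     (simp_all add: mom_simps eval_nat_numeral prod.insert_if)

lemma X_nth: "X x i $ a = Z i (snd x) $ a - am [a] x"
  by (simp add: X_def centered_def mean_vec_emp am_def avg_def)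

lemma am_list: "am xs x = (\<Sum>i<fst x. monom_vec xs (Z i (snd x))) / real (fst x)"
  by (simp add: am_def avg_def)

lemma cm2_eq: "fst x > 0 \<Longrightarrow> cm [a, b] x = am [a, b] x - am [a] x * am [b] x"
  unfolding cm_def monom_vec_simps X_nth mult_1_right am_list by (rule sum_centered2) simp_all

lemma cm3_eq: "fst x > 0 \<Longrightarrow> cm [a, b, c] x = am [a, b, c] x - am [a] x * am [b, c] x - am [b] x * am [a, c] x
    - am [c] x * am [a, b] x + 2 * am [a] x * am [b] x * am [c] x"
  unfolding cm_def monom_vec_simps X_nth mult_1_right am_list by (rule sum_centered3) simp_all

lemma cm4_eq: "fst x > 0 \<Longrightarrow> cm [a, b, c, d] x = am [a, b, c, d] x
    - am [a] x * am [b, c, d] x - am [b] x * am [a, c, d] x - am [c] x * am [a, b, d] x - am [d] x * am [a, b, c] x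
    + am [a] x * am [b] x * am [c, d] x + am [a] x * am [c] x * am [b, d] x + am [a] x * am [d] x * am [b, c] x
    + am [b] x * am [c] x * am [a, d] x + am [b] x * am [d] x * am [a, c] x + am [c] x * am [d] x * am [a, b] x
    - 3 * am [a] x * am [b] x * am [c] x * am [d] x"
  unfolding cm_def monom_vec_simps X_nth mult_1_right am_list by (rule sum_centered4) simp_all

lemma cm_tendstoI:
  assumes "((\<lambda>x. g x) \<longlongrightarrow> c) F" "\<And>x. fst x > 0 \<Longrightarrow> f x = g x"
  shows "(f \<longlongrightarrow> c) F"
  using assms(1) by (rule Lim_transform_eventually) (use whp_pos assms(2) in \<open>auto elim!: eventually_mono\<close>)

lemma cm2: "(cm [a, b] \<longlongrightarrow> (if a = b then 1 else 0)) F"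
  by (rule cm_tendstoI[OF _ cm2_eq]) (rule tendsto_eq_intros am1 am2 refl | simp)+

lemma cm3: "(cm [a, b, c] \<longlongrightarrow> (if a = b \<and> b = c then \<gamma> a else 0)) F"
  by (rule cm_tendstoI[OF _ cm3_eq]) (rule tendsto_eq_intros am1 am2 am3 refl | simp)+

lemma cm4:
  assumes "\<alpha> \<noteq> 1"
  shows "(cm [a, b, c, d] \<longlongrightarrow> m4 a b c d) F"
  by (rule cm_tendstoI[OF _ cm4_eq]) (rule tendsto_eq_intros am1 am2 am3 am4[OF assms] refl | simp)+

definition C :: "nat \<times> 'w \<Rightarrow> real^('p::{finite,linorder})^('p::{finite,linorder})" where
  "C x = cov_mat (emp (fst x)) (\<lambda>i. Z i (snd x))"

lemma C_nth: "C x $ k $ l = cm [k, l] x"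
  by (simp add: C_def cov_mat_emp cm_def X_def)

lemma C_tendsto: "(C \<longlongrightarrow> mat 1) F"
  by (intro vec_tendstoI) (simp add: C_nth mat_def cm2)

lemma eventually_standardizable: "\<forall>\<^sub>F x in F. standardizable (fst x) (\<lambda>i. Z i (snd x))"
proof -
  have "((\<lambda>x. det (C x)) \<longlongrightarrow> 1) F" using tendsto_det[OF C_tendsto] by simp
  then have "\<forall>\<^sub>F x in F. det (C x) > 0" by (rule order_tendstoD) simp
  then show ?thesis
    by eventually_elim (simp add: standardizable_def invertible_det_nz C_def)
qed

definition S :: "nat \<times> 'w \<Rightarrow> real^('p::{finite,linorder})^('p::{finite,linorder})" where
  "S x = sample_root (fst x) (\<lambda>i. Z i (snd x))"

lemma S_tendsto: "(S \<longlongrightarrow> mat 1) F"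
proof -
  have "\<forall>\<^sub>F x in F. sym_pos_def (C x)"
    using eventually_standardizable
    by eventually_elim (metis C_def standardizable.C_def standardizable.cov_sym_pos_def)
  then have "((\<lambda>x. inv_sqrt_mat (C x)) \<longlongrightarrow> mat 1) F" by (rule tendsto_inv_sqrt_mat[OF C_tendsto])
  then show ?thesis
    by (rule Lim_transform_eventually)
       (use eventually_standardizable in \<open>auto elim!: eventually_mono simp: S_def C_def
          standardizable.sample_root_eq standardizable.S_def standardizable.C_def\<close>)
qed

end

section \<open>Consistency\<close>

context ica_sample
begin

section \<open>Sample moments as multilinear forms in the directions\<close>

lemma avg_inner_linear:
  "(\<Sum>i<fst x. (p \<bullet> X x i) * g i) / real (fst x) = (\<Sum>a\<in>UNIV. p $ a * ((\<Sum>i<fst x. X x i $ a * g i) / real (fst x)))"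
proof -
  have "(\<Sum>i<fst x. (p \<bullet> X x i) * g i) = (\<Sum>i<fst x. \<Sum>a\<in>UNIV. p $ a * (X x i $ a * g i))"
    by (simp add: inner_vec_def sum_distrib_right mult.assoc)
  also have "\<dots> = (\<Sum>a\<in>UNIV. p $ a * (\<Sum>i<fst x. X x i $ a * g i))"
    by (subst sum.swap) (simp add: sum_distrib_left)
  finally show ?thesis by (simp only: sum_divide_distrib[where A=UNIV] times_divide_eq_right)
qed

lemma avg_inner3:
  "(\<Sum>i<fst x. (p \<bullet> X x i) * ((q \<bullet> X x i) * (r \<bullet> X x i))) / real (fst x) =
    (\<Sum>a\<in>UNIV. p $ a * (\<Sum>b\<in>UNIV. q $ b * (\<Sum>c\<in>UNIV. r $ c * cm [a, b, c] x)))"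
proof -
  have 1: "(\<Sum>i<fst x. X x i $ a * (X x i $ b * (r \<bullet> X x i))) / real (fst x) = (\<Sum>c\<in>UNIV. r $ c * cm [a, b, c] x)" for a b
    using avg_inner_linear[where x=x and p=r and g="\<lambda>i. X x i $ a * X x i $ b"] by (simp add: cm_def mult_ac)
  have 2: "(\<Sum>i<fst x. X x i $ a * ((q \<bullet> X x i) * (r \<bullet> X x i))) / real (fst x) =
      (\<Sum>b\<in>UNIV. q $ b * (\<Sum>c\<in>UNIV. r $ c * cm [a, b, c] x))" for a
    using avg_inner_linear[where x=x and p=q and g="\<lambda>i. X x i $ a * (r \<bullet> X x i)"] unfolding 1[symmetric]
    by (simp add: mult_ac)
  show ?thesis unfolding 2[symmetric] by (rule avg_inner_linear)
qed

lemma avg_inner4: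
  "(\<Sum>i<fst x. (p \<bullet> X x i) * ((q \<bullet> X x i) * ((r \<bullet> X x i) * (s \<bullet> X x i)))) / real (fst x) =
    (\<Sum>a\<in>UNIV. p $ a * (\<Sum>b\<in>UNIV. q $ b * (\<Sum>c\<in>UNIV. r $ c * (\<Sum>d\<in>UNIV. s $ d * cm [a, b, c, d] x))))"
proof -
  have 0: "(\<Sum>i<fst x. X x i $ a * (X x i $ b * (X x i $ c * (s \<bullet> X x i)))) / real (fst x) = (\<Sum>d\<in>UNIV. s $ d * cm [a, b, c, d] x)" for a b c
    using avg_inner_linear[where x=x and p=s and g="\<lambda>i. X x i $ a * (X x i $ b * X x i $ c)"] by (simp add: cm_def mult_ac)
  have 1: "(\<Sum>i<fst x. X x i $ a * (X x i $ b * ((r \<bullet> X x i) * (s \<bullet> X x i)))) / real (fst x) =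
      (\<Sum>c\<in>UNIV. r $ c * (\<Sum>d\<in>UNIV. s $ d * cm [a, b, c, d] x))" for a b
    using avg_inner_linear[where x=x and p=r and g="\<lambda>i. X x i $ a * (X x i $ b * (s \<bullet> X x i))"] unfolding 0[symmetric]
    by (simp add: mult_ac)
  have 2: "(\<Sum>i<fst x. X x i $ a * ((q \<bullet> X x i) * ((r \<bullet> X x i) * (s \<bullet> X x i)))) / real (fst x) =
      (\<Sum>b\<in>UNIV. q $ b * (\<Sum>c\<in>UNIV. r $ c * (\<Sum>d\<in>UNIV. s $ d * cm [a, b, c, d] x)))" for a
    using avg_inner_linear[where x=x and p=q and g="\<lambda>i. X x i $ a * ((r \<bullet> X x i) * (s \<bullet> X x i))"] unfolding 1[symmetric]
    by (simp add: mult_ac)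
  show ?thesis unfolding 2[symmetric] by (rule avg_inner_linear)
qed

section \<open>Uniform convergence of the index on the sphere\<close>

abbreviation "Y x \<equiv> sample_std (fst x) (\<lambda>i. Z i (snd x))"

text \<open>Continuity of the limit is carried along because it makes the limit bounded on the
  compact sphere, as products of uniform limits require.\<close>

definition ulim :: "(nat \<times> 'w \<Rightarrow> real^('p::{finite,linorder}) \<Rightarrow> real) \<Rightarrow> (real^('p::{finite,linorder}) \<Rightarrow> real) \<Rightarrow> bool" where
  "ulim f l \<longleftrightarrow> uniform_limit (sphere 0 1) f l F \<and> continuous_on (sphere 0 1) l"

lemma ulim_tendsto: "(c \<longlongrightarrow> c0) F \<Longrightarrow> ulim (\<lambda>x u. c x) (\<lambda>u. c0)"
  unfolding ulim_def uniform_limit_iff by (auto dest: tendstoD)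

lemma ulim_fixed: "continuous_on (sphere 0 1) l \<Longrightarrow> ulim (\<lambda>x. l) l"
  unfolding ulim_def by (simp add: uniform_limit_iff)

lemma ulim_cong:
  assumes "ulim f l" "\<And>u. u \<in> sphere 0 1 \<Longrightarrow> l u = m u"
  shows "ulim f m"
  using assms(1) unfolding ulim_def
  using uniform_limit_cong'[of "sphere 0 1" f f l m F] continuous_on_cong[OF refl, of "sphere 0 1" l m] assms(2)
  by auto

lemma ulim_add: "ulim f l \<Longrightarrow> ulim g m \<Longrightarrow> ulim (\<lambda>x u. f x u + g x u) (\<lambda>u. l u + m u)"
  unfolding ulim_def by (auto intro!: uniform_limit_add continuous_intros)

lemma ulim_mult:
  assumes "ulim f l" "ulim g m"
  shows "ulim (\<lambda>x u. f x u * g x u) (\<lambda>u. l u * m u)"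
proof -
  have "bounded (l ` sphere 0 1)" "bounded (m ` sphere 0 1)"
    using assms by (auto simp: ulim_def intro!: compact_imp_bounded compact_continuous_image)
  then show ?thesis using assms unfolding ulim_def
    by (auto intro!: uniform_lim_mult continuous_intros)
qed

lemma ulim_sum: "(\<And>a. a \<in> A \<Longrightarrow> ulim (f a) (l a)) \<Longrightarrow> ulim (\<lambda>x u. \<Sum>a\<in>A. f a x u) (\<lambda>u. \<Sum>a\<in>A. l a u)"
  by (induction A rule: infinite_finite_induct) (auto intro: ulim_add ulim_fixed)

lemma ulim_power: "ulim f l \<Longrightarrow> ulim (\<lambda>x u. f x u ^ m) (\<lambda>u. l u ^ m)"
  by (induction m) (auto intro: ulim_mult ulim_fixed)

text \<open>The population index on unit vectors: cumulants of a sum of independent terms add up,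
  and those of \<open>u \<bullet> z\<close> of orders three and four are these two sums.\<close>

definition pop_index :: "real^('p::{finite,linorder}) \<Rightarrow> real" where
  "pop_index u = \<alpha> * (\<Sum>a\<in>UNIV. u $ a ^ 3 * \<gamma> a)\<^sup>2 + (1 - \<alpha>) * (\<Sum>a\<in>UNIV. u $ a ^ 4 * \<kappa> a)\<^sup>2"

definition sample_index :: "nat \<times> 'w \<Rightarrow> real^('p::{finite,linorder}) \<Rightarrow> real" where
  "sample_index x = index_poly \<alpha> (fst x) (Y x)"

text \<open>The row-vector product transfers the root from the data to the direction without appeal
  to its symmetry.\<close>

lemma ulim_root: "ulim (\<lambda>x u. (u v* S x) $ a) (\<lambda>u. u $ a)"
proof -
  have "ulim (\<lambda>x u. \<Sum>b\<in>UNIV. S x $ b $ a * u $ b) (\<lambda>u. \<Sum>b\<in>UNIV. mat 1 $ b $ a * u $ b)"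
    by (intro ulim_sum ulim_mult ulim_tendsto ulim_fixed tendsto_vec_nth S_tendsto continuous_intros)
  then show ?thesis
    by (simp add: vector_matrix_mult_def mat_def mult.commute[of "S _ $ _ $ _"] if_distrib[of "\<lambda>t. t * _"] cong: if_cong)
qed

lemma inner_sample_std: "u \<bullet> Y x i = (u v* S x) \<bullet> X x i"
  by (simp add: sample_std_def S_def X_def dot_lmul_matrix)

text \<open>The index is a polynomial in the direction, the entries of the root and finitely many
  central moments. Uniformity over the sphere therefore follows from convergence of these
  coefficients.\<close>

lemma sample_index_uniform: "ulim sample_index pop_index"
proof -
  have 3: "ulim (\<lambda>x u. (\<Sum>i<fst x. (u \<bullet> Y x i) ^ 3) / real (fst x)) (\<lambda>u. \<Sum>a\<in>UNIV. u $ a ^ 3 * \<gamma> a)"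
  proof -
    have "ulim (\<lambda>x u. \<Sum>a\<in>UNIV. (u v* S x) $ a * (\<Sum>b\<in>UNIV. (u v* S x) $ b * (\<Sum>c\<in>UNIV. (u v* S x) $ c * cm [a, b, c] x)))
      (\<lambda>u. \<Sum>a\<in>UNIV. u $ a * (\<Sum>b\<in>UNIV. u $ b * (\<Sum>c\<in>UNIV. u $ c * (if a = b \<and> b = c then \<gamma> a else 0))))"
      by (intro ulim_sum ulim_mult ulim_root ulim_tendsto cm3)
    also have "(\<lambda>u. \<Sum>a\<in>UNIV. u $ a * (\<Sum>b\<in>UNIV. u $ b * (\<Sum>c\<in>UNIV. u $ c * (if a = b \<and> b = c then \<gamma> a else 0))))
        = (\<lambda>u. \<Sum>a\<in>UNIV. u $ a ^ 3 * \<gamma> a)"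
    proof
      fix u :: "real^('p::{finite,linorder})"
      have "(\<Sum>b\<in>UNIV. u $ b * (\<Sum>c\<in>UNIV. u $ c * (if a = b \<and> b = c then \<gamma> a else 0))) =
          (\<Sum>b\<in>UNIV. if a = b then u $ b * (u $ b * \<gamma> a) else 0)" for a
        by (intro sum.cong refl) (auto simp: if_distrib[of "\<lambda>t. _ * t"] cong: if_cong)
      then show "(\<Sum>a\<in>UNIV. u $ a * (\<Sum>b\<in>UNIV. u $ b * (\<Sum>c\<in>UNIV. u $ c * (if a = b \<and> b = c then \<gamma> a else 0)))) =
          (\<Sum>a\<in>UNIV. u $ a ^ 3 * \<gamma> a)"
        by (simp add: power3_eq_cube mult.assoc)
    qed
    finally show ?thesis
      by (simp add: inner_sample_std avg_inner3[symmetric] power3_eq_cube mult.assoc)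
  qed
  show ?thesis
  \<comment> \<open>Limits of the quartic averages are available only for a weight other than 1. At
    weight 1 they carry the factor 0 and disappear from the index.\<close>
  proof (cases "\<alpha> = 1")
    case True
    have "ulim (\<lambda>x u. ((\<Sum>i<fst x. (u \<bullet> Y x i) ^ 3) / real (fst x))\<^sup>2)
        (\<lambda>u. (\<Sum>a\<in>UNIV. u $ a ^ 3 * \<gamma> a)\<^sup>2)"
      by (intro ulim_power 3)
    moreover have "sample_index = (\<lambda>x u. ((\<Sum>i<fst x. (u \<bullet> Y x i) ^ 3) / real (fst x))\<^sup>2)"
      unfolding sample_index_def[abs_def] index_poly_def[abs_def] by (simp add: True)
    moreover have "pop_index = (\<lambda>u. (\<Sum>a\<in>UNIV. u $ a ^ 3 * \<gamma> a)\<^sup>2)"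
      unfolding pop_index_def[abs_def] by (simp add: True)
    ultimately show ?thesis by simp
  next
    case False
    let ?w = "\<lambda>x u. u v* S x"
    have "ulim (\<lambda>x u. (\<Sum>a\<in>UNIV. ?w x u $ a * (\<Sum>b\<in>UNIV. ?w x u $ b * (\<Sum>c\<in>UNIV. ?w x u $ c * (\<Sum>d\<in>UNIV. ?w x u $ d * cm [a, b, c, d] x)))) + - 3)
      (\<lambda>u. (\<Sum>a\<in>UNIV. u $ a * (\<Sum>b\<in>UNIV. u $ b * (\<Sum>c\<in>UNIV. u $ c * (\<Sum>d\<in>UNIV. u $ d *
        (m4 a b c d))))) + - 3)"
      by (intro ulim_add ulim_sum ulim_mult ulim_root ulim_tendsto cm4 False tendsto_const)
    also have "(\<lambda>x u. (\<Sum>a\<in>UNIV. ?w x u $ a * (\<Sum>b\<in>UNIV. ?w x u $ b * (\<Sum>c\<in>UNIV. ?w x u $ c * (\<Sum>d\<in>UNIV. ?w x u $ d * cm [a, b, c, d] x)))) + - 3)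
       = (\<lambda>x u. (\<Sum>i<fst x. (u \<bullet> Y x i) ^ 4) / real (fst x) - 3)"
      by (simp add: inner_sample_std avg_inner4[symmetric] eval_nat_numeral mult.assoc)
    finally have "ulim (\<lambda>x u. (\<Sum>i<fst x. (u \<bullet> Y x i) ^ 4) / real (fst x) - 3)
      (\<lambda>u. (\<Sum>a\<in>UNIV. u $ a * (\<Sum>b\<in>UNIV. u $ b * (\<Sum>c\<in>UNIV. u $ c * (\<Sum>d\<in>UNIV. u $ d *
        (m4 a b c d))))) + - 3)" .
    \<comment> \<open>On the unit sphere each of the three pairings sums to 1, so together they
      cancel the constant 3 and only the cumulants remain.\<close>
    moreover have "(\<Sum>a\<in>UNIV. u $ a * (\<Sum>b\<in>UNIV. u $ b * (\<Sum>c\<in>UNIV. u $ c * (\<Sum>d\<in>UNIV. u $ d *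
        (m4 a b c d))))) + - 3
      = (\<Sum>a\<in>UNIV. u $ a ^ 4 * \<kappa> a)" if "u \<in> sphere 0 1" for u
    proof -
      have one: "(\<Sum>a\<in>UNIV. u $ a * u $ a) = 1"
        using that by (simp add: norm_eq_1 inner_vec_def)
      have d: "(\<Sum>d\<in>UNIV. u $ d * (m4 a b c d))
          = (if a = b \<and> b = c then u $ a * \<kappa> a else 0) + (if a = b then u $ c else 0) + (if a = c then u $ b else 0) + (if b = c then u $ a else 0)" for a b c
        by (simp add: distrib_left sum.distrib if_distrib[of "\<lambda>t. _ * t"] cong: if_cong)
      have c: "(\<Sum>c\<in>UNIV. u $ c * ((if a = b \<and> b = c then u $ a * \<kappa> a else 0) + (if a = b then u $ c else 0)
             + (if a = c then u $ b else 0) + (if b = c then u $ a else 0)))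
          = (if a = b then u $ a * (u $ a * \<kappa> a) else 0) + (if a = b then 1 else 0) + 2 * (u $ a * u $ b)" for a b
        using one
        by (simp add: distrib_left sum.distrib if_distrib[of "\<lambda>t. _ * t"] cong: if_cong)
      have b: "(\<Sum>b\<in>UNIV. u $ b * ((if a = b then u $ a * (u $ a * \<kappa> a) else 0) + (if a = b then 1 else 0) + 2 * (u $ a * u $ b)))
          = u $ a * (u $ a * (u $ a * \<kappa> a)) + 3 * u $ a" for a
      proof -
        have "(\<Sum>b\<in>UNIV. u $ b * (2 * (u $ a * u $ b))) = (2 * u $ a) * (\<Sum>b\<in>UNIV. u $ b * u $ b)"
          by (simp add: sum_distrib_left mult_ac)
        then show ?thesis
          by (simp add: one distrib_left sum.distrib if_distrib[of "\<lambda>t. _ * t"] cong: if_cong)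
      qed
      have "(\<Sum>a\<in>UNIV. u $ a * (u $ a * (u $ a * (u $ a * \<kappa> a)) + 3 * u $ a)) = (\<Sum>a\<in>UNIV. u $ a ^ 4 * \<kappa> a) + 3 * (\<Sum>a\<in>UNIV. u $ a * u $ a)"
        by (simp add: distrib_left sum.distrib sum_distrib_left eval_nat_numeral mult_ac)
      then show ?thesis unfolding d c b one by simp
    qed
    ultimately have "ulim (\<lambda>x u. (\<Sum>i<fst x. (u \<bullet> Y x i) ^ 4) / real (fst x) - 3)
      (\<lambda>u. \<Sum>a\<in>UNIV. u $ a ^ 4 * \<kappa> a)"
      by (rule ulim_cong)
    then have "ulim (\<lambda>x u. \<alpha> * ((\<Sum>i<fst x. (u \<bullet> Y x i) ^ 3) / real (fst x))\<^sup>2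
       + (1 - \<alpha>) * ((\<Sum>i<fst x. (u \<bullet> Y x i) ^ 4) / real (fst x) - 3)\<^sup>2)
      (\<lambda>u. \<alpha> * (\<Sum>a\<in>UNIV. u $ a ^ 3 * \<gamma> a)\<^sup>2 + (1 - \<alpha>) * (\<Sum>a\<in>UNIV. u $ a ^ 4 * \<kappa> a)\<^sup>2)"
      by (intro ulim_add ulim_mult ulim_power 3 ulim_tendsto tendsto_const)
    then show ?thesis
      by (simp add: sample_index_def[abs_def] index_poly_def[abs_def] pop_index_def[abs_def])
  qed
qed

section \<open>The population index on the sphere\<close>

definition contrast :: "'p \<Rightarrow> real" where
  "contrast k = \<alpha> * (\<gamma> k)\<^sup>2 + (1 - \<alpha>) * (\<kappa> k)\<^sup>2"

lemma contrast_nonneg: "0 \<le> contrast k"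
  using alpha by (simp add: contrast_def)

lemma pop_index_axis: "pop_index (axis k 1) = contrast k"
proof -
  have "(\<Sum>a\<in>UNIV. (axis k 1 $ a) ^ m * g a) = g k" if "m > 0" for m and g :: "'p \<Rightarrow> real"
  proof -
    have "(\<Sum>a\<in>UNIV. (axis k 1 $ a) ^ m * g a) = (\<Sum>a\<in>UNIV. if a = k then g a else 0)"
      using that by (intro sum.cong refl) (auto simp: axis_def)
    then show ?thesis by simp
  qed
  then show ?thesis by (simp add: pop_index_def contrast_def)
qed

text \<open>Cauchy-Schwarz with one factor \<open>u $ a\<close> split off, whose squares sum to 1.
  Skewness lands on fourth powers at once; kurtosis lands on sixth powers, lowered by
  \<open>(u $ a)\<^sup>2 \<le> 1\<close> so that both parts share the same weights.\<close>

lemma pop_index_le: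
  assumes "norm u = 1"
  shows "pop_index u \<le> (\<Sum>a\<in>UNIV. u $ a ^ 4 * contrast a)"
proof -
  have one: "(\<Sum>a\<in>UNIV. (u $ a)\<^sup>2) = 1"
    using assms by (simp add: norm_eq_1 inner_vec_def power2_eq_square)
  have "(\<Sum>a\<in>UNIV. u $ a ^ 3 * \<gamma> a)\<^sup>2 = (\<Sum>a\<in>UNIV. u $ a * ((u $ a)\<^sup>2 * \<gamma> a))\<^sup>2"
    by (simp add: power3_eq_cube power2_eq_square mult.assoc)
  also have "\<dots> \<le> (\<Sum>a\<in>UNIV. (u $ a)\<^sup>2) * (\<Sum>a\<in>UNIV. ((u $ a)\<^sup>2 * \<gamma> a)\<^sup>2)"
    by (rule Cauchy_Schwarz_ineq_sum)
  also have "\<dots> = (\<Sum>a\<in>UNIV. u $ a ^ 4 * (\<gamma> a)\<^sup>2)"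
    unfolding one by (simp add: power_mult_distrib flip: power_mult)
  finally have 3: "(\<Sum>a\<in>UNIV. u $ a ^ 3 * \<gamma> a)\<^sup>2 \<le> (\<Sum>a\<in>UNIV. u $ a ^ 4 * (\<gamma> a)\<^sup>2)" .
  have "(\<Sum>a\<in>UNIV. u $ a ^ 4 * \<kappa> a)\<^sup>2 = (\<Sum>a\<in>UNIV. u $ a * ((u $ a) ^ 3 * \<kappa> a))\<^sup>2"
    by (simp add: eval_nat_numeral mult.assoc)
  also have "\<dots> \<le> (\<Sum>a\<in>UNIV. (u $ a)\<^sup>2) * (\<Sum>a\<in>UNIV. ((u $ a) ^ 3 * \<kappa> a)\<^sup>2)"
    by (rule Cauchy_Schwarz_ineq_sum)
  also have "\<dots> = (\<Sum>a\<in>UNIV. (u $ a)\<^sup>2 * (u $ a ^ 4 * (\<kappa> a)\<^sup>2))"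
    unfolding one by (simp add: power_mult_distrib mult.assoc[symmetric] flip: power_mult power_add)
  also have "\<dots> \<le> (\<Sum>a\<in>UNIV. 1 * (u $ a ^ 4 * (\<kappa> a)\<^sup>2))"
  proof (intro sum_mono mult_right_mono)
    fix a
    have "\<bar>u $ a\<bar> \<le> 1" using component_le_norm_cart[of u a] assms by simp
    then show "(u $ a)\<^sup>2 \<le> 1" by (simp add: abs_square_le_1)
  qed simp
  finally have 4: "(\<Sum>a\<in>UNIV. u $ a ^ 4 * \<kappa> a)\<^sup>2 \<le> (\<Sum>a\<in>UNIV. u $ a ^ 4 * (\<kappa> a)\<^sup>2)" by simp
  have "pop_index u \<le> \<alpha> * (\<Sum>a\<in>UNIV. u $ a ^ 4 * (\<gamma> a)\<^sup>2) + (1 - \<alpha>) * (\<Sum>a\<in>UNIV. u $ a ^ 4 * (\<kappa> a)\<^sup>2)"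
    unfolding pop_index_def using alpha 3 4 by (intro add_mono mult_left_mono) auto
  also have "\<dots> = (\<Sum>a\<in>UNIV. u $ a ^ 4 * contrast a)"
    by (simp add: contrast_def sum_distrib_left distrib_left sum.distrib mult_ac)
  finally show ?thesis .
qed

end

text \<open>On the cap of row \<open>k\<close> the later coordinates have weight \<open>t\<close> at
  most \<open>1 - (\<rho> k)\<^sup>2\<close>. The condition \<open>separation\<close> is
  \<open>t * (contrast k + B k) < 2 * contrast k\<close> at this extreme weight, which keeps the
  population index strictly below its value at the axis. It is required only of rows that have a
  later one.\<close>

locale deflation_sample = ica_sample N M z Z \<alpha> deg
  for N :: "'v measure" and M :: "'w measure" and z :: "'v \<Rightarrow> real^('p::{finite,linorder})" and Z \<alpha> deg +
  fixes \<rho> :: "'p \<Rightarrow> real" and B :: "'p \<Rightarrow> real"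
    and U :: "nat \<Rightarrow> 'w \<Rightarrow> real^('p::{finite,linorder})^('p::{finite,linorder})"
  assumes rho: "0 \<le> \<rho> k" "\<rho> k < 1"
    and B: "k < i \<Longrightarrow> contrast i \<le> B k" "0 \<le> B k"
    and separation: "k < i \<Longrightarrow> (1 - (\<rho> k)\<^sup>2) * (contrast k + B k) < 2 * contrast k"
    and U_orthogonal: "\<omega> \<in> space M \<Longrightarrow> orthogonal_matrix (U n \<omega>)"
    and U_rows: "\<omega> \<in> space M \<Longrightarrow>
      row_choice \<rho> (sample_index (n, \<omega>)) k (feasible_dirs (U n \<omega>) k) (U n \<omega> $ k)"
begin

abbreviation "Ux x \<equiv> U (fst x) (snd x)"

lemma U_inner: "snd x \<in> space M \<Longrightarrow> Ux x $ i \<bullet> Ux x $ j = (if i = j then 1 else 0)"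
  using U_orthogonal[of "snd x" "fst x"] unfolding orthogonal_matrix_orthonormal_rows
  by (auto simp: row_def orthogonal_def norm_eq_1)

text \<open>Near-maximality forces \<open>u\<close> close to the \<open>k\<close>-th axis: with \<open>t\<close> the squared weight of the later
  coordinates, the population index is at most
  \<open>contrast k - t * (2 * contrast k - t * (contrast k + B k))\<close>, up to the weight \<open>\<eta>\<close> of the earlier ones.\<close>

lemma near_maximizer:
  assumes e: "0 < e"
  obtains \<delta> where "\<delta> > 0"
    "\<And>u. norm u = 1 \<Longrightarrow> (\<Sum>j\<in>{..<k}. (u $ j)\<^sup>2) \<le> \<delta> \<Longrightarrow> \<rho> k \<le> \<bar>u $ k\<bar> \<Longrightarrow>
      contrast k - \<delta> \<le> pop_index u \<Longrightarrow> 1 - e \<le> (u $ k)\<^sup>2"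
proof -
  define c where "c = contrast k"
  define \<tau> where "\<tau> = 1 - (\<rho> k)\<^sup>2"
  \<comment> \<open>A lower bound for the loss per unit of \<open>t\<close>. The last row has
    \<open>t = 0\<close>, and any positive value serves.\<close>
  define s where "s = (if \<exists>i. k < i then 2 * c - \<tau> * (c + B k) else 1)"
  define D where "D = (\<Sum>a\<in>UNIV. contrast a)"
  have c0: "0 \<le> c" by (simp add: c_def contrast_nonneg)
  have s0: "s > 0" using separation[of k] by (auto simp: s_def c_def \<tau>_def)
  have D0: "0 \<le> D" by (simp add: D_def sum_nonneg contrast_nonneg)
  define q where "q = 1 + D"
  have q0: "q > 0" using D0 by (simp add: q_def)
  \<comment> \<open>One bound caps the weight on earlier coordinates by \<open>e / 2\<close>; the
    other keeps the total error \<open>\<delta> * (1 + D)\<close>, in which \<open>D\<close> bounds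
    every contrast, below \<open>e * s / 2\<close>.\<close>
  define \<delta> where "\<delta> = min (e / 2) (e * s / (2 * q))"
  have d0: "\<delta> > 0" using e s0 q0 by (simp add: \<delta>_def)
  have d1: "\<delta> \<le> e / 2" unfolding \<delta>_def by (rule min.cobounded1)
  have "\<delta> \<le> e * s / (2 * q)" unfolding \<delta>_def by (rule min.cobounded2)
  then have "\<delta> * q \<le> e * s / 2" using q0 by (simp add: field_simps)
  then have d2: "\<delta> * (1 + D) \<le> e * s / 2" by (simp add: q_def)
  show thesis
  proof (rule that[OF d0])
    fix u :: "real^('p::{finite,linorder})"
    assume u: "norm u = 1" "(\<Sum>j\<in>{..<k}. (u $ j)\<^sup>2) \<le> \<delta>" "\<rho> k \<le> \<bar>u $ k\<bar>" "contrast k - \<delta> \<le> pop_index u"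
    define t where "t = (\<Sum>i\<in>{k<..}. (u $ i)\<^sup>2)"
    define \<eta> where "\<eta> = (\<Sum>j\<in>{..<k}. (u $ j)\<^sup>2)"
    have split: "(\<Sum>a\<in>UNIV. g a) = (\<Sum>j\<in>{..<k}. g j) + g k + (\<Sum>i\<in>{k<..}. g i)" for g :: "'p \<Rightarrow> real"
    proof -
      have "(UNIV :: 'p set) = insert k ({..<k} \<union> {k<..})" by auto
      then have "(\<Sum>a\<in>UNIV. g a) = (\<Sum>a\<in>insert k ({..<k} \<union> {k<..}). g a)" by simp
      also have "\<dots> = g k + (\<Sum>a\<in>{..<k} \<union> {k<..}. g a)" by (rule sum.insert) auto
      also have "(\<Sum>a\<in>{..<k} \<union> {k<..}. g a) = (\<Sum>j\<in>{..<k}. g j) + (\<Sum>i\<in>{k<..}. g i)"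
        by (rule sum.union_disjoint) auto
      finally show ?thesis by simp
    qed
    have one: "\<eta> + (u $ k)\<^sup>2 + t = 1"
      using split[of "\<lambda>a. (u $ a)\<^sup>2"] u(1) by (simp add: norm_eq_1 inner_vec_def power2_eq_square t_def \<eta>_def)
    have t0: "0 \<le> t" and e0: "0 \<le> \<eta>" by (auto simp: t_def \<eta>_def sum_nonneg)
    have "(\<rho> k)\<^sup>2 \<le> (u $ k)\<^sup>2" using u(3) rho(1)[of k] by (metis power2_abs power_mono)
    then have t1: "t \<le> \<tau>" using one e0 by (simp add: \<tau>_def)
    have p4: "u $ a ^ 4 = ((u $ a)\<^sup>2)\<^sup>2" for a by (simp flip: power_mult)
    have u1: "(u $ a)\<^sup>2 \<le> 1" for a
    proof -
      have "\<bar>u $ a\<bar> \<le> 1" using component_le_norm_cart[of u a] u(1) by simp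
      then show ?thesis by (simp add: abs_square_le_1)
    qed
    have low: "(\<Sum>j\<in>{..<k}. u $ j ^ 4 * contrast j) \<le> D * \<eta>"
    proof -
      have "u $ j ^ 4 * contrast j \<le> (u $ j)\<^sup>2 * D" for j
      proof -
        have "contrast j \<le> D" unfolding D_def by (rule member_le_sum) (auto simp: contrast_nonneg)
        moreover have "u $ j ^ 4 \<le> (u $ j)\<^sup>2"
          unfolding p4 using mult_left_mono[OF u1[of j] zero_le_power2[of "u $ j"]] by (simp add: power2_eq_square)
        ultimately show ?thesis by (intro mult_mono) (auto simp: contrast_nonneg)
      qed
      then have "(\<Sum>j\<in>{..<k}. u $ j ^ 4 * contrast j) \<le> (\<Sum>j\<in>{..<k}. (u $ j)\<^sup>2 * D)" by (rule sum_mono)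
      then show ?thesis by (simp add: \<eta>_def sum_distrib_left mult.commute)
    qed
    have high: "(\<Sum>i\<in>{k<..}. u $ i ^ 4 * contrast i) \<le> B k * t\<^sup>2"
    proof -
      have "(\<Sum>i\<in>{k<..}. u $ i ^ 4 * contrast i) \<le> (\<Sum>i\<in>{k<..}. ((u $ i)\<^sup>2 * t) * B k)"
      proof (intro sum_mono mult_mono)
        fix i assume i: "i \<in> {k<..}"
        show "contrast i \<le> B k" using B(1) i by simp
        have "(u $ i)\<^sup>2 \<le> t" unfolding t_def using i by (intro member_le_sum) auto
        then show "u $ i ^ 4 \<le> (u $ i)\<^sup>2 * t"
          unfolding p4 power2_eq_square[of "(u $ i)\<^sup>2"] by (rule mult_left_mono) simp
      qed (auto simp: contrast_nonneg t0)
      also have "\<dots> = B k * t\<^sup>2"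
      proof -
        have "(\<Sum>i\<in>{k<..}. ((u $ i)\<^sup>2 * t) * B k) = (\<Sum>i\<in>{k<..}. (u $ i)\<^sup>2) * t * B k"
          by (simp add: sum_distrib_right)
        also have "\<dots> = B k * t\<^sup>2" unfolding t_def[symmetric] by (simp add: power2_eq_square mult_ac)
        finally show ?thesis .
      qed
      finally show ?thesis .
    qed
    have mid: "u $ k ^ 4 * c \<le> (1 - t)\<^sup>2 * c"
      unfolding p4 using one e0 c0 by (intro mult_right_mono power_mono) auto
    have "c - \<delta> \<le> (\<Sum>a\<in>UNIV. u $ a ^ 4 * contrast a)"
      using u(4) pop_index_le[OF u(1)] by (simp add: c_def)
    also have "\<dots> \<le> D * \<eta> + (1 - t)\<^sup>2 * c + B k * t\<^sup>2"
      unfolding split[of "\<lambda>a. u $ a ^ 4 * contrast a"] using low mid high by (simp add: c_def)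
    finally have main: "t * (2 * c - t * (c + B k)) \<le> \<delta> + D * \<eta>"
      by (simp add: power2_eq_square algebra_simps)
    have "t * s \<le> \<delta> + D * \<eta>"
    proof (cases "\<exists>i. k < i")
      case True
      have "t * (c + B k) \<le> \<tau> * (c + B k)"
        using t1 c0 B(2)[of k] by (intro mult_right_mono) auto
      then have "t * s \<le> t * (2 * c - t * (c + B k))"
        using True t0 by (intro mult_left_mono) (auto simp: s_def)
      with main show ?thesis by linarith
    next
      case False
      then have "{k<..} = {}" by auto
      then have "t = 0" by (simp add: t_def)
      then show ?thesis using d0 D0 e0 by simp
    qed
    also have "\<dots> \<le> \<delta> + D * \<delta>" using u(2) D0 by (intro add_left_mono mult_left_mono) (auto simp: \<eta>_def)
    also have "\<dots> = \<delta> * (1 + D)" by (simp add: algebra_simps)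
    also have "\<dots> \<le> e * s / 2" by (rule d2)
    finally have "t * s \<le> (e / 2) * s" by simp
    then have "t \<le> e / 2" using s0 by (rule mult_right_le_imp_le)
    with one d1 u(2) show "1 - e \<le> (u $ k)\<^sup>2" by (simp add: \<eta>_def)
  qed
qed

section \<open>Convergence of the selected rows\<close>

lemma pop_index_continuous: "isCont pop_index u"
  unfolding pop_index_def by (intro continuous_intros)

lemma sample_index_uminus: "sample_index x (- u) = sample_index x u"
  by (simp add: sample_index_def index_poly_uminus)

lemma sample_index_continuous: "continuous_on K (sample_index x)"
  unfolding sample_index_def index_poly_def by (cases "fst x = 0") (auto intro!: continuous_intros)

text \<open>The chosen row is compared with the normalized projection \<open>u0\<close> of the axis
  onto the complement of the earlier rows. That competitor is feasible and tends to the axis, so a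
  maximizer on the cap has population index nearly \<open>contrast k\<close>. Three errors of
  \<open>\<delta> / 3\<close> enter: the index at \<open>u0\<close> against its limit, and the
  sampling error at either point.\<close>

lemma U_diag_tendsto_step:
  assumes IH: "\<And>j. j < k \<Longrightarrow> ((\<lambda>x. Ux x $ j) \<longlongrightarrow> axis j 1) F"
  shows "((\<lambda>x. Ux x $ k $ k) \<longlongrightarrow> 1) F"
proof (rule tendstoI)
  fix e0 :: real assume "e0 > 0"
  \<comment> \<open>The entry demanded by \<open>good_row\<close>. With
    \<open>e \<le> 1 - r\<^sup>2\<close>, a maximizer on the cap reaches it in absolute value, so
    that a good row exists.\<close>
  define r where "r = (1 + \<rho> k) / 2"
  have r: "\<rho> k < r" "0 < r" "r < 1" using rho[of k] by (auto simp: r_def)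
  then have r2: "r\<^sup>2 < 1" by (simp add: abs_square_less_1)
  define e where "e = min (e0 / 2) (1 - r\<^sup>2)"
  have e: "0 < e" "e < e0" "e \<le> 1 - r\<^sup>2" using \<open>e0 > 0\<close> r2 by (auto simp: e_def)
  obtain \<delta> where d: "\<delta> > 0" and near: "\<And>u. norm u = 1 \<Longrightarrow> (\<Sum>j\<in>{..<k}. (u $ j)\<^sup>2) \<le> \<delta> \<Longrightarrow> \<rho> k \<le> \<bar>u $ k\<bar> \<Longrightarrow>
      contrast k - \<delta> \<le> pop_index u \<Longrightarrow> 1 - e \<le> (u $ k)\<^sup>2"
    using near_maximizer[OF e(1), of k] by metis
  have d3: "\<delta> / 3 > 0" using d by simp
  define v where "v x = axis k 1 - (\<Sum>j\<in>{..<k}. (axis k 1 \<bullet> Ux x $ j) *\<^sub>R Ux x $ j)" for x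
  define u0 where "u0 x = v x /\<^sub>R norm (v x)" for x
  have "(v \<longlongrightarrow> axis k 1 - (\<Sum>j\<in>{..<k}. (axis k 1 \<bullet> axis j (1::real)) *\<^sub>R axis j (1::real))) F"
    unfolding v_def
  proof (intro tendsto_diff tendsto_const tendsto_sum tendsto_scaleR)
    fix j assume "j \<in> {..<k}"
    then have j: "((\<lambda>x. Ux x $ j) \<longlongrightarrow> axis j 1) F" using IH by simp
    then show "((\<lambda>x. Ux x $ j) \<longlongrightarrow> axis j 1) F" .
    show "((\<lambda>x. axis k 1 \<bullet> Ux x $ j) \<longlongrightarrow> axis k 1 \<bullet> axis j (1::real)) F"
      by (rule tendsto_inner[OF tendsto_const j])
  qed
  moreover have "(\<Sum>j\<in>{..<k}. (axis k 1 \<bullet> axis j (1::real)) *\<^sub>R axis j (1::real)) = (0 :: real^('p::{finite,linorder}))"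
    by (intro sum.neutral) (auto simp: inner_axis_axis)
  ultimately have v: "(v \<longlongrightarrow> axis k 1) F" by simp
  have u0: "(u0 \<longlongrightarrow> axis k 1) F"
    unfolding u0_def by (rule tendsto_eq_intros v refl | simp)+
  have "((\<lambda>x. pop_index (u0 x)) \<longlongrightarrow> contrast k) F"
    using isCont_tendsto_compose[OF pop_index_continuous u0] by (simp add: pop_index_axis)
  then have ev1: "\<forall>\<^sub>F x in F. contrast k - \<delta> / 3 < pop_index (u0 x)"
    by (rule order_tendstoD) (use d in simp)
  have "((\<lambda>x. u0 x $ k) \<longlongrightarrow> axis k 1 $ k) F" by (intro tendsto_intros u0)
  then have ev2: "\<forall>\<^sub>F x in F. \<rho> k < u0 x $ k" by (rule order_tendstoD) (use rho[of k] in simp)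
  have "((\<lambda>x. norm (v x)) \<longlongrightarrow> norm (axis k (1::real))) F" by (intro tendsto_intros v)
  then have ev3: "\<forall>\<^sub>F x in F. 0 < norm (v x)" by (rule order_tendstoD) simp
  have "((\<lambda>x. \<Sum>j\<in>{..<k}. (norm (Ux x $ j - axis j 1))\<^sup>2) \<longlongrightarrow> (\<Sum>j\<in>{..<k}. (norm (axis j 1 - axis j (1::real) :: real^('p::{finite,linorder})))\<^sup>2)) F"
    by (intro tendsto_intros IH) auto
  then have ev4: "\<forall>\<^sub>F x in F. (\<Sum>j\<in>{..<k}. (norm (Ux x $ j - axis j 1))\<^sup>2) < \<delta>"
    by (rule order_tendstoD) (use d in simp)
  have ev5: "\<forall>\<^sub>F x in F. \<forall>u\<in>sphere 0 1. dist (sample_index x u) (pop_index u) < \<delta> / 3"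
    using sample_index_uniform d3 unfolding ulim_def uniform_limit_iff by blast
  show "\<forall>\<^sub>F x in F. dist (Ux x $ k $ k) 1 < e0"
    using ev1 ev2 ev3 ev4 ev5 M.eventually_whp_space
  proof eventually_elim
    case (elim x)
    let ?S = "feasible_dirs (Ux x) k"
    have norm_S: "norm u = 1" if "u \<in> ?S" for u using that by (simp add: feasible_dirs_def)
    have u0S: "u0 x \<in> ?S"
    proof -
      have "v x \<bullet> Ux x $ j = 0" if "j < k" for j
      proof -
        have "(\<Sum>i\<in>{..<k}. (axis k 1 \<bullet> Ux x $ i) *\<^sub>R Ux x $ i) \<bullet> Ux x $ j
            = (\<Sum>i\<in>{..<k}. if i = j then axis k 1 \<bullet> Ux x $ i else 0)"
          using elim(6) by (simp add: inner_sum_left U_inner if_distrib cong: if_cong)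
        also have "\<dots> = axis k 1 \<bullet> Ux x $ j" using that by simp
        finally show ?thesis by (simp add: v_def inner_diff_left)
      qed
      then show ?thesis using elim(3) by (simp add: feasible_dirs_def u0_def)
    qed
    have close: "1 - e \<le> (u $ k)\<^sup>2"
      if u: "u \<in> ?S" "\<rho> k \<le> \<bar>u $ k\<bar>" "sample_index x (u0 x) \<le> sample_index x u" for u
    proof (rule near[OF norm_S[OF u(1)] _ u(2)])
      have "(u $ j)\<^sup>2 \<le> (norm (Ux x $ j - axis j 1))\<^sup>2" if "j < k" for j
      proof -
        \<comment> \<open>Orthogonality to an earlier row, itself close to its axis, makes the
          earlier coordinate small.\<close>
        have "u $ j = u \<bullet> (axis j 1 - Ux x $ j)"
          using u(1) that by (simp add: feasible_dirs_def inner_diff_right inner_axis)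
        then have "\<bar>u $ j\<bar> \<le> norm u * norm (axis j 1 - Ux x $ j)"
          by (metis Cauchy_Schwarz_ineq2)
        then have "\<bar>u $ j\<bar> \<le> norm (Ux x $ j - axis j 1)"
          using norm_S[OF u(1)] by (simp add: norm_minus_commute)
        then show ?thesis by (metis abs_ge_zero power2_abs power_mono)
      qed
      then have "(\<Sum>j\<in>{..<k}. (u $ j)\<^sup>2) \<le> (\<Sum>j\<in>{..<k}. (norm (Ux x $ j - axis j 1))\<^sup>2)"
        by (intro sum_mono) auto
      then show "(\<Sum>j\<in>{..<k}. (u $ j)\<^sup>2) \<le> \<delta>" using elim(4) by simp
      have "dist (sample_index x u) (pop_index u) < \<delta> / 3" "dist (sample_index x (u0 x)) (pop_index (u0 x)) < \<delta> / 3"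
        using elim(5) norm_S[OF u(1)] norm_S[OF u0S] by auto
      then show "contrast k - \<delta> \<le> pop_index u"
        using elim(1) u(3) unfolding dist_real_def abs_less_iff by linarith
    qed
    have ex: "\<exists>u. good_row \<rho> (sample_index x) k ?S u"
    proof -
      define L where "L = {u\<in>?S. \<rho> k \<le> \<bar>u $ k\<bar>}"
      have "compact L"
      proof -
        have "L = sphere 0 1 \<inter> (\<Inter>j\<in>{..<k}. {u. u \<bullet> Ux x $ j = 0}) \<inter> {u. \<rho> k \<le> \<bar>u $ k\<bar>}"
          by (auto simp: L_def feasible_dirs_def)
        moreover have "closed {u. u \<bullet> Ux x $ j = 0}" for j
          by (intro closed_Collect_eq continuous_intros)
        moreover have "closed {u :: real^('p::{finite,linorder}). \<rho> k \<le> \<bar>u $ k\<bar>}"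
          by (intro closed_Collect_le continuous_intros)
        ultimately show ?thesis by (auto intro!: compact_Int_closed closed_INT)
      qed
      moreover have "u0 x \<in> L" using u0S elim(2) by (simp add: L_def)
      ultimately have "\<exists>u\<in>L. \<forall>u'\<in>L. sample_index x u' \<le> sample_index x u"
        by (intro continuous_attains_sup sample_index_continuous) auto
      then obtain u where u: "u \<in> ?S" "\<rho> k \<le> \<bar>u $ k\<bar>" and mx: "\<forall>u'\<in>L. sample_index x u' \<le> sample_index x u"
        unfolding L_def by blast
      have "1 - e \<le> (u $ k)\<^sup>2" using u mx \<open>u0 x \<in> L\<close> by (intro close) auto
      then have "r\<^sup>2 \<le> \<bar>u $ k\<bar>\<^sup>2" using e(3) by simp
      then have big: "r \<le> \<bar>u $ k\<bar>" by (rule power2_le_imp_le) simp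
      \<comment> \<open>The index is even, so the sign required by \<open>good_row\<close> can be
        arranged by reflection.\<close>
      define u' where "u' = (if 0 \<le> u $ k then u else - u)"
      have "u' \<in> ?S" using u(1) by (auto simp: u'_def feasible_dirs_def)
      moreover have "r \<le> u' $ k" using big by (auto simp: u'_def)
      moreover have "sample_index x u' = sample_index x u" by (simp add: u'_def sample_index_uminus)
      ultimately have "good_row \<rho> (sample_index x) k ?S u'"
        using mx by (simp add: good_row_def r_def L_def)
      then show ?thesis by blast
    qed
    have "row_choice \<rho> (sample_index x) k ?S (Ux x $ k)"
      using U_rows[OF elim(6), of "fst x" k] by simp
    with ex have good: "good_row \<rho> (sample_index x) k ?S (Ux x $ k)" by (simp add: row_choice_def)
    then have S: "Ux x $ k \<in> ?S" and rk: "r \<le> Ux x $ k $ k"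
      and mx: "\<And>u'. u' \<in> ?S \<Longrightarrow> \<rho> k \<le> \<bar>u' $ k\<bar> \<Longrightarrow> sample_index x u' \<le> sample_index x (Ux x $ k)"
      by (auto simp: good_row_def r_def)
    have "1 - e \<le> (Ux x $ k $ k)\<^sup>2"
      using S rk r u0S elim(2) by (intro close mx) auto
    moreover have le1: "Ux x $ k $ k \<le> 1"
      using component_le_norm_cart[of "Ux x $ k" k] norm_S[OF S] by simp
    moreover have "(Ux x $ k $ k)\<^sup>2 \<le> Ux x $ k $ k"
      using le1 rk r by (simp add: power2_eq_square mult_left_le)
    ultimately show ?case using e(2) by (simp add: dist_real_def)
  qed
qed

text \<open>For a unit row the squared distance to the axis is \<open>2 - 2 * Ux x $ k $ k\<close>,
  so the diagonal entry controls the whole row. The induction is on the number of smaller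
  indices.\<close>

lemma U_row_tendsto: "((\<lambda>x. Ux x $ k) \<longlongrightarrow> axis k 1) F"
proof (induction k rule: measure_induct_rule[where f = "\<lambda>k. card {..<k}"])
  case (less k)
  have "((\<lambda>x. Ux x $ j) \<longlongrightarrow> axis j 1) F" if "j < k" for j
    using that by (intro less psubset_card_mono) auto
  then have diag: "((\<lambda>x. Ux x $ k $ k) \<longlongrightarrow> 1) F" by (rule U_diag_tendsto_step)
  then have "((\<lambda>x. sqrt (2 - 2 * Ux x $ k $ k)) \<longlongrightarrow> sqrt (2 - 2 * 1)) F" by (intro tendsto_intros)
  then have lim: "((\<lambda>x. sqrt (2 - 2 * Ux x $ k $ k)) \<longlongrightarrow> 0) F" by simp
  have "((\<lambda>x. Ux x $ k - axis k 1) \<longlongrightarrow> 0) F"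
  proof (rule Lim_null_comparison[OF _ lim])
    show "\<forall>\<^sub>F x in F. norm (Ux x $ k - axis k 1) \<le> sqrt (2 - 2 * Ux x $ k $ k)"
      using M.eventually_whp_space
    proof eventually_elim
      case (elim x)
      then have "Ux x $ k \<bullet> Ux x $ k = 1" by (simp add: U_inner)
      then have "(norm (Ux x $ k - axis k 1))\<^sup>2 = 2 - 2 * Ux x $ k $ k"
        by (simp add: power2_norm_eq_inner inner_diff_left inner_diff_right inner_axis inner_axis' inner_axis_axis)
      then show ?case by (metis norm_ge_zero order_refl real_sqrt_abs2 real_sqrt_unique)
    qed
  qed
  then show ?case by (rule LIM_zero_cancel)
qed

definition W :: "nat \<times> 'w \<Rightarrow> real^('p::{finite,linorder})^('p::{finite,linorder})" where
  "W x = Ux x ** S x"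

lemma W_tendsto: "(W \<longlongrightarrow> mat 1) F"
proof -
  have "(Ux \<longlongrightarrow> mat 1) F"
  proof (rule vec_tendstoI)
    fix k
    have "mat 1 $ k = (axis k 1 :: real^('p::{finite,linorder}))" by (simp add: vec_eq_iff mat_def axis_def)
    then show "((\<lambda>x. Ux x $ k) \<longlongrightarrow> mat 1 $ k) F" using U_row_tendsto[of k] by simp
  qed
  then have "((\<lambda>x. Ux x ** S x) \<longlongrightarrow> mat 1 ** mat 1) F" by (intro tendsto_matrix_mult S_tendsto)
  then show ?thesis by (simp add: W_def[abs_def])
qed

end

section \<open>Linearization\<close>

lemma sum_axis: "(\<Sum>a\<in>UNIV. axis k 1 $ a * f a) = (f k :: real)"
proof -
  have "(\<Sum>a\<in>UNIV. axis k 1 $ a * f a) = (\<Sum>a\<in>UNIV. if a = k then f a else 0)"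
    by (intro sum.cong refl) (simp add: axis_def)
  then show ?thesis by simp
qed

lemma bigo_mult_tendsto_0:
  fixes f g :: "'a \<Rightarrow> real"
  assumes "f \<in> O[F](q)" "(g \<longlongrightarrow> 0) F"
  shows "(\<lambda>x. f x * g x) \<in> o[F](q)"
proof -
  have "g \<in> o[F](\<lambda>x. 1)" using assms(2) by (intro smalloI_tendsto) auto
  from landau_o.big_small_mult[OF assms(1) this] show ?thesis by simp
qed

lemma smallo_mult_tendsto:
  fixes f g :: "'a \<Rightarrow> real"
  assumes "f \<in> o[F](q)" "(g \<longlongrightarrow> c) F"
  shows "(\<lambda>x. f x * g x) \<in> o[F](q)"
proof -
  have "g \<in> O[F](\<lambda>x. 1)" using assms(2) by (intro bigoI_tendsto) auto
  from landau_o.small_big_mult[OF assms(1) this] show ?thesis by simp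
qed

lemma smallo_cmult:
  fixes f :: "'a \<Rightarrow> real"
  shows "f \<in> o[F](q) \<Longrightarrow> (\<lambda>x. c * f x) \<in> o[F](q)"
  by (cases "c = 0") auto

lemma bigo_cmult:
  fixes f :: "'a \<Rightarrow> real"
  shows "f \<in> O[F](q) \<Longrightarrow> (\<lambda>x. c * f x) \<in> O[F](q)"
  by (cases "c = 0") auto

lemma bigo_bounded:
  fixes f q :: "'a \<Rightarrow> real"
  assumes "\<And>x. \<bar>f x\<bar> \<le> q x"
  shows "f \<in> O[F](q)"
  by (intro landau_o.big_mono always_eventually allI) (use assms in \<open>auto intro: order_trans[OF _ abs_ge_self]\<close>)

lemma smallo_eventually_eq:
  fixes f g :: "'a \<Rightarrow> real"
  assumes "f \<in> o[F](q)" "eventually (\<lambda>x. g x = f x) F"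
  shows "g \<in> o[F](q)"
  using assms landau_o.small.in_cong by blast

context deflation_sample
begin

section \<open>Entrywise errors and their common scale\<close>

abbreviation "kd a b \<equiv> (if a = b then 1 else 0 :: real)"

definition h :: "'p \<Rightarrow> 'p \<Rightarrow> nat \<times> 'w \<Rightarrow> real" where
  "h a b x = W x $ a $ b - kd a b"

definition H :: "'p \<Rightarrow> nat \<times> 'w \<Rightarrow> real^('p::{finite,linorder})" where
  "H k x = W x $ k - axis k 1"

definition sd :: "'p \<Rightarrow> 'p \<Rightarrow> nat \<times> 'w \<Rightarrow> real" where
  "sd a b x = am [a, b] x - kd a b"

definition rh :: "'p \<Rightarrow> 'p \<Rightarrow> nat \<times> 'w \<Rightarrow> real" where
  "rh k l x = am [k, k, l] x - am [l] x"

definition qh :: "'p \<Rightarrow> 'p \<Rightarrow> nat \<times> 'w \<Rightarrow> real" where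
  "qh k l x = am [k, k, k, l] x - \<gamma> k * am [l] x"

text \<open>Every summand is an average with mean zero. The diagonal is left out for
  \<open>rh\<close> and \<open>qh\<close>, whose limits there are the third and fourth moments; the
  factor \<open>1 - \<alpha>\<close> erases the quartic averages when eighth moments are not
  assumed.\<close>

definition R :: "nat \<times> 'w \<Rightarrow> real" where
  "R x = (\<Sum>a\<in>UNIV. \<bar>am [a] x\<bar>) + (\<Sum>a\<in>UNIV. \<Sum>b\<in>UNIV. \<bar>sd a b x\<bar>)
    + (\<Sum>a\<in>UNIV. \<Sum>b\<in>-{a}. \<bar>rh a b x\<bar>) + (\<Sum>a\<in>UNIV. \<Sum>b\<in>-{a}. \<bar>(1 - \<alpha>) * qh a b x\<bar>)"

definition Q :: "nat \<times> 'w \<Rightarrow> real" where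
  "Q x = R x + (\<Sum>a\<in>UNIV. \<Sum>b\<in>UNIV. \<bar>h a b x\<bar>)"

lemma R_bounds:
  "\<bar>am [a] x\<bar> \<le> R x" "\<bar>sd a b x\<bar> \<le> R x" "a \<noteq> b \<Longrightarrow> \<bar>rh a b x\<bar> \<le> R x" "a \<noteq> b \<Longrightarrow> \<bar>(1 - \<alpha>) * qh a b x\<bar> \<le> R x" "0 \<le> R x"
proof -
  have nn: "0 \<le> (\<Sum>a\<in>UNIV. \<bar>am [a] x\<bar>)" "0 \<le> (\<Sum>a\<in>UNIV. \<Sum>b\<in>UNIV. \<bar>sd a b x\<bar>)"
    "0 \<le> (\<Sum>a\<in>UNIV. \<Sum>b\<in>-{a}. \<bar>rh a b x\<bar>)" "0 \<le> (\<Sum>a\<in>UNIV. \<Sum>b\<in>-{a}. \<bar>(1 - \<alpha>) * qh a b x\<bar>)"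
    by (intro sum_nonneg abs_ge_zero)+
  show "0 \<le> R x" using nn unfolding R_def by linarith
  have le2: "g a b \<le> (\<Sum>a\<in>UNIV. \<Sum>b\<in>I a. g a b)" if "\<And>a b. 0 \<le> g a b" "b \<in> I a"
    for g :: "'p \<Rightarrow> 'p \<Rightarrow> real" and I a b
  proof -
    have "g a b \<le> (\<Sum>b\<in>I a. g a b)" using that by (intro member_le_sum) auto
    also have "\<dots> \<le> (\<Sum>a\<in>UNIV. \<Sum>b\<in>I a. g a b)"
      using that by (intro member_le_sum[where f = "\<lambda>a. \<Sum>b\<in>I a. g a b"] sum_nonneg) auto
    finally show ?thesis .
  qed
  have "\<bar>am [a] x\<bar> \<le> (\<Sum>a\<in>UNIV. \<bar>am [a] x\<bar>)" by (rule member_le_sum) auto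
  then show "\<bar>am [a] x\<bar> \<le> R x" using nn unfolding R_def by linarith
  have "\<bar>sd a b x\<bar> \<le> (\<Sum>a\<in>UNIV. \<Sum>b\<in>UNIV. \<bar>sd a b x\<bar>)"
    by (rule le2[of "\<lambda>a b. \<bar>sd a b x\<bar>"]) auto
  then show "\<bar>sd a b x\<bar> \<le> R x" using nn unfolding R_def by linarith
  assume ab: "a \<noteq> b"
  have "\<bar>rh a b x\<bar> \<le> (\<Sum>a\<in>UNIV. \<Sum>b\<in>-{a}. \<bar>rh a b x\<bar>)"
    by (rule le2[of "\<lambda>a b. \<bar>rh a b x\<bar>"]) (use ab in auto)
  then show "\<bar>rh a b x\<bar> \<le> R x" using nn unfolding R_def by linarith
  have "\<bar>(1 - \<alpha>) * qh a b x\<bar> \<le> (\<Sum>a\<in>UNIV. \<Sum>b\<in>-{a}. \<bar>(1 - \<alpha>) * qh a b x\<bar>)"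
    by (rule le2[of "\<lambda>a b. \<bar>(1 - \<alpha>) * qh a b x\<bar>"]) (use ab in auto)
  then show "\<bar>(1 - \<alpha>) * qh a b x\<bar> \<le> R x" using nn unfolding R_def by linarith
qed

lemma R_bigo:
  "am [a] \<in> O[F](R)" "sd a b \<in> O[F](R)" "a \<noteq> b \<Longrightarrow> rh a b \<in> O[F](R)" "a \<noteq> b \<Longrightarrow> (\<lambda>x. (1 - \<alpha>) * qh a b x) \<in> O[F](R)"
  using R_bounds by (blast intro: bigo_bounded)+

lemma R_le_Q: "R x \<le> Q x" "\<bar>h a b x\<bar> \<le> Q x"
proof -
  have "\<bar>h a b x\<bar> \<le> (\<Sum>b\<in>UNIV. \<bar>h a b x\<bar>)" by (rule member_le_sum) auto
  also have "\<dots> \<le> (\<Sum>a\<in>UNIV. \<Sum>b\<in>UNIV. \<bar>h a b x\<bar>)"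
    by (rule member_le_sum[where f = "\<lambda>a. \<Sum>b\<in>UNIV. \<bar>h a b x\<bar>"]) (auto intro: sum_nonneg)
  finally show "\<bar>h a b x\<bar> \<le> Q x" using R_bounds(5)[of x] by (simp add: Q_def)
  show "R x \<le> Q x" by (simp add: Q_def sum_nonneg)
qed

lemma h_bigo: "h a b \<in> O[F](Q)"
  using R_le_Q(2) by (rule bigo_bounded)

lemma R_bigo_Q: "R \<in> O[F](Q)"
  by (rule bigo_bounded) (simp add: R_le_Q R_bounds(5))

lemmas Q_bigo = R_bigo[THEN landau_o.big_trans[OF _ R_bigo_Q]]

lemma W_row_tendsto: "((\<lambda>x. W x $ k) \<longlongrightarrow> axis k 1) F"
proof -
  have "mat 1 $ k = (axis k 1 :: real^('p::{finite,linorder}))" by (simp add: vec_eq_iff mat_def axis_def)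
  then show ?thesis using tendsto_vec_nth[OF W_tendsto, of k] by simp
qed

lemma h_tendsto: "(h a b \<longlongrightarrow> 0) F"
proof -
  have "((\<lambda>x. W x $ a $ b - kd a b) \<longlongrightarrow> mat 1 $ a $ b - kd a b) F"
    by (intro tendsto_intros W_tendsto)
  then show ?thesis by (simp add: h_def[abs_def] mat_def)
qed

lemma H_nth: "H a x $ b = h a b x"
  by (simp add: H_def h_def axis_def)

section \<open>Linearized orthonormality\<close>

definition dC :: "'p \<Rightarrow> 'p \<Rightarrow> nat \<times> 'w \<Rightarrow> real" where
  "dC a b x = C x $ a $ b - kd a b"

text \<open>Centering changes the covariance by a product of two sample means, one of order
  \<open>Q\<close> and one tending to 0.\<close>

lemma dC_sd: "(\<lambda>x. dC a b x - sd a b x) \<in> o[F](Q)"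
proof -
  have "(\<lambda>x. - (am [a] x * am [b] x)) \<in> o[F](Q)"
    using bigo_mult_tendsto_0[OF Q_bigo(1) am1, of a b] by simp
  then show ?thesis
    by (rule smallo_eventually_eq)
       (use whp_pos in eventually_elim, simp add: dC_def sd_def C_nth cm2_eq)
qed

lemma dC_tendsto: "(dC a b \<longlongrightarrow> 0) F"
proof -
  have "((\<lambda>x. C x $ a $ b - kd a b) \<longlongrightarrow> mat 1 $ a $ b - kd a b) F"
    by (intro tendsto_intros C_tendsto)
  then show ?thesis by (simp add: dC_def[abs_def] mat_def)
qed

lemma dC_bigo: "dC a b \<in> O[F](Q)"
proof -
  have "(\<lambda>x. (dC a b x - sd a b x) + sd a b x) \<in> O[F](Q)"
    by (intro sum_in_bigo Q_bigo landau_o.small_imp_big[OF dC_sd])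
  then show ?thesis by simp
qed

lemma dC_sym: "dC a b x = dC b a x"
  by (auto simp: dC_def C_nth cm_def mult.commute)

definition CW :: "'p \<Rightarrow> 'p \<Rightarrow> nat \<times> 'w \<Rightarrow> real" where
  "CW j l x = (C x *v W x $ j) $ l"

definition rem :: "'p \<Rightarrow> 'p \<Rightarrow> nat \<times> 'w \<Rightarrow> real" where
  "rem j l x = (\<Sum>b\<in>UNIV. h j b x * dC l b x)"

lemma rem_smallo: "rem j l \<in> o[F](Q)"
  unfolding rem_def[abs_def] by (intro big_sum_in_smallo bigo_mult_tendsto_0 h_bigo dC_tendsto)

lemma CW_eq: "CW j l x = kd j l + h j l x + dC j l x + rem j l x"
proof -
  have "CW j l x = (\<Sum>b\<in>UNIV. (kd l b + dC l b x) * (kd b j + h j b x))"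
    by (simp add: CW_def matrix_vector_mult_def dC_def h_def eq_commute[of j])
  also have "\<dots> = (\<Sum>b\<in>UNIV. kd l b * (kd b j + h j b x)) + (\<Sum>b\<in>UNIV. dC l b x * kd b j) + (\<Sum>b\<in>UNIV. h j b x * dC l b x)"
    by (simp only: distrib_left distrib_right sum.distrib mult.commute[of "dC l _ x" "h j _ x"])
  also have "(\<Sum>b\<in>UNIV. kd l b * (kd b j + h j b x)) = kd j l + h j l x"
    by (simp add: if_distrib[of "\<lambda>t. t * _"] cong: if_cong)
  also have "(\<Sum>b\<in>UNIV. dC l b x * kd b j) = dC j l x"
    by (simp add: if_distrib[of "\<lambda>t. _ * t"] dC_sym[of l j] cong: if_cong)
  finally show ?thesis by (simp add: rem_def)
qed

lemma CW_tendsto: "(CW j l \<longlongrightarrow> kd j l) F"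
proof -
  have "((\<lambda>x. (C x *v W x $ j) $ l) \<longlongrightarrow> (mat 1 *v axis j (1::real)) $ l) F"
    by (intro tendsto_vec_nth tendsto_matrix_vector_mult C_tendsto W_row_tendsto)
  then show ?thesis by (simp add: CW_def[abs_def] axis_def eq_commute)
qed

lemma eventually_good:
  "\<forall>\<^sub>F x in F. standardizable (fst x) (\<lambda>i. Z i (snd x)) \<and> snd x \<in> space M \<and> fst x > 0"
  by (intro eventually_conj eventually_standardizable M.eventually_whp_space whp_pos)

lemma orthonormality:
  assumes "standardizable (fst x) (\<lambda>i. Z i (snd x))" "snd x \<in> space M"
  shows "W x $ k \<bullet> (C x *v W x $ l) = kd k l"
  using standardizable.unmixing_orthonormal[OF assms(1) U_orthogonal[OF assms(2), of "fst x"]]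
    standardizable.sample_root_eq[OF assms(1)] standardizable.C_def[OF assms(1)]
  by (simp add: W_def S_def C_def)

text \<open>The linear part of the orthonormality of the rows with respect to \<open>C\<close>. Off
  the diagonal it relates the two triangles; for \<open>k = l\<close> the error is counted twice,
  which is the origin of the factor one half in the diagonal expansion.\<close>

lemma symmetric_part: "(\<lambda>x. h k l x + h l k x + sd k l x) \<in> o[F](Q)"
proof -
  have "(\<lambda>x. - (rem l k x + (\<Sum>a\<in>UNIV. h k a x * (CW l a x - kd l a))) - (dC k l x - sd k l x)) \<in> o[F](Q)"
  proof (rule sum_in_smallo(2)[OF _ dC_sd])
    have "(\<lambda>x. rem l k x + (\<Sum>a\<in>UNIV. h k a x * (CW l a x - kd l a))) \<in> o[F](Q)"
      by (intro sum_in_smallo rem_smallo big_sum_in_smallo bigo_mult_tendsto_0 h_bigo LIM_zero CW_tendsto)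
    then show "(\<lambda>x. - (rem l k x + (\<Sum>a\<in>UNIV. h k a x * (CW l a x - kd l a)))) \<in> o[F](Q)"
      by (simp only: landau_o.small.uminus_in_iff)
  qed
  then show ?thesis
  proof (rule smallo_eventually_eq)
    show "\<forall>\<^sub>F x in F. h k l x + h l k x + sd k l x =
        - (rem l k x + (\<Sum>a\<in>UNIV. h k a x * (CW l a x - kd l a))) - (dC k l x - sd k l x)"
      using eventually_good
    proof eventually_elim
      case (elim x)
      have "W x $ k \<bullet> (C x *v W x $ l) = (\<Sum>a\<in>UNIV. (kd k a + h k a x) * CW l a x)"
        by (simp add: inner_vec_def CW_def h_def)
      also have "\<dots> = (\<Sum>a\<in>UNIV. kd k a * CW l a x) + (\<Sum>a\<in>UNIV. h k a x * CW l a x)"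
        by (simp only: distrib_right sum.distrib)
      also have "(\<Sum>a\<in>UNIV. kd k a * CW l a x) = CW l k x"
        by (simp add: if_distrib[of "\<lambda>t. t * _"] cong: if_cong)
      also have "(\<Sum>a\<in>UNIV. h k a x * CW l a x) = (\<Sum>a\<in>UNIV. h k a x * (CW l a x - kd l a)) + h k l x"
        by (simp add: right_diff_distrib sum_subtractf if_distrib[of "\<lambda>t. _ * t"] cong: if_cong)
      finally have "kd k l = CW l k x + ((\<Sum>a\<in>UNIV. h k a x * (CW l a x - kd l a)) + h k l x)"
        using orthonormality[of x k l] elim by simp
      then show ?case by (simp add: CW_eq[of l k] dC_sym[of l k] eq_commute[of k l])
    qed
  qed
qed

section \<open>Limits and expansion of the gradient\<close>

definition M3 :: "'p \<Rightarrow> nat \<times> 'w \<Rightarrow> real^('p::{finite,linorder}) \<Rightarrow> real" where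
  "M3 k x d = (\<Sum>i<fst x. (W x $ k \<bullet> X x i)\<^sup>2 * (d \<bullet> X x i)) / real (fst x)"

definition M4 :: "'p \<Rightarrow> nat \<times> 'w \<Rightarrow> real^('p::{finite,linorder}) \<Rightarrow> real" where
  "M4 k x d = (\<Sum>i<fst x. (W x $ k \<bullet> X x i) ^ 3 * (d \<bullet> X x i)) / real (fst x)"

definition T :: "'p \<Rightarrow> nat \<times> 'w \<Rightarrow> real^('p::{finite,linorder})" where
  "T k x = index_grad \<alpha> (fst x) (X x) (W x $ k)"

text \<open>Separates each cumulant, where row \<open>k\<close> fills all slots, from a factor
  linear in \<open>d\<close>. An axis for \<open>d\<close> reads off a component of the gradient, a
  row of \<open>W\<close> a multiplier of the estimating equations.\<close>

lemma T_inner: "T k x \<bullet> d = 3 * \<alpha> * M3 k x (W x $ k) * M3 k x d + 4 * (1 - \<alpha>) * (M4 k x (W x $ k) - 3) * M4 k x d"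
proof -
  have "(\<Sum>i<fst x. (W x $ k \<bullet> X x i) ^ 3) / real (fst x) = M3 k x (W x $ k)"
    "(\<Sum>i<fst x. (W x $ k \<bullet> X x i) ^ 4) / real (fst x) = M4 k x (W x $ k)"
    by (simp_all add: M3_def M4_def eval_nat_numeral mult.assoc)
  then show ?thesis unfolding T_def index_grad_inner M3_def[of _ _ d] M4_def[of _ _ d] by (simp only:)
qed

lemma M3_tendsto:
  assumes "(d \<longlongrightarrow> axis j 1) F"
  shows "((\<lambda>x. M3 k x (d x)) \<longlongrightarrow> (if k = j then \<gamma> k else 0)) F"
proof -
  have "((\<lambda>x. \<Sum>a\<in>UNIV. W x $ k $ a * (\<Sum>b\<in>UNIV. W x $ k $ b * (\<Sum>c\<in>UNIV. d x $ c * cm [a, b, c] x))) \<longlongrightarrow>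
     (\<Sum>a\<in>UNIV. axis k 1 $ a * (\<Sum>b\<in>UNIV. axis k 1 $ b * (\<Sum>c\<in>UNIV. axis j 1 $ c * (if a = b \<and> b = c then \<gamma> a else 0))))) F"
    by (intro tendsto_sum tendsto_mult tendsto_vec_nth W_row_tendsto assms cm3)
  then show ?thesis
    by (simp add: avg_inner3[symmetric] sum_axis M3_def power2_eq_square mult.assoc)
qed

lemma M4_tendsto:
  assumes "(d \<longlongrightarrow> axis j 1) F" "\<alpha> \<noteq> 1"
  shows "((\<lambda>x. M4 k x (d x)) \<longlongrightarrow> (if k = j then \<beta> k else 0)) F"
proof -
  have "((\<lambda>x. \<Sum>a\<in>UNIV. W x $ k $ a * (\<Sum>b\<in>UNIV. W x $ k $ b * (\<Sum>c\<in>UNIV. W x $ k $ c * (\<Sum>e\<in>UNIV. d x $ e * cm [a, b, c, e] x)))) \<longlongrightarrow>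
     (\<Sum>a\<in>UNIV. axis k 1 $ a * (\<Sum>b\<in>UNIV. axis k 1 $ b * (\<Sum>c\<in>UNIV. axis k 1 $ c * (\<Sum>e\<in>UNIV. axis j 1 $ e *
       (m4 a b c e)))))) F"
    by (intro tendsto_sum tendsto_mult tendsto_vec_nth W_row_tendsto assms cm4)
  then show ?thesis
    by (simp add: avg_inner4[symmetric] sum_axis M4_def power3_eq_cube mult.assoc) (cases "k = j"; simp)
qed

text \<open>The limit of the multiplier \<open>T k x \<bullet> W x $ k\<close>. It contains
  \<open>\<kappa> k * \<beta> k\<close>, not the square of the cumulant, since the linear factor
  retains the full fourth moment.\<close>

definition lam :: "'p \<Rightarrow> real" where
  "lam k = 3 * \<alpha> * (\<gamma> k)\<^sup>2 + 4 * (1 - \<alpha>) * (\<kappa> k * \<beta> k)"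

lemma T_inner_tendsto:
  assumes "(d \<longlongrightarrow> axis j 1) F"
  shows "((\<lambda>x. T k x \<bullet> d x) \<longlongrightarrow> (if k = j then lam k else 0)) F"
proof -
  have 3: "((\<lambda>x. 3 * \<alpha> * M3 k x (W x $ k) * M3 k x (d x)) \<longlongrightarrow> 3 * \<alpha> * \<gamma> k * (if k = j then \<gamma> k else 0)) F"
    using M3_tendsto[OF W_row_tendsto, of k k] by (intro tendsto_mult tendsto_const M3_tendsto assms) simp
  have 4: "((\<lambda>x. 4 * (1 - \<alpha>) * (M4 k x (W x $ k) - 3) * M4 k x (d x)) \<longlongrightarrow> 4 * (1 - \<alpha>) * \<kappa> k * (if k = j then \<beta> k else 0)) F"
  proof (cases "\<alpha> = 1")
    case False
    have "((\<lambda>x. M4 k x (W x $ k)) \<longlongrightarrow> \<beta> k) F" using M4_tendsto[OF W_row_tendsto False, of k k] by simp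
    then show ?thesis by (intro tendsto_mult tendsto_diff tendsto_const M4_tendsto assms False)
  qed simp
  have "((\<lambda>x. T k x \<bullet> d x) \<longlongrightarrow> 3 * \<alpha> * \<gamma> k * (if k = j then \<gamma> k else 0) + 4 * (1 - \<alpha>) * \<kappa> k * (if k = j then \<beta> k else 0)) F"
    unfolding T_inner by (intro tendsto_add 3 4)
  then show ?thesis by (cases "k = j") (simp_all add: lam_def power2_eq_square mult_ac)
qed

text \<open>The row error enters linearly only with third moments containing two different indices,
  and these tend to 0. Centering contributes \<open>- am [l] x * am [k, k] x\<close>, that is,
  \<open>- am [l] x\<close> to first order: this is the subtracted 1 in
  \<open>r_hat\<close>.\<close>

lemma M3_expand:
  assumes kl: "k \<noteq> l"
  shows "(\<lambda>x. M3 k x (axis l 1) - rh k l x) \<in> o[F](Q)"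
proof -
  have eq: "M3 k x (axis l 1) = cm [k, k, l] x + 2 * (\<Sum>a\<in>UNIV. h k a x * cm [a, k, l] x)
      + (\<Sum>a\<in>UNIV. h k a x * (\<Sum>b\<in>UNIV. h k b x * cm [a, b, l] x))" for x
  proof -
    have w: "W x $ k \<bullet> X x i = X x i $ k + H k x \<bullet> X x i" "axis l 1 \<bullet> X x i = X x i $ l" for i
      by (simp_all add: H_def inner_diff_left inner_axis')
    have "M3 k x (axis l 1) = (\<Sum>i<fst x. X x i $ k * (X x i $ k * X x i $ l)
        + 2 * ((H k x \<bullet> X x i) * (X x i $ k * X x i $ l)) + (H k x \<bullet> X x i) * ((H k x \<bullet> X x i) * X x i $ l)) / real (fst x)"
      unfolding M3_def w by (intro arg_cong2[where f = "(/)"] sum.cong refl) (simp add: power2_eq_square algebra_simps)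
    also have "\<dots> = cm [k, k, l] x + 2 * ((\<Sum>i<fst x. (H k x \<bullet> X x i) * (X x i $ k * X x i $ l)) / real (fst x))
        + (\<Sum>i<fst x. (H k x \<bullet> X x i) * ((H k x \<bullet> X x i) * X x i $ l)) / real (fst x)"
      by (simp add: sum.distrib sum_distrib_left add_divide_distrib cm_def)
    also have "(\<Sum>i<fst x. (H k x \<bullet> X x i) * (X x i $ k * X x i $ l)) / real (fst x) = (\<Sum>a\<in>UNIV. h k a x * cm [a, k, l] x)"
      by (simp add: avg_inner_linear H_nth cm_def)
    also have "(\<Sum>i<fst x. (H k x \<bullet> X x i) * ((H k x \<bullet> X x i) * X x i $ l)) / real (fst x) =
        (\<Sum>a\<in>UNIV. h k a x * (\<Sum>b\<in>UNIV. h k b x * cm [a, b, l] x))"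
    proof -
      have "(\<Sum>i<fst x. (H k x \<bullet> X x i) * ((H k x \<bullet> X x i) * (axis l 1 \<bullet> X x i))) / real (fst x) =
        (\<Sum>a\<in>UNIV. h k a x * (\<Sum>b\<in>UNIV. h k b x * cm [a, b, l] x))"
        unfolding avg_inner3 by (simp add: sum_axis H_nth)
      then show ?thesis by (simp add: w)
    qed
    finally show ?thesis .
  qed
  have "((\<lambda>x. \<Sum>b\<in>UNIV. h k b x * cm [a, b, l] x) \<longlongrightarrow> (\<Sum>b\<in>UNIV. 0 * (if a = b \<and> b = l then \<gamma> a else 0))) F" for a
    by (intro tendsto_sum tendsto_mult h_tendsto cm3)
  then have quad: "((\<lambda>x. \<Sum>b\<in>UNIV. h k b x * cm [a, b, l] x) \<longlongrightarrow> 0) F" for a by simp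
  have lin: "(cm [a, k, l] \<longlongrightarrow> 0) F" for a using cm3[of a k l] kl by simp
  have am2': "(am [k, l] \<longlongrightarrow> 0) F" using am2[of k l] kl by simp
  have sdt: "(sd k k \<longlongrightarrow> 0) F" using LIM_zero[OF am2[of k k]] by (simp add: sd_def[abs_def])
  have "(\<lambda>x. 2 * (\<Sum>a\<in>UNIV. h k a x * cm [a, k, l] x) + (\<Sum>a\<in>UNIV. h k a x * (\<Sum>b\<in>UNIV. h k b x * cm [a, b, l] x))
      - 2 * (am [k] x * am [k, l] x) - am [l] x * sd k k x + 2 * (am [l] x * (am [k] x * am [k] x))) \<in> o[F](Q)"
    by (intro sum_in_smallo smallo_cmult big_sum_in_smallo bigo_mult_tendsto_0 h_bigo Q_bigo lin quad am2' sdt tendsto_mult_zero am1)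
  then show ?thesis
    by (rule smallo_eventually_eq)
       (use whp_pos in eventually_elim, simp add: eq cm3_eq rh_def sd_def algebra_simps)
qed

text \<open>Of the linear terms only \<open>a = l\<close> survives, with the mixed moment 1 and
  three positions for the error, hence \<open>3 * h k l x\<close>. Centering contributes
  \<open>- \<gamma> k * am [l] x\<close>, the correction inside \<open>q_hat\<close>. The factor
  \<open>1 - \<alpha>\<close> makes the claim trivial at weight 1.\<close>

lemma M4_expand:
  assumes kl: "k \<noteq> l"
  shows "(\<lambda>x. (1 - \<alpha>) * M4 k x (axis l 1) - (1 - \<alpha>) * (qh k l x + 3 * h k l x)) \<in> o[F](Q)"
proof (cases "\<alpha> = 1")
  case False
  have eq: "M4 k x (axis l 1) = cm [k, k, k, l] x + 3 * (\<Sum>a\<in>UNIV. h k a x * cm [a, k, k, l] x)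
      + 3 * (\<Sum>a\<in>UNIV. h k a x * (\<Sum>b\<in>UNIV. h k b x * cm [a, b, k, l] x))
      + (\<Sum>a\<in>UNIV. h k a x * (\<Sum>b\<in>UNIV. h k b x * (\<Sum>c\<in>UNIV. h k c x * cm [a, b, c, l] x)))" for x
  proof -
    have w: "W x $ k \<bullet> X x i = X x i $ k + H k x \<bullet> X x i" "axis b 1 \<bullet> X x i = X x i $ b" for i b
      by (simp_all add: H_def inner_diff_left inner_axis')
    have "M4 k x (axis l 1) = (\<Sum>i<fst x. X x i $ k * (X x i $ k * (X x i $ k * X x i $ l))
        + 3 * ((H k x \<bullet> X x i) * (X x i $ k * (X x i $ k * X x i $ l)))
        + 3 * ((H k x \<bullet> X x i) * ((H k x \<bullet> X x i) * (X x i $ k * X x i $ l)))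
        + (H k x \<bullet> X x i) * ((H k x \<bullet> X x i) * ((H k x \<bullet> X x i) * X x i $ l))) / real (fst x)"
      unfolding M4_def w by (intro arg_cong2[where f = "(/)"] sum.cong refl) (simp add: power3_eq_cube algebra_simps)
    also have "\<dots> = cm [k, k, k, l] x + 3 * ((\<Sum>i<fst x. (H k x \<bullet> X x i) * (X x i $ k * (X x i $ k * X x i $ l))) / real (fst x))
        + 3 * ((\<Sum>i<fst x. (H k x \<bullet> X x i) * ((H k x \<bullet> X x i) * (X x i $ k * X x i $ l))) / real (fst x))
        + (\<Sum>i<fst x. (H k x \<bullet> X x i) * ((H k x \<bullet> X x i) * ((H k x \<bullet> X x i) * X x i $ l))) / real (fst x)"
      by (simp add: sum.distrib sum_distrib_left add_divide_distrib cm_def)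
    also have "(\<Sum>i<fst x. (H k x \<bullet> X x i) * (X x i $ k * (X x i $ k * X x i $ l))) / real (fst x) = (\<Sum>a\<in>UNIV. h k a x * cm [a, k, k, l] x)"
      by (simp add: avg_inner_linear H_nth cm_def)
    also have "(\<Sum>i<fst x. (H k x \<bullet> X x i) * ((H k x \<bullet> X x i) * (X x i $ k * X x i $ l))) / real (fst x) =
        (\<Sum>a\<in>UNIV. h k a x * (\<Sum>b\<in>UNIV. h k b x * cm [a, b, k, l] x))"
    proof -
      have "(\<Sum>i<fst x. (H k x \<bullet> X x i) * ((H k x \<bullet> X x i) * ((axis k 1 \<bullet> X x i) * (axis l 1 \<bullet> X x i)))) / real (fst x) =
        (\<Sum>a\<in>UNIV. h k a x * (\<Sum>b\<in>UNIV. h k b x * cm [a, b, k, l] x))"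
        unfolding avg_inner4 by (simp add: sum_axis H_nth)
      then show ?thesis by (simp add: w)
    qed
    also have "(\<Sum>i<fst x. (H k x \<bullet> X x i) * ((H k x \<bullet> X x i) * ((H k x \<bullet> X x i) * X x i $ l))) / real (fst x) =
        (\<Sum>a\<in>UNIV. h k a x * (\<Sum>b\<in>UNIV. h k b x * (\<Sum>c\<in>UNIV. h k c x * cm [a, b, c, l] x)))"
    proof -
      have "(\<Sum>i<fst x. (H k x \<bullet> X x i) * ((H k x \<bullet> X x i) * ((H k x \<bullet> X x i) * (axis l 1 \<bullet> X x i)))) / real (fst x) =
        (\<Sum>a\<in>UNIV. h k a x * (\<Sum>b\<in>UNIV. h k b x * (\<Sum>c\<in>UNIV. h k c x * cm [a, b, c, l] x)))"
        unfolding avg_inner4 by (simp add: sum_axis H_nth)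
      then show ?thesis by (simp add: w)
    qed
    finally show ?thesis .
  qed
  note cm4 = cm4[OF False]
  have "((\<lambda>x. \<Sum>b\<in>UNIV. h k b x * cm [a, b, k, l] x) \<longlongrightarrow> (\<Sum>b\<in>UNIV. 0 * (m4 a b k l))) F" for a
    by (intro tendsto_sum tendsto_mult h_tendsto cm4)
  then have quad: "((\<lambda>x. \<Sum>b\<in>UNIV. h k b x * cm [a, b, k, l] x) \<longlongrightarrow> 0) F" for a by simp
  have "((\<lambda>x. \<Sum>b\<in>UNIV. h k b x * (\<Sum>c\<in>UNIV. h k c x * cm [a, b, c, l] x)) \<longlongrightarrow> (\<Sum>b\<in>UNIV. 0 * (\<Sum>c\<in>UNIV. 0 * (m4 a b c l)))) F" for a
    by (intro tendsto_sum tendsto_mult h_tendsto cm4)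
  then have cub: "((\<lambda>x. \<Sum>b\<in>UNIV. h k b x * (\<Sum>c\<in>UNIV. h k c x * cm [a, b, c, l] x)) \<longlongrightarrow> 0) F" for a by simp
  have "(cm [a, k, k, l] \<longlongrightarrow> kd a l) F" for a using cm4[of a k k l] kl by simp
  then have lin: "((\<lambda>x. cm [a, k, k, l] x - kd a l) \<longlongrightarrow> 0) F" for a by (rule LIM_zero)
  have am3: "(am [k, k, l] \<longlongrightarrow> 0) F" "((\<lambda>x. am [k, k, k] x - \<gamma> k) \<longlongrightarrow> 0) F"
    using am3[of k k l] LIM_zero[OF am3[of k k k]] kl by simp_all
  have kkl: "((\<lambda>x. am [k] x * am [k, l] x) \<longlongrightarrow> 0) F" "((\<lambda>x. am [l] x * am [k, k] x) \<longlongrightarrow> 0) F"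
    using tendsto_mult[OF am1 am2, of k k l] tendsto_mult[OF am1 am2, of l k k] by simp_all
  have kkkl: "((\<lambda>x. am [k] x * (am [k] x * am [l] x)) \<longlongrightarrow> 0) F"
    by (intro tendsto_mult_zero am1)
  have "(\<lambda>x. 3 * (\<Sum>a\<in>UNIV. h k a x * (cm [a, k, k, l] x - kd a l))
      + 3 * (\<Sum>a\<in>UNIV. h k a x * (\<Sum>b\<in>UNIV. h k b x * cm [a, b, k, l] x))
      + (\<Sum>a\<in>UNIV. h k a x * (\<Sum>b\<in>UNIV. h k b x * (\<Sum>c\<in>UNIV. h k c x * cm [a, b, c, l] x)))
      - 3 * (am [k] x * am [k, k, l] x) - am [l] x * (am [k, k, k] x - \<gamma> k)
      + 3 * (am [k] x * (am [k] x * am [k, l] x)) + 3 * (am [k] x * (am [l] x * am [k, k] x))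
      - 3 * (am [k] x * (am [k] x * (am [k] x * am [l] x)))) \<in> o[F](Q)"
    by (intro sum_in_smallo smallo_cmult big_sum_in_smallo bigo_mult_tendsto_0 h_bigo Q_bigo lin quad cub am3 kkl kkkl)
  then have "(\<lambda>x. M4 k x (axis l 1) - (qh k l x + 3 * h k l x)) \<in> o[F](Q)"
  proof (rule smallo_eventually_eq)
    have sum: "(\<Sum>a\<in>UNIV. h k a x * (cm [a, k, k, l] x - kd a l)) = (\<Sum>a\<in>UNIV. h k a x * cm [a, k, k, l] x) - h k l x" for x
      by (simp add: right_diff_distrib sum_subtractf if_distrib[of "\<lambda>t. _ * t"] cong: if_cong)
    show "\<forall>\<^sub>F x in F. M4 k x (axis l 1) - (qh k l x + 3 * h k l x) =
      3 * (\<Sum>a\<in>UNIV. h k a x * (cm [a, k, k, l] x - kd a l))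
      + 3 * (\<Sum>a\<in>UNIV. h k a x * (\<Sum>b\<in>UNIV. h k b x * cm [a, b, k, l] x))
      + (\<Sum>a\<in>UNIV. h k a x * (\<Sum>b\<in>UNIV. h k b x * (\<Sum>c\<in>UNIV. h k c x * cm [a, b, c, l] x)))
      - 3 * (am [k] x * am [k, k, l] x) - am [l] x * (am [k, k, k] x - \<gamma> k)
      + 3 * (am [k] x * (am [k] x * am [k, l] x)) + 3 * (am [k] x * (am [l] x * am [k, k] x))
      - 3 * (am [k] x * (am [k] x * (am [k] x * am [l] x)))"
      using whp_pos by eventually_elim (simp add: eq cm4_eq[of _ k k k l] qh_def sum right_diff_distrib[of "am [l] _"] mult.commute[of "\<gamma> k"])
  qed
  from smallo_cmult[OF this, of "1 - \<alpha>"] show ?thesis by (simp add: algebra_simps)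
qed simp

section \<open>Solving for the entries above the diagonal\<close>

definition den :: "'p \<Rightarrow> real" where
  "den k = 3 * \<alpha> * (\<gamma> k)\<^sup>2 + 4 * (1 - \<alpha>) * (\<kappa> k)\<^sup>2"

definition psi :: "'p \<Rightarrow> 'p \<Rightarrow> nat \<times> 'w \<Rightarrow> real" where
  "psi k l x = 3 * \<alpha> * (\<gamma> k * rh k l x - (\<gamma> k)\<^sup>2 * sd k l x)
     + 4 * (\<kappa> k * ((1 - \<alpha>) * qh k l x) - (1 - \<alpha>) * \<kappa> k * \<beta> k * sd k l x)"

lemma psi_bigo: "k \<noteq> l \<Longrightarrow> psi k l \<in> O[F](R)"
  unfolding psi_def[abs_def] by (intro sum_in_bigo bigo_cmult R_bigo)

text \<open>Off the diagonal the factor linear in \<open>d\<close> is of order \<open>Q\<close>, so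
  the cumulant factor may be replaced by its limit at the cost of \<open>o(Q)\<close>.\<close>

lemma T_expand:
  assumes kl: "k \<noteq> l"
  shows "(\<lambda>x. T k x $ l - (3 * \<alpha> * (\<gamma> k * rh k l x) + 4 * (\<kappa> k * ((1 - \<alpha>) * (qh k l x + 3 * h k l x))))) \<in> o[F](Q)"
proof -
  have m3: "((\<lambda>x. M3 k x (W x $ k)) \<longlongrightarrow> \<gamma> k) F" using M3_tendsto[OF W_row_tendsto, of k k] by simp
  have A: "(\<lambda>x. rh k l x * (M3 k x (W x $ k) - \<gamma> k)) \<in> o[F](Q)"
    by (intro bigo_mult_tendsto_0 Q_bigo kl LIM_zero m3)
  have B: "(\<lambda>x. (M3 k x (axis l 1) - rh k l x) * M3 k x (W x $ k)) \<in> o[F](Q)"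
    by (rule smallo_mult_tendsto[OF M3_expand[OF kl] m3])
  have C: "(\<lambda>x. (1 - \<alpha>) * (qh k l x + 3 * h k l x) * (M4 k x (W x $ k) - \<beta> k)) \<in> o[F](Q)
    \<and> (\<lambda>x. ((1 - \<alpha>) * M4 k x (axis l 1) - (1 - \<alpha>) * (qh k l x + 3 * h k l x)) * (M4 k x (W x $ k) - 3)) \<in> o[F](Q)"
  proof (cases "\<alpha> = 1")
    case False
    have m4: "((\<lambda>x. M4 k x (W x $ k)) \<longlongrightarrow> \<beta> k) F" using M4_tendsto[OF W_row_tendsto False, of k k] by simp
    have "(\<lambda>x. (1 - \<alpha>) * qh k l x + (1 - \<alpha>) * (3 * h k l x)) \<in> O[F](Q)"
      by (intro sum_in_bigo Q_bigo kl bigo_cmult h_bigo)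
    then have "(\<lambda>x. (1 - \<alpha>) * (qh k l x + 3 * h k l x)) \<in> O[F](Q)" by (simp add: distrib_left)
    then show ?thesis
      by (intro conjI bigo_mult_tendsto_0 LIM_zero m4 smallo_mult_tendsto[OF M4_expand[OF kl] tendsto_diff[OF m4 tendsto_const]])
  qed simp
  have "(\<lambda>x. 3 * \<alpha> * (rh k l x * (M3 k x (W x $ k) - \<gamma> k)) + 3 * \<alpha> * ((M3 k x (axis l 1) - rh k l x) * M3 k x (W x $ k))
    + 4 * ((1 - \<alpha>) * (qh k l x + 3 * h k l x) * (M4 k x (W x $ k) - \<beta> k))
    + 4 * (((1 - \<alpha>) * M4 k x (axis l 1) - (1 - \<alpha>) * (qh k l x + 3 * h k l x)) * (M4 k x (W x $ k) - 3))) \<in> o[F](Q)"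
    using C by (intro sum_in_smallo smallo_cmult A B) auto
  then show ?thesis
  proof (rule smallo_eventually_eq, intro always_eventually allI)
    fix x
    have "T k x $ l = T k x \<bullet> axis l 1" by (simp add: inner_axis)
    then show "T k x $ l - (3 * \<alpha> * (\<gamma> k * rh k l x) + 4 * (\<kappa> k * ((1 - \<alpha>) * (qh k l x + 3 * h k l x)))) =
      3 * \<alpha> * (rh k l x * (M3 k x (W x $ k) - \<gamma> k)) + 3 * \<alpha> * ((M3 k x (axis l 1) - rh k l x) * M3 k x (W x $ k))
    + 4 * ((1 - \<alpha>) * (qh k l x + 3 * h k l x) * (M4 k x (W x $ k) - \<beta> k))
    + 4 * (((1 - \<alpha>) * M4 k x (axis l 1) - (1 - \<alpha>) * (qh k l x + 3 * h k l x)) * (M4 k x (W x $ k) - 3))"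
      unfolding T_inner by (simp add: algebra_simps)
  qed
qed

lemma estimating_equation:
  assumes x: "standardizable (fst x) (\<lambda>i. Z i (snd x))" "snd x \<in> space M"
  shows "T k x $ l = (\<Sum>j\<in>{..k}. (T k x \<bullet> W x $ j) * CW j l x)"
proof -
  interpret st: standardizable "fst x" "\<lambda>i. Z i (snd x)" by (rule x(1))
  have eqs: "W x = Ux x ** st.S" "C x = st.C" "X x = st.x"
    using st.sample_root_eq by (simp_all add: W_def S_def C_def X_def st.C_def st.x_def)
  have "index_poly \<alpha> (fst x) st.y = sample_index x" by (simp add: sample_index_def st.sample_std_eq)
  then have rows: "\<And>k. row_choice \<rho> (index_poly \<alpha> (fst x) st.y) k (feasible_dirs (Ux x) k) (Ux x $ k)"
    using U_rows[OF x(2), of "fst x"] by simp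
  have "T k x = (\<Sum>j\<in>{..k}. (W x $ j \<bullet> T k x) *\<^sub>R (C x *v W x $ j))"
    unfolding T_def eqs
    by (rule st.unmixing_equations[OF U_orthogonal[OF x(2)] rows rho(2)])
  from arg_cong[OF this, of "\<lambda>v. v $ l"] show ?thesis by (simp add: CW_def inner_commute)
qed

text \<open>The right side of the equation contributes \<open>lam k * (h k l x + sd k l x)\<close>,
  the gradient contributes \<open>12 * (1 - \<alpha>) * \<kappa> k * h k l x\<close>. Collecting the
  unknown turns \<open>\<kappa> k * \<beta> k\<close> into the square of \<open>\<kappa> k\<close>
  in \<open>den k\<close>, while the covariance term keeps the coefficient
  \<open>lam k\<close>.\<close>

lemma upper_expansion:
  assumes kl: "k < l"
  shows "(\<lambda>x. den k * h k l x - psi k l x) \<in> o[F](Q)"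
proof -
  have big: "(\<lambda>x. h j l x + dC j l x + rem j l x) \<in> O[F](Q)" for j
    by (intro sum_in_bigo h_bigo dC_bigo landau_o.small_imp_big[OF rem_smallo])
  \<comment> \<open>Both factors are small: the multiplier of an earlier row tends to 0, and
    \<open>CW j l\<close> is of order \<open>Q\<close> because \<open>j < k < l\<close>.\<close>
  have low: "(\<lambda>x. (h j l x + dC j l x + rem j l x) * (T k x \<bullet> W x $ j)) \<in> o[F](Q)" if "j < k" for j
  proof (rule bigo_mult_tendsto_0[OF big])
    show "((\<lambda>x. T k x \<bullet> W x $ j) \<longlongrightarrow> 0) F" using T_inner_tendsto[OF W_row_tendsto, of k j] that by (simp add: less_imp_neq[symmetric] split: if_splits)
  qed
  have "((\<lambda>x. T k x \<bullet> W x $ k) \<longlongrightarrow> lam k) F" using T_inner_tendsto[OF W_row_tendsto, of k k] by simp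
  then have dia: "(\<lambda>x. (h k l x + dC k l x + rem k l x) * (T k x \<bullet> W x $ k - lam k)) \<in> o[F](Q)"
    by (intro bigo_mult_tendsto_0 big LIM_zero)
  have "k \<noteq> l" using kl by simp
  have "(\<lambda>x. (T k x $ l - (3 * \<alpha> * (\<gamma> k * rh k l x) + 4 * (\<kappa> k * ((1 - \<alpha>) * (qh k l x + 3 * h k l x)))))
      - (\<Sum>j\<in>{..<k}. (h j l x + dC j l x + rem j l x) * (T k x \<bullet> W x $ j))
      - (h k l x + dC k l x + rem k l x) * (T k x \<bullet> W x $ k - lam k)
      - lam k * ((dC k l x - sd k l x) + rem k l x)) \<in> o[F](Q)"
    by (intro sum_in_smallo(2)[OF sum_in_smallo(2)[OF sum_in_smallo(2)[OF T_expand[OF \<open>k \<noteq> l\<close>]]]] big_sum_in_smallo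
        smallo_cmult sum_in_smallo(1)[OF dC_sd rem_smallo] low dia) simp
  then show ?thesis
  proof (rule smallo_eventually_eq)
    show "\<forall>\<^sub>F x in F. den k * h k l x - psi k l x = (T k x $ l - (3 * \<alpha> * (\<gamma> k * rh k l x) + 4 * (\<kappa> k * ((1 - \<alpha>) * (qh k l x + 3 * h k l x)))))
      - (\<Sum>j\<in>{..<k}. (h j l x + dC j l x + rem j l x) * (T k x \<bullet> W x $ j))
      - (h k l x + dC k l x + rem k l x) * (T k x \<bullet> W x $ k - lam k)
      - lam k * ((dC k l x - sd k l x) + rem k l x)"
      using eventually_good
    proof eventually_elim
      case (elim x)
      have "T k x $ l = (\<Sum>j\<in>insert k {..<k}. (T k x \<bullet> W x $ j) * CW j l x)"
        using estimating_equation[of x k l] elim by (simp add: lessThan_Suc_atMost ivl_disj_un_singleton(2)[symmetric])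
      also have "\<dots> = (T k x \<bullet> W x $ k) * CW k l x + (\<Sum>j\<in>{..<k}. (T k x \<bullet> W x $ j) * CW j l x)" by simp
      also have "(\<Sum>j\<in>{..<k}. (T k x \<bullet> W x $ j) * CW j l x) = (\<Sum>j\<in>{..<k}. (h j l x + dC j l x + rem j l x) * (T k x \<bullet> W x $ j))"
        using kl by (intro sum.cong refl) (auto simp: CW_eq)
      also have "CW k l x = h k l x + dC k l x + rem k l x" using kl by (simp add: CW_eq)
      finally have "T k x $ l = (T k x \<bullet> W x $ k) * (h k l x + dC k l x + rem k l x)
        + (\<Sum>j\<in>{..<k}. (h j l x + dC j l x + rem j l x) * (T k x \<bullet> W x $ j))" .
      then show ?case
        by (simp add: psi_def den_def lam_def power2_eq_square algebra_simps)
    qed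
  qed
qed

text \<open>All entries of the estimation error are of the order of \<open>R\<close>, up to a small fraction of
  the error itself, which can be absorbed.\<close>

lemma Q_bigo_R:
  assumes den: "\<And>k l. k < l \<Longrightarrow> den k \<noteq> 0"
  shows "Q \<in> O[F](R)"
proof -
  have ex: "\<exists>g. g \<in> O[F](R) \<and> (\<lambda>x. h k l x - g x) \<in> o[F](Q)" for k l
  proof -
    have up: "\<exists>g. g \<in> O[F](R) \<and> (\<lambda>x. h k l x - g x) \<in> o[F](Q)" if "k < l" for k l
    proof (intro exI conjI)
      show "(\<lambda>x. (1 / den k) * psi k l x) \<in> O[F](R)" using that by (intro bigo_cmult psi_bigo) auto
      have "(\<lambda>x. (1 / den k) * (den k * h k l x - psi k l x)) \<in> o[F](Q)"
        by (intro smallo_cmult upper_expansion that)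
      then show "(\<lambda>x. h k l x - (1 / den k) * psi k l x) \<in> o[F](Q)"
        using den[OF that] by (simp add: right_diff_distrib)
    qed
    consider "k < l" | "l < k" | "k = l" by (rule linorder_cases)
    then show ?thesis
    proof cases
      case 1
      then show ?thesis by (rule up)
    next
      case 2
      from up[OF this] obtain g where g: "g \<in> O[F](R)" "(\<lambda>x. h l k x - g x) \<in> o[F](Q)" by blast
      \<comment> \<open>Below the diagonal the linearized orthonormality is solved using the entry
        already found above it.\<close>
      have "(\<lambda>x. - g x - sd k l x) \<in> O[F](R)" using g(1) by (intro sum_in_bigo R_bigo) simp
      moreover have "(\<lambda>x. (h k l x + h l k x + sd k l x) - (h l k x - g x)) \<in> o[F](Q)"
        by (rule sum_in_smallo(2)[OF symmetric_part g(2)])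
      then have "(\<lambda>x. h k l x - (- g x - sd k l x)) \<in> o[F](Q)" by (simp add: algebra_simps)
      ultimately show ?thesis by blast
    next
      case 3
      have "(\<lambda>x. (-1/2) * sd k k x) \<in> O[F](R)" by (intro bigo_cmult R_bigo)
      moreover have "(\<lambda>x. (1/2) * (h k k x + h k k x + sd k k x)) \<in> o[F](Q)" by (intro smallo_cmult symmetric_part)
      then have "(\<lambda>x. h k k x - (-1/2) * sd k k x) \<in> o[F](Q)" by (simp add: algebra_simps)
      ultimately show ?thesis using 3 by blast
    qed
  qed
  then have "\<forall>k. \<exists>f. \<forall>l. f l \<in> O[F](R) \<and> (\<lambda>x. h k l x - f l x) \<in> o[F](Q)" by (intro allI choice) blast
  then obtain g where g: "\<And>k l. g k l \<in> O[F](R)" "\<And>k l. (\<lambda>x. h k l x - g k l x) \<in> o[F](Q)"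
    using choice by metis
  define G where "G x = R x + (\<Sum>k\<in>UNIV. \<Sum>l\<in>UNIV. \<bar>g k l x\<bar>)" for x
  define s where "s x = (\<Sum>k\<in>UNIV. \<Sum>l\<in>UNIV. \<bar>h k l x - g k l x\<bar>)" for x
  have G: "G \<in> O[F](R)" unfolding G_def using g(1)
    by (intro sum_in_bigo big_sum_in_bigo) auto
  have s: "s \<in> o[F](Q)" unfolding s_def using g(2) by (intro big_sum_in_smallo) auto
  have "\<forall>\<^sub>F x in F. norm (Q x) \<le> 2 * norm (G x)"
    \<comment> \<open>With constant one half, \<open>Q \<le> G + s\<close> leaves half of
      \<open>Q\<close> on the left.\<close>
    using landau_o.smallD[OF s, of "1/2"]
  proof (rule eventually_mono)
    show "1 / 2 > (0::real)" by simp
    fix x assume sx: "norm (s x) \<le> 1 / 2 * norm (Q x)"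
    have "(\<Sum>k\<in>UNIV. \<Sum>l\<in>UNIV. \<bar>h k l x\<bar>) \<le> (\<Sum>k\<in>UNIV. \<Sum>l\<in>UNIV. \<bar>g k l x\<bar> + \<bar>h k l x - g k l x\<bar>)"
      by (intro sum_mono) linarith
    then have "Q x \<le> G x + s x" by (simp add: Q_def G_def s_def sum.distrib)
    moreover have "0 \<le> Q x" using R_le_Q(1)[of x] R_bounds(5)[of x] by linarith
    ultimately show "norm (Q x) \<le> 2 * norm (G x)" using sx by (simp add: abs_if split: if_splits)
  qed
  then have "Q \<in> O[F](G)" by (rule landau_o.bigI[rotated]) simp
  then show ?thesis using G by (rule landau_o.big_trans)
qed

section \<open>Order of the error in probability\<close>

lemma R_stoch_bounded: "stoch_bounded M (\<lambda>n \<omega>. sqrt (real n) * R (n, \<omega>))"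
proof -
  have int: "integrable N (\<lambda>v. monom_vec xs (z v))" if "length xs \<le> 2 * deg" for xs
    using that by (intro monomial_moment(1)[OF deg_moments])
  have sq: "integrable N (\<lambda>v. (monom_vec xs (z v) - c * monom_vec ys (z v))\<^sup>2)"
    if "length xs \<le> deg" "length ys \<le> deg" for xs ys c
  proof -
    have "(monom_vec xs v - c * monom_vec ys v)\<^sup>2 = monom_vec (xs @ xs) v - 2 * c * monom_vec (xs @ ys) v + c\<^sup>2 * monom_vec (ys @ ys) v" for v
      by (simp add: monom_vec_append power2_eq_square algebra_simps)
    then show ?thesis using int that by simp
  qed
  \<comment> \<open>All summands of \<open>R\<close> share this shape: a monomial minus a multiple
    of another one with the same mean. A constant is the empty monomial, and multiplier 0 covers a
    single monomial.\<close>
  have bd: "stoch_bounded M (\<lambda>n \<omega>. sqrt (real n) * (am xs (n, \<omega>) - c * am ys (n, \<omega>)))"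
    if "length xs \<le> deg" "length ys \<le> deg" "(\<Prod>k\<in>set xs. mom k (count_list xs k)) = c * (\<Prod>k\<in>set ys. mom k (count_list ys k))" for xs ys c
  proof -
    have "stoch_bounded M (\<lambda>n \<omega>. sqrt (real n) * avg n (\<lambda>v. monom_vec xs v - c * monom_vec ys v) \<omega>)"
    proof (rule avg_stoch_bounded)
      show "integrable N (\<lambda>v. (monom_vec xs (z v) - c * monom_vec ys (z v))\<^sup>2)" by (rule sq) (use that in auto)
      show "(LINT v|N. monom_vec xs (z v) - c * monom_vec ys (z v)) = 0"
        using that int by (simp add: monomial_expectation)
    qed measurable
    then show ?thesis
      by (simp add: am_def avg_def sum_subtractf sum_distrib_left diff_divide_distrib)
  qed
  have 1: "stoch_bounded M (\<lambda>n \<omega>. sqrt (real n) * am [a] (n, \<omega>))" for a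
    using bd[of "[a]" "[a]" 0] deg3 by (simp add: mom_simps)
  \<comment> \<open>The average of the constant 1 is 0 for an empty sample; the factor
    \<open>sqrt (real n)\<close> conceals this.\<close>
  have one: "am [] (n, \<omega>) = 1 \<or> n = 0" for n \<omega> by (simp add: am_list)
  have 2: "stoch_bounded M (\<lambda>n \<omega>. sqrt (real n) * sd a b (n, \<omega>))" for a b
  proof -
    have "stoch_bounded M (\<lambda>n \<omega>. sqrt (real n) * (am [a, b] (n, \<omega>) - kd a b * am [] (n, \<omega>)))"
      using deg3 by (intro bd) (simp_all add: mom_simps)
    also have "(\<lambda>n \<omega>. sqrt (real n) * (am [a, b] (n, \<omega>) - kd a b * am [] (n, \<omega>))) = (\<lambda>n \<omega>. sqrt (real n) * sd a b (n, \<omega>))"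
      using one by (fastforce simp: fun_eq_iff sd_def)
    finally show ?thesis .
  qed
  have 3: "stoch_bounded M (\<lambda>n \<omega>. sqrt (real n) * rh a b (n, \<omega>))" if "a \<noteq> b" for a b
    using bd[of "[a, a, b]" "[b]" 1] deg3 that by (simp add: mom_simps rh_def)
  have 4: "stoch_bounded M (\<lambda>n \<omega>. sqrt (real n) * ((1 - \<alpha>) * qh a b (n, \<omega>)))" if "a \<noteq> b" for a b
  proof (cases "\<alpha> = 1")
    case True
    then show ?thesis using M.stoch_bounded_const[of 0] by simp
  next
    case False
    have "stoch_bounded M (\<lambda>n \<omega>. sqrt (real n) * qh a b (n, \<omega>))"
      using bd[of "[a, a, a, b]" "[b]" "\<gamma> a"] deg4[OF False] that by (simp add: mom_simps qh_def)
    from M.stoch_bounded_cmult[OF this, of "1 - \<alpha>"] show ?thesis by (simp add: mult_ac)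
  qed
  have "stoch_bounded M (\<lambda>n \<omega>. (\<Sum>a\<in>UNIV. \<bar>sqrt (real n) * am [a] (n, \<omega>)\<bar>)
    + (\<Sum>a\<in>UNIV. \<Sum>b\<in>UNIV. \<bar>sqrt (real n) * sd a b (n, \<omega>)\<bar>)
    + (\<Sum>a\<in>UNIV. \<Sum>b\<in>-{a}. \<bar>sqrt (real n) * rh a b (n, \<omega>)\<bar>)
    + (\<Sum>a\<in>UNIV. \<Sum>b\<in>-{a}. \<bar>sqrt (real n) * ((1 - \<alpha>) * qh a b (n, \<omega>))\<bar>))"
    by (intro M.stoch_bounded_add M.stoch_bounded_sum M.stoch_bounded_abs 1 2 3 4) auto
  then show ?thesis by (simp add: R_def abs_mult sum_distrib_left distrib_left mult_ac)
qed

lemma scaled_smallo_tendsto: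
  assumes den: "\<And>k l. k < l \<Longrightarrow> den k \<noteq> 0" and f: "f \<in> o[F](Q)"
  shows "tendsto_prob M (\<lambda>n \<omega>. sqrt (real n) * f (n, \<omega>)) 0"
proof (rule M.tendsto_prob_whp)
  have "f \<in> o[F](R)" using f Q_bigo_R[OF den] by (rule landau_o.small_big_trans)
  from M.smallo_scaled_tendsto[OF this R_stoch_bounded]
  show "((\<lambda>x. sqrt (real (fst x)) * f (fst x, snd x)) \<longlongrightarrow> 0) F" by simp
qed

end

section \<open>Existence of the solutions\<close>

context deflation_sample
begin

lemma s_hat_am: "s_hat Z n k l \<omega> = am [k, l] (n, \<omega>)"
  by (simp add: s_hat_def am_list)

lemma r_hat_rh: "r_hat Z n k l \<omega> = rh k l (n, \<omega>)"
  by (simp add: r_hat_def rh_def am_list power2_eq_square left_diff_distrib sum_subtractf diff_divide_distrib mult.assoc)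

lemma q_hat_qh: "q_hat \<gamma> Z n k l \<omega> = qh k l (n, \<omega>)"
  by (simp add: q_hat_def qh_def am_list power3_eq_cube left_diff_distrib sum_subtractf diff_divide_distrib
      sum_distrib_left[symmetric] mult.assoc)

lemma limits:
  assumes den: "\<And>k l. k < l \<Longrightarrow> den k \<noteq> 0"
  shows "tendsto_prob M (\<lambda>n \<omega>. W (n, \<omega>)) (mat 1)"
    and "l < k \<Longrightarrow> eq_up_to_oP M (\<lambda>n \<omega>. sqrt (real n) * W (n, \<omega>) $ k $ l)
      (\<lambda>n \<omega>. - sqrt (real n) * W (n, \<omega>) $ l $ k - sqrt (real n) * s_hat Z n k l \<omega>)"
    and "eq_up_to_oP M (\<lambda>n \<omega>. sqrt (real n) * (W (n, \<omega>) $ k $ k - 1))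
      (\<lambda>n \<omega>. - (1 / 2) * sqrt (real n) * (s_hat Z n k k \<omega> - 1))"
    and "k < l \<Longrightarrow> eq_up_to_oP M (\<lambda>n \<omega>. sqrt (real n) * W (n, \<omega>) $ k $ l)
      (\<lambda>n \<omega>. (3 * \<alpha> * (sqrt (real n) * psi1_hat \<gamma> Z n k l \<omega>)
        + 4 * (1 - \<alpha>) * (sqrt (real n) * psi2_hat \<gamma> \<beta> Z n k l \<omega>)) / den k)"
proof -
  show "tendsto_prob M (\<lambda>n \<omega>. W (n, \<omega>)) (mat 1)"
    using W_tendsto by (intro M.tendsto_prob_whp) simp
  have small: "tendsto_prob M (\<lambda>n \<omega>. sqrt (real n) * f (n, \<omega>)) 0" if "f \<in> o[F](Q)" for f
    by (rule scaled_smallo_tendsto[OF den that])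
  show "eq_up_to_oP M (\<lambda>n \<omega>. sqrt (real n) * W (n, \<omega>) $ k $ l)
      (\<lambda>n \<omega>. - sqrt (real n) * W (n, \<omega>) $ l $ k - sqrt (real n) * s_hat Z n k l \<omega>)" if "l < k"
    using small[OF symmetric_part[of k l]] less_imp_neq[OF that] less_imp_neq[OF that, symmetric]
    by (simp add: eq_up_to_oP_def h_def sd_def s_hat_am algebra_simps)
  have "(\<lambda>x. (1 / 2) * (h k k x + h k k x + sd k k x)) \<in> o[F](Q)"
    by (intro smallo_cmult symmetric_part)
  from small[OF this]
  show "eq_up_to_oP M (\<lambda>n \<omega>. sqrt (real n) * (W (n, \<omega>) $ k $ k - 1))
      (\<lambda>n \<omega>. - (1 / 2) * sqrt (real n) * (s_hat Z n k k \<omega> - 1))"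
    by (simp add: eq_up_to_oP_def h_def sd_def s_hat_am algebra_simps)
  assume kl: "k < l"
  have "(\<lambda>x. (1 / den k) * (den k * h k l x - psi k l x)) \<in> o[F](Q)"
    by (intro smallo_cmult upper_expansion kl)
  from small[OF this]
  have *: "tendsto_prob M (\<lambda>n \<omega>. sqrt (real n) * ((1 / den k) * (den k * h k l (n, \<omega>) - psi k l (n, \<omega>)))) 0" by simp
  have psi: "psi k l (n, \<omega>) = 3 * \<alpha> * psi1_hat \<gamma> Z n k l \<omega> + 4 * (1 - \<alpha>) * psi2_hat \<gamma> \<beta> Z n k l \<omega>" for n \<omega>
    using less_imp_neq[OF kl] by (simp add: psi_def psi1_hat_def psi2_hat_def s_hat_am r_hat_rh q_hat_qh sd_def algebra_simps)
  have "sqrt (real n) * ((1 / den k) * (den k * h k l (n, \<omega>) - psi k l (n, \<omega>))) =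
     sqrt (real n) * W (n, \<omega>) $ k $ l - (3 * \<alpha> * (sqrt (real n) * psi1_hat \<gamma> Z n k l \<omega>)
        + 4 * (1 - \<alpha>) * (sqrt (real n) * psi2_hat \<gamma> \<beta> Z n k l \<omega>)) / den k" for n \<omega>
    unfolding psi using den[OF kl] kl by (simp add: h_def field_simps)
  with * show "eq_up_to_oP M (\<lambda>n \<omega>. sqrt (real n) * W (n, \<omega>) $ k $ l)
      (\<lambda>n \<omega>. (3 * \<alpha> * (sqrt (real n) * psi1_hat \<gamma> Z n k l \<omega>)
        + 4 * (1 - \<alpha>) * (sqrt (real n) * psi2_hat \<gamma> \<beta> Z n k l \<omega>)) / den k)"
    by (simp only: eq_up_to_oP_def)
qed

lemma solutions:
  assumes U_measurable: "\<And>n. U n \<in> borel_measurable M"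
  shows "sample_solutions M Z \<alpha> (\<lambda>n \<omega>. W (n, \<omega>))"
    and "(\<And>k. \<rho> k = 0) \<Longrightarrow> sample_maximizers M Z \<alpha> (\<lambda>n \<omega>. W (n, \<omega>))"
proof -
  have meas: "(\<lambda>\<omega>. W (n, \<omega>)) \<in> borel_measurable M" for n
    unfolding W_def S_def fst_conv snd_conv
    by (intro borel_measurable_matrix_mult U_measurable borel_measurable_sample_root Z_measurable)
  have st: "standardizable n (\<lambda>i. Z i \<omega>)" "W (n, \<omega>) = U n \<omega> ** standardizable.S n (\<lambda>i. Z i \<omega>)"
    "row_choice \<rho> (index_poly \<alpha> n (standardizable.y n (\<lambda>i. Z i \<omega>))) k (feasible_dirs (U n \<omega>) k) (U n \<omega> $ k)"
    if "\<omega> \<in> space M" "invertible (cov_mat (emp n) (\<lambda>i. Z i \<omega>))" for n \<omega> k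
  proof -
    interpret st: standardizable n "\<lambda>i. Z i \<omega>" using that(2) by unfold_locales
    show "standardizable n (\<lambda>i. Z i \<omega>)" by (rule st.standardizable_axioms)
    show "W (n, \<omega>) = U n \<omega> ** st.S" by (simp add: W_def S_def st.sample_root_eq)
    show "row_choice \<rho> (index_poly \<alpha> n st.y) k (feasible_dirs (U n \<omega>) k) (U n \<omega> $ k)"
      using U_rows[OF that(1), of n k] by (simp add: sample_index_def st.sample_std_eq)
  qed
  show "sample_solutions M Z \<alpha> (\<lambda>n \<omega>. W (n, \<omega>))"
    unfolding sample_solutions_def
    using meas standardizable.deflation_solution_emp[OF st(1) U_orthogonal st(3) rho(2)] st(2) by auto
  assume r0: "\<And>k. \<rho> k = 0"
  show "sample_maximizers M Z \<alpha> (\<lambda>n \<omega>. W (n, \<omega>))"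
    unfolding sample_maximizers_def
    using standardizable.deflation_maximizer_emp[OF st(1) U_orthogonal st(3) r0] st(2) by auto
qed

end

section \<open>Choice of the caps and assembly of the cases\<close>

abbreviation solution_limits where
  "solution_limits M Z \<alpha> \<gamma> \<beta> \<kappa> W \<equiv>
     tendsto_prob M W (mat 1) \<and>
     (\<forall>k l. l < k \<longrightarrow> eq_up_to_oP M (\<lambda>n \<omega>. sqrt (real n) * W n \<omega> $ k $ l)
        (\<lambda>n \<omega>. - sqrt (real n) * W n \<omega> $ l $ k - sqrt (real n) * s_hat Z n k l \<omega>)) \<and>
     (\<forall>k. eq_up_to_oP M (\<lambda>n \<omega>. sqrt (real n) * (W n \<omega> $ k $ k - 1))
        (\<lambda>n \<omega>. - (1 / 2) * sqrt (real n) * (s_hat Z n k k \<omega> - 1))) \<and>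
     (\<forall>k l. l > k \<longrightarrow> eq_up_to_oP M (\<lambda>n \<omega>. sqrt (real n) * W n \<omega> $ k $ l)
        (\<lambda>n \<omega>. (3 * \<alpha> * (sqrt (real n) * psi1_hat \<gamma> Z n k l \<omega>)
               + 4 * (1 - \<alpha>) * (sqrt (real n) * psi2_hat \<gamma> \<beta> Z n k l \<omega>))
              / (3 * \<alpha> * (\<gamma> k)\<^sup>2 + 4 * (1 - \<alpha>) * (\<kappa> k)\<^sup>2)))"

context ica_sample
begin

lemma solution_exists:
  assumes den: "\<forall>k l. k < l \<longrightarrow> 3 * \<alpha> * (\<gamma> k)\<^sup>2 + 4 * (1 - \<alpha>) * (\<kappa> k)\<^sup>2 \<noteq> 0"
  shows "\<exists>W. sample_solutions M Z \<alpha> W \<and>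
     ((\<forall>k l. k < l \<longrightarrow> \<alpha> * (\<gamma> l)\<^sup>2 + (1 - \<alpha>) * (\<kappa> l)\<^sup>2 < \<alpha> * (\<gamma> k)\<^sup>2 + (1 - \<alpha>) * (\<kappa> k)\<^sup>2) \<longrightarrow>
        sample_maximizers M Z \<alpha> W) \<and>
     solution_limits M Z \<alpha> \<gamma> \<beta> (\<lambda>k. \<kappa> k) W"
proof -
  define ordered where "ordered \<longleftrightarrow> (\<forall>k l. k < l \<longrightarrow> contrast l < contrast k)"
  \<comment> \<open>The inserted 0 gives the maximum a value for the last row and keeps the bound
    nonnegative.\<close>
  define B where "B k = Max (insert 0 (contrast ` {k<..}))" for k
  \<comment> \<open>With \<open>c = contrast k\<close> and \<open>B = B k\<close>, separation asks
    the square of \<open>\<rho> k\<close> to exceed \<open>(B - c) / (B + c)\<close>, and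
    \<open>B / (c + B)\<close> achieves it because \<open>B * B > B * B - c * c\<close>. With
    decreasing contrasts the threshold is negative and 0 is allowed, which yields global
    maximizers.\<close>
  define \<rho> where "\<rho> k = (if ordered then 0 else B k / (contrast k + B k))" for k
  have B0: "0 \<le> B k" for k unfolding B_def by (rule Max_ge) auto
  have Bi: "contrast i \<le> B k" if "k < i" for i k unfolding B_def using that by (intro Max_ge) auto
  \<comment> \<open>Both weights are nonnegative, so a vanishing contrast would make each summand of
    the denominator vanish.\<close>
  have pos: "0 < contrast k" if "k < i" for k i
  proof (rule ccontr)
    assume "\<not> 0 < contrast k"
    then have "contrast k = 0" using contrast_nonneg[of k] by simp
    moreover have "0 \<le> \<alpha> * (\<gamma> k)\<^sup>2" "0 \<le> (1 - \<alpha>) * (\<kappa> k)\<^sup>2" using alpha by auto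
    ultimately have "\<alpha> * (\<gamma> k)\<^sup>2 = 0" "(1 - \<alpha>) * (\<kappa> k)\<^sup>2 = 0" unfolding contrast_def by linarith+
    then show False using den that by auto
  qed
  have Blast: "B k = 0" if "\<And>i. \<not> k < i" for k
  proof -
    have "{k<..} = {}" using that by auto
    then show ?thesis by (simp add: B_def)
  qed
  have rho: "0 \<le> \<rho> k \<and> \<rho> k < 1 \<and> (\<forall>i. k < i \<longrightarrow> (1 - (\<rho> k)\<^sup>2) * (contrast k + B k) < 2 * contrast k)" for k
  proof (cases "\<exists>i. k < i")
    case True
    then have c: "0 < contrast k" using pos by blast
    show ?thesis
    proof (cases ordered)
      case True
      have "B k < contrast k" unfolding B_def using True c by (auto simp: ordered_def)
      then show ?thesis using True by (simp add: \<rho>_def)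
    next
      case False
      define c' where "c' = contrast k + B k"
      have c': "0 < c'" using c B0[of k] by (simp add: c'_def)
      have r: "\<rho> k = B k / c'" using False by (simp add: \<rho>_def c'_def)
      have "(1 - (B k / c')\<^sup>2) * c' = (c'\<^sup>2 - (B k)\<^sup>2) / c'"
        using c' by (simp add: field_simps power2_eq_square)
      also have "c'\<^sup>2 - (B k)\<^sup>2 = contrast k * (c' + B k)" by (simp add: c'_def power2_eq_square algebra_simps)
      also have "contrast k * (c' + B k) / c' < 2 * contrast k"
      proof -
        have "contrast k * (c' + B k) < contrast k * (2 * c')"
          using c by (intro mult_strict_left_mono) (simp_all add: c'_def)
        then show ?thesis using c' by (simp add: field_simps)
      qed
      finally show ?thesis unfolding r using c' B0[of k] c by (simp add: c'_def)
    qed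
  next
    case False
    \<comment> \<open>For the last row \<open>B k = 0\<close>, and the quotient is 0 even if its
      contrast is 0 as well, since \<open>0 / 0 = 0\<close>.\<close>
    then have "\<rho> k = 0" using Blast[of k] by (simp add: \<rho>_def)
    then show ?thesis using False by simp
  qed
  have "\<forall>n. \<exists>U. U \<in> borel_measurable M \<and> (\<forall>\<omega>\<in>space M. orthogonal_matrix (U \<omega>) \<and>
      (\<forall>k. row_choice \<rho> (sample_index (n, \<omega>)) k (feasible_dirs (U \<omega>) k) (U \<omega> $ k)))"
    unfolding sample_index_def fst_conv snd_conv
    by (intro allI measurable_row_choices caratheodory_index_poly Z_measurable)
  then obtain U where U: "\<forall>n. U n \<in> borel_measurable M \<and> (\<forall>\<omega>\<in>space M. orthogonal_matrix (U n \<omega>) \<and>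
      (\<forall>k. row_choice \<rho> (sample_index (n, \<omega>)) k (feasible_dirs (U n \<omega>) k) (U n \<omega> $ k)))"
    by (rule exE[OF choice])
  interpret deflation_sample N M z Z \<alpha> deg \<rho> B U
    using rho B0 Bi U by unfold_locales auto
  have den': "den k \<noteq> 0" if "k < l" for k l using den that unfolding den_def by blast
  note lims = limits[OF den', unfolded den_def]
  have max: "sample_maximizers M Z \<alpha> (\<lambda>n \<omega>. W (n, \<omega>))"
    if "\<forall>k l. k < l \<longrightarrow> \<alpha> * (\<gamma> l)\<^sup>2 + (1 - \<alpha>) * (\<kappa> l)\<^sup>2 < \<alpha> * (\<gamma> k)\<^sup>2 + (1 - \<alpha>) * (\<kappa> k)\<^sup>2"
  proof -
    have ordered using that by (simp add: ordered_def contrast_def)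
    then show ?thesis using U by (intro solutions(2)) (auto simp: \<rho>_def)
  qed
  show ?thesis
    by (rule exI[of _ "\<lambda>n \<omega>. W (n, \<omega>)"], intro conjI allI impI solutions(1) max lims) (use U in auto)
qed

end

theorem theorem4p1p2:
  fixes N :: "'v measure" and z :: "'v \<Rightarrow> real^('p::{finite,linorder})"
    and M :: "'w measure" and Z :: "nat \<Rightarrow> 'w \<Rightarrow> real^('p::{finite,linorder})"
    and \<gamma> \<beta> \<kappa> :: "'p \<Rightarrow> real"
  assumes "prob_space N" and "z \<in> borel_measurable N"
    and "prob_space.indep_vars N (\<lambda>_. borel) (\<lambda>k v. z v $ k) UNIV"
    and "\<And>k. (LINT v|N. z v $ k) = 0" and "\<And>k. (LINT v|N. (z v $ k)\<^sup>2) = 1"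
    and "prob_space M" and "prob_space.indep_vars M (\<lambda>_. borel) Z UNIV"
    and "\<And>i. distr M borel (Z i) = distr N borel z"
    and "\<And>k. \<gamma> k = (LINT v|N. (z v $ k) ^ 3)"
    and "\<And>k. \<beta> k = (LINT v|N. (z v $ k) ^ 4)"
    and "\<And>k. \<kappa> k = \<beta> k - 3"
  shows
    "((\<forall>k. integrable N (\<lambda>v. (z v $ k) ^ 6)) \<and>
        card {k. \<gamma> k = 0} \<le> 1 \<and> (\<forall>k l. k < l \<longrightarrow> \<gamma> k \<noteq> 0) \<longrightarrow>
        (\<exists>W. sample_solutions M Z 1 W \<and>
           ((\<forall>k l. k < l \<longrightarrow> (\<gamma> l)\<^sup>2 < (\<gamma> k)\<^sup>2) \<longrightarrow>
              sample_maximizers M Z 1 W) \<and>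
           tendsto_prob M W (mat 1) \<and>
           (\<forall>k l. l < k \<longrightarrow> eq_up_to_oP M (\<lambda>n \<omega>. sqrt (real n) * W n \<omega> $ k $ l)
              (\<lambda>n \<omega>. - sqrt (real n) * W n \<omega> $ l $ k - sqrt (real n) * s_hat Z n k l \<omega>)) \<and>
           (\<forall>k. eq_up_to_oP M (\<lambda>n \<omega>. sqrt (real n) * (W n \<omega> $ k $ k - 1))
              (\<lambda>n \<omega>. - (1 / 2) * sqrt (real n) * (s_hat Z n k k \<omega> - 1))) \<and>
           (\<forall>k l. l > k \<longrightarrow> eq_up_to_oP M (\<lambda>n \<omega>. sqrt (real n) * W n \<omega> $ k $ l)
              (\<lambda>n \<omega>. sqrt (real n) * psi1_hat \<gamma> Z n k l \<omega> / (\<gamma> k)\<^sup>2))))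
     \<and>
     ((\<forall>k. integrable N (\<lambda>v. (z v $ k) ^ 8)) \<and>
        card {k. \<kappa> k = 0} \<le> 1 \<and> (\<forall>k l. k < l \<longrightarrow> \<kappa> k \<noteq> 0) \<longrightarrow>
        (\<exists>W. sample_solutions M Z 0 W \<and>
           ((\<forall>k l. k < l \<longrightarrow> (\<kappa> l)\<^sup>2 < (\<kappa> k)\<^sup>2) \<longrightarrow>
              sample_maximizers M Z 0 W) \<and>
           tendsto_prob M W (mat 1) \<and>
           (\<forall>k l. l < k \<longrightarrow> eq_up_to_oP M (\<lambda>n \<omega>. sqrt (real n) * W n \<omega> $ k $ l)
              (\<lambda>n \<omega>. - sqrt (real n) * W n \<omega> $ l $ k - sqrt (real n) * s_hat Z n k l \<omega>)) \<and>
           (\<forall>k. eq_up_to_oP M (\<lambda>n \<omega>. sqrt (real n) * (W n \<omega> $ k $ k - 1))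
              (\<lambda>n \<omega>. - (1 / 2) * sqrt (real n) * (s_hat Z n k k \<omega> - 1))) \<and>
           (\<forall>k l. l > k \<longrightarrow> eq_up_to_oP M (\<lambda>n \<omega>. sqrt (real n) * W n \<omega> $ k $ l)
              (\<lambda>n \<omega>. sqrt (real n) * psi2_hat \<gamma> \<beta> Z n k l \<omega> / (\<kappa> k)\<^sup>2))))
     \<and>
     (\<forall>\<alpha>\<in>{0..1}.
        (\<forall>k. integrable N (\<lambda>v. (z v $ k) ^ 8)) \<and>
        card {k. \<gamma> k = 0 \<and> \<kappa> k = 0} \<le> 1 \<and>
        (\<forall>k l. k < l \<longrightarrow> 3 * \<alpha> * (\<gamma> k)\<^sup>2 + 4 * (1 - \<alpha>) * (\<kappa> k)\<^sup>2 \<noteq> 0) \<longrightarrow>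
        (\<exists>W. sample_solutions M Z \<alpha> W \<and>
           ((\<forall>k l. k < l \<longrightarrow> \<alpha> * (\<gamma> l)\<^sup>2 + (1 - \<alpha>) * (\<kappa> l)\<^sup>2
                < \<alpha> * (\<gamma> k)\<^sup>2 + (1 - \<alpha>) * (\<kappa> k)\<^sup>2) \<longrightarrow>
              sample_maximizers M Z \<alpha> W) \<and>
           tendsto_prob M W (mat 1) \<and>
           (\<forall>k l. l < k \<longrightarrow> eq_up_to_oP M (\<lambda>n \<omega>. sqrt (real n) * W n \<omega> $ k $ l)
              (\<lambda>n \<omega>. - sqrt (real n) * W n \<omega> $ l $ k - sqrt (real n) * s_hat Z n k l \<omega>)) \<and>
           (\<forall>k. eq_up_to_oP M (\<lambda>n \<omega>. sqrt (real n) * (W n \<omega> $ k $ k - 1))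
              (\<lambda>n \<omega>. - (1 / 2) * sqrt (real n) * (s_hat Z n k k \<omega> - 1))) \<and>
           (\<forall>k l. l > k \<longrightarrow> eq_up_to_oP M (\<lambda>n \<omega>. sqrt (real n) * W n \<omega> $ k $ l)
              (\<lambda>n \<omega>. (3 * \<alpha> * (sqrt (real n) * psi1_hat \<gamma> Z n k l \<omega>)
                     + 4 * (1 - \<alpha>) * (sqrt (real n) * psi2_hat \<gamma> \<beta> Z n k l \<omega>))
                    / (3 * \<alpha> * (\<gamma> k)\<^sup>2 + 4 * (1 - \<alpha>) * (\<kappa> k)\<^sup>2)))))"
proof -
  have \<gamma>: "\<gamma> = (\<lambda>k. LINT v|N. (z v $ k) ^ 3)" and \<beta>: "\<beta> = (\<lambda>k. LINT v|N. (z v $ k) ^ 4)"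
    and \<kappa>: "\<kappa> = (\<lambda>k. (LINT v|N. (z v $ k) ^ 4) - 3)"
    using assms(9,10,11) by auto
  interpret iid: iid_sample N M z Z
    using assms by (simp add: iid_sample_def iid_sample_axioms_def)
  \<comment> \<open>The weighted formula serves all weights; \<open>deg\<close> records whether
    sixth or eighth moments are at hand.\<close>
  have main: "\<exists>W. sample_solutions M Z \<alpha> W \<and>
     ((\<forall>k l. k < l \<longrightarrow> \<alpha> * (\<gamma> l)\<^sup>2 + (1 - \<alpha>) * (\<kappa> l)\<^sup>2 < \<alpha> * (\<gamma> k)\<^sup>2 + (1 - \<alpha>) * (\<kappa> k)\<^sup>2) \<longrightarrow>
        sample_maximizers M Z \<alpha> W) \<and>
     solution_limits M Z \<alpha> \<gamma> \<beta> \<kappa> W"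
    if "0 \<le> \<alpha>" "\<alpha> \<le> 1" "3 \<le> deg" "\<alpha> \<noteq> 1 \<Longrightarrow> 4 \<le> deg" "\<And>k. integrable N (\<lambda>v. (z v $ k) ^ (2 * deg))"
      "\<forall>k l. k < l \<longrightarrow> 3 * \<alpha> * (\<gamma> k)\<^sup>2 + 4 * (1 - \<alpha>) * (\<kappa> k)\<^sup>2 \<noteq> 0" for \<alpha> deg
  proof -
    interpret ica_sample N M z Z \<alpha> deg
      using assms(4,5) that by unfold_locales auto
    show ?thesis using solution_exists that(6) unfolding \<gamma> \<beta> \<kappa> mom_def by blast
  qed
  show ?thesis
    \<comment> \<open>At weight 1 the factor 3 cancels from the quotient, at weight 0 the factor
      4.\<close>
    using main[of 1 3] main[of 0 4] main[of _ 4] by auto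
qed

end
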